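(* Let $T_0, T_1$ be recursively enumerable theories extending $\mathbf{I\Sigma_1}$, and let $\tau_0(v)$, $\tau_1(v)$ be $\Sigma_1$ definitions of $T_0$ and $T_1$, respectively. Suppose $\mathrm{Th}(\mathbf{PA}) \subseteq \mathrm{Th}(T_0)$. If $\mathrm{QPL}_{\tau_0}(T_0) \subseteq \mathrm{QPL}_{\tau_1}(T_1)$, then for every $\Pi_1$ formula $\varphi(\vec{y})$, \[ T_1 \vdash \forall \vec{y}\,\bigl(\mathrm{Pr}_{\tau_1}(\ulcorner \varphi(\vec{\dot{y}})\urcorner) \to \mathrm{Pr}_{\tau_0}(\ulcorner \varphi(\vec{\dot{y}})\urcorner)\bigr). \]
   Context: $\mathcal{L}_A=\{0,S,+,\times,<,=\}$; a theory is a set of $\mathcal{L}_A$-sentences and $\mathrm{Th}(T)$ is the set of sentences provable in $T$. $\mathbf{PA}$ is Peano arithmetic; $\mathbf{I\Sigma_1}$ is $\mathbf{PA}$ with induction restricted to $\Sigma_1$ formulas. A formula $\tau(v)$ is a definition of $T$ if for every $n$, $\mathbb{N}\models\tau(\overline{n})$ iff $n$ is the Gödel number of an axiom of $T$. For a $\Sigma_1$ definition $\tau$, $\mathrm{Pr}_\tau(x)$ is the standard $\Sigma_1$ provability predicate for the theory defined by $\tau$. $\ulcorner\varphi(\vec{\dot{y}})\urcorner$ is the primitive recursive term giving the Gödel number of $\varphi(\overline{k_1},\dots,\overline{k_n})$ from the values of $\vec y$. Quantified modal language: first-order logic without function or constant symbols, plus $\Box,\Diamond$. An arithmetical interpretation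 $f$ maps each atomic modal formula $P(x_1,\dots,x_n)$ to an $\mathcal{L}_A$-formula $\varphi(x_1,\dots,x_n)$ with the same free variables, uniformly under renaming of variables. It extends to $f_\tau$: $f_\tau(\bot)$ is $0=\overline 1$; $f_\tau$ commutes with connectives and quantifiers; $f_\tau(\Box A(x_1,\dots,x_n))$ is $\mathrm{Pr}_\tau(\ulcorner f_\tau(A(\dot x_1,\dots,\dot x_n))\urcorner)$. $\mathrm{QPL}_\tau(T)$ is the set of modal sentences $A$ with $T\vdash f_\tau(A)$ for all arithmetical interpretations $f$. *)

theory Defs
  imports Main
begin

section \<open>Syntax of arithmetic\<close>

text \<open>
  Bound variables are de Bruijn indices: \<open>Var i\<close> below \<open>k\<close> quantifiers refers to one of them if
  \<open>i < k\<close> and to the free variable number \<open>i - k\<close> otherwise. The remaining connectives and the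
  existential quantifier are the usual classical abbreviations.
\<close>

datatype tm = Var nat | Zero | Succ tm | Plus tm tm | Times tm tm

datatype fm = Eq tm tm | Less tm tm | Neg fm | Imp fm fm | Forall fm

definition Conj :: "fm \<Rightarrow> fm \<Rightarrow> fm" where "Conj \<phi> \<psi> = Neg (Imp \<phi> (Neg \<psi>))"
definition Disj :: "fm \<Rightarrow> fm \<Rightarrow> fm" where "Disj \<phi> \<psi> = Imp (Neg \<phi>) \<psi>"
definition Iff :: "fm \<Rightarrow> fm \<Rightarrow> fm" where "Iff \<phi> \<psi> = Conj (Imp \<phi> \<psi>) (Imp \<psi> \<phi>)"
definition Exists :: "fm \<Rightarrow> fm" where "Exists \<phi> = Neg (Forall (Neg \<phi>))"

definition num :: "nat \<Rightarrow> tm" where "num n = (Succ ^^ n) Zero"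

definition Falsum :: fm where "Falsum = Eq Zero (num 1)"

primrec fvT :: "tm \<Rightarrow> nat set" where
  "fvT (Var i) = {i}"
| "fvT Zero = {}"
| "fvT (Succ t) = fvT t"
| "fvT (Plus s t) = fvT s \<union> fvT t"
| "fvT (Times s t) = fvT s \<union> fvT t"

primrec fv :: "fm \<Rightarrow> nat set" where
  "fv (Eq s t) = fvT s \<union> fvT t"
| "fv (Less s t) = fvT s \<union> fvT t"
| "fv (Neg \<phi>) = fv \<phi>"
| "fv (Imp \<phi> \<psi>) = fv \<phi> \<union> fv \<psi>"
| "fv (Forall \<phi>) = {i. Suc i \<in> fv \<phi>}"

definition sentence :: "fm \<Rightarrow> bool" where "sentence \<phi> \<longleftrightarrow> fv \<phi> = {}"

definition fv_bound :: "fm \<Rightarrow> nat" where "fv_bound \<phi> = (LEAST m. fv \<phi> \<subseteq> {..<m})"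

definition univ_closure :: "fm \<Rightarrow> fm" where "univ_closure \<phi> = (Forall ^^ fv_bound \<phi>) \<phi>"

text \<open>
  \<open>lift k\<close> renumbers for the insertion of a new variable \<open>k\<close>; \<open>subst k u\<close> replaces variable \<open>k\<close>
  by \<open>u\<close> and removes it from the numbering; \<open>ren \<rho>\<close> renames all free variables simultaneously.
\<close>

primrec liftT :: "nat \<Rightarrow> tm \<Rightarrow> tm" where
  "liftT k (Var i) = (if i < k then Var i else Var (Suc i))"
| "liftT k Zero = Zero"
| "liftT k (Succ t) = Succ (liftT k t)"
| "liftT k (Plus s t) = Plus (liftT k s) (liftT k t)"
| "liftT k (Times s t) = Times (liftT k s) (liftT k t)"

primrec lift :: "nat \<Rightarrow> fm \<Rightarrow> fm" where
  "lift k (Eq s t) = Eq (liftT k s) (liftT k t)"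
| "lift k (Less s t) = Less (liftT k s) (liftT k t)"
| "lift k (Neg \<phi>) = Neg (lift k \<phi>)"
| "lift k (Imp \<phi> \<psi>) = Imp (lift k \<phi>) (lift k \<psi>)"
| "lift k (Forall \<phi>) = Forall (lift (Suc k) \<phi>)"

primrec substT :: "nat \<Rightarrow> tm \<Rightarrow> tm \<Rightarrow> tm" where
  "substT k u (Var i) = (if i < k then Var i else if i = k then u else Var (i - 1))"
| "substT k u Zero = Zero"
| "substT k u (Succ t) = Succ (substT k u t)"
| "substT k u (Plus s t) = Plus (substT k u s) (substT k u t)"
| "substT k u (Times s t) = Times (substT k u s) (substT k u t)"

primrec subst :: "nat \<Rightarrow> tm \<Rightarrow> fm \<Rightarrow> fm" where
  "subst k u (Eq s t) = Eq (substT k u s) (substT k u t)"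
| "subst k u (Less s t) = Less (substT k u s) (substT k u t)"
| "subst k u (Neg \<phi>) = Neg (subst k u \<phi>)"
| "subst k u (Imp \<phi> \<psi>) = Imp (subst k u \<phi>) (subst k u \<psi>)"
| "subst k u (Forall \<phi>) = Forall (subst (Suc k) (liftT 0 u) \<phi>)"

primrec renT :: "(nat \<Rightarrow> nat) \<Rightarrow> tm \<Rightarrow> tm" where
  "renT \<rho> (Var i) = Var (\<rho> i)"
| "renT \<rho> Zero = Zero"
| "renT \<rho> (Succ t) = Succ (renT \<rho> t)"
| "renT \<rho> (Plus s t) = Plus (renT \<rho> s) (renT \<rho> t)"
| "renT \<rho> (Times s t) = Times (renT \<rho> s) (renT \<rho> t)"

primrec ren :: "(nat \<Rightarrow> nat) \<Rightarrow> fm \<Rightarrow> fm" where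
  "ren \<rho> (Eq s t) = Eq (renT \<rho> s) (renT \<rho> t)"
| "ren \<rho> (Less s t) = Less (renT \<rho> s) (renT \<rho> t)"
| "ren \<rho> (Neg \<phi>) = Neg (ren \<rho> \<phi>)"
| "ren \<rho> (Imp \<phi> \<psi>) = Imp (ren \<rho> \<phi>) (ren \<rho> \<psi>)"
| "ren \<rho> (Forall \<phi>) = Forall (ren (\<lambda>i. case i of 0 \<Rightarrow> 0 | Suc j \<Rightarrow> Suc (\<rho> j)) \<phi>)"

text \<open>Bounded quantifiers; the bound \<open>t\<close> lives outside the quantifier.\<close>

definition ForallB :: "tm \<Rightarrow> fm \<Rightarrow> fm" where
  "ForallB t \<phi> = Forall (Imp (Less (Var 0) (liftT 0 t)) \<phi>)"
definition ExistsB :: "tm \<Rightarrow> fm \<Rightarrow> fm" where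
  "ExistsB t \<phi> = Exists (Conj (Less (Var 0) (liftT 0 t)) \<phi>)"

inductive Delta0 :: "fm \<Rightarrow> bool" where
  "Delta0 (Eq s t)"
| "Delta0 (Less s t)"
| "Delta0 \<phi> \<Longrightarrow> Delta0 (Neg \<phi>)"
| "Delta0 \<phi> \<Longrightarrow> Delta0 \<psi> \<Longrightarrow> Delta0 (Imp \<phi> \<psi>)"
| "Delta0 \<phi> \<Longrightarrow> Delta0 (ForallB t \<phi>)"
| "Delta0 \<phi> \<Longrightarrow> Delta0 (ExistsB t \<phi>)"

definition Sigma1 :: "fm \<Rightarrow> bool" where "Sigma1 \<phi> \<longleftrightarrow> (\<exists>n \<delta>. Delta0 \<delta> \<and> \<phi> = (Exists ^^ n) \<delta>)"
definition Pi1 :: "fm \<Rightarrow> bool" where "Pi1 \<phi> \<longleftrightarrow> (\<exists>n \<delta>. Delta0 \<delta> \<and> \<phi> = (Forall ^^ n) \<delta>)"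


section \<open>Truth in the standard model\<close>

primrec evalT :: "(nat \<Rightarrow> nat) \<Rightarrow> tm \<Rightarrow> nat" where
  "evalT e (Var i) = e i"
| "evalT e Zero = 0"
| "evalT e (Succ t) = Suc (evalT e t)"
| "evalT e (Plus s t) = evalT e s + evalT e t"
| "evalT e (Times s t) = evalT e s * evalT e t"

primrec sat :: "(nat \<Rightarrow> nat) \<Rightarrow> fm \<Rightarrow> bool" where
  "sat e (Eq s t) \<longleftrightarrow> evalT e s = evalT e t"
| "sat e (Less s t) \<longleftrightarrow> evalT e s < evalT e t"
| "sat e (Neg \<phi>) \<longleftrightarrow> \<not> sat e \<phi>"
| "sat e (Imp \<phi> \<psi>) \<longleftrightarrow> (sat e \<phi> \<longrightarrow> sat e \<psi>)"
| "sat e (Forall \<phi>) \<longleftrightarrow> (\<forall>x. sat (\<lambda>i. case i of 0 \<Rightarrow> x | Suc j \<Rightarrow> e j) \<phi>)"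

definition true_in_N :: "fm \<Rightarrow> bool" where "true_in_N \<phi> \<longleftrightarrow> (\<forall>e. sat e \<phi>)"


section \<open>Provability and theories\<close>

text \<open>
  A Hilbert calculus for classical first-order logic with equality. Non-logical axioms are meant to
  be sentences, so the generalization rule is unrestricted.
\<close>

inductive proves :: "fm set \<Rightarrow> fm \<Rightarrow> bool" (infix "\<turnstile>" 50) for T :: "fm set" where
  Ax: "\<phi> \<in> T \<Longrightarrow> T \<turnstile> \<phi>"
| K: "T \<turnstile> Imp \<phi> (Imp \<psi> \<phi>)"
| S: "T \<turnstile> Imp (Imp \<phi> (Imp \<psi> \<chi>)) (Imp (Imp \<phi> \<psi>) (Imp \<phi> \<chi>))"
| N: "T \<turnstile> Imp (Imp (Neg \<phi>) (Neg \<psi>)) (Imp \<psi> \<phi>)"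
| Inst: "T \<turnstile> Imp (Forall \<phi>) (subst 0 t \<phi>)"
| Dist: "T \<turnstile> Imp (Forall (Imp \<phi> \<psi>)) (Imp (Forall \<phi>) (Forall \<psi>))"
| Vac: "T \<turnstile> Imp \<phi> (Forall (lift 0 \<phi>))"
| Refl: "T \<turnstile> Eq t t"
| Leib: "T \<turnstile> Imp (Eq s t) (Imp (subst 0 s \<phi>) (subst 0 t \<phi>))"
| MP: "T \<turnstile> Imp \<phi> \<psi> \<Longrightarrow> T \<turnstile> \<phi> \<Longrightarrow> T \<turnstile> \<psi>"
| Gen: "T \<turnstile> \<phi> \<Longrightarrow> T \<turnstile> Forall \<phi>"

definition LA_theory :: "fm set \<Rightarrow> bool" where "LA_theory T \<longleftrightarrow> (\<forall>\<phi>\<in>T. sentence \<phi>)"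

definition Th :: "fm set \<Rightarrow> fm set" where "Th T = {\<phi>. sentence \<phi> \<and> T \<turnstile> \<phi>}"

definition basic_axioms :: "fm set" where
  "basic_axioms = univ_closure ` (let x = Var 0; y = Var 1 in
    {Neg (Eq (Succ x) Zero),
     Imp (Eq (Succ x) (Succ y)) (Eq x y),
     Eq (Plus x Zero) x,
     Eq (Plus x (Succ y)) (Succ (Plus x y)),
     Eq (Times x Zero) Zero,
     Eq (Times x (Succ y)) (Plus (Times x y) x),
     Neg (Less x Zero),
     Iff (Less x (Succ y)) (Disj (Less x y) (Eq x y))})"

text \<open>Induction on variable \<open>0\<close> of \<open>\<phi>\<close>; after \<open>lift 1\<close>, the substitution of \<open>Succ (Var 0)\<close> for
  variable \<open>0\<close> leaves the parameters of \<open>\<phi>\<close> unchanged.\<close>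

definition induction_axiom :: "fm \<Rightarrow> fm" where
  "induction_axiom \<phi> = univ_closure
     (Imp (subst 0 Zero \<phi>)
       (Imp (Forall (Imp \<phi> (subst 0 (Succ (Var 0)) (lift 1 \<phi>)))) (Forall \<phi>)))"

definition PA :: "fm set" where
  "PA = basic_axioms \<union> range induction_axiom"

definition ISigma1 :: "fm set" where
  "ISigma1 = basic_axioms \<union> induction_axiom ` {\<phi>. Sigma1 \<phi>}"


section \<open>Goedel numbers\<close>

text \<open>
  Shoenfield's pairing function. It is injective and, being a polynomial, is also available as
  a term of the language of arithmetic.
\<close>

definition pair :: "nat \<Rightarrow> nat \<Rightarrow> nat" where "pair m n = Suc ((m + n) * (m + n) + m)"

primrec gnT :: "tm \<Rightarrow> nat" where
  "gnT (Var i) = pair 0 i"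
| "gnT Zero = pair 1 0"
| "gnT (Succ t) = pair 2 (gnT t)"
| "gnT (Plus s t) = pair 3 (pair (gnT s) (gnT t))"
| "gnT (Times s t) = pair 4 (pair (gnT s) (gnT t))"

primrec gn :: "fm \<Rightarrow> nat" where
  "gn (Eq s t) = pair 5 (pair (gnT s) (gnT t))"
| "gn (Less s t) = pair 6 (pair (gnT s) (gnT t))"
| "gn (Neg \<phi>) = pair 7 (gn \<phi>)"
| "gn (Imp \<phi> \<psi>) = pair 8 (pair (gn \<phi>) (gn \<psi>))"
| "gn (Forall \<phi>) = pair 9 (gn \<phi>)"

text \<open>\<open>\<tau>(v)\<close> is a definition of \<open>T\<close>; the variable \<open>v\<close> is number \<open>0\<close>.\<close>

definition is_definition :: "fm \<Rightarrow> fm set \<Rightarrow> bool" where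
  "is_definition \<tau> T \<longleftrightarrow>
     fv \<tau> \<subseteq> {0} \<and> (\<forall>n. true_in_N (subst 0 (num n) \<tau>) \<longleftrightarrow> n \<in> gn ` T)"

text \<open>Partial recursive functions, and recursively enumerable sets as their domains.\<close>

datatype recf = Z0 | S1 | Proj nat | Comp recf "recf list" | Prec recf recf | Mu recf

inductive computes :: "recf \<Rightarrow> nat list \<Rightarrow> nat \<Rightarrow> bool" where
  "computes Z0 xs 0"
| "computes S1 [x] (Suc x)"
| "i < length xs \<Longrightarrow> computes (Proj i) xs (xs ! i)"
| "list_all2 (\<lambda>g y. computes g xs y) gs ys \<Longrightarrow> computes f ys z \<Longrightarrow> computes (Comp f gs) xs z"
| "computes f xs y \<Longrightarrow> computes (Prec f g) (0 # xs) y"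
| "computes (Prec f g) (n # xs) r \<Longrightarrow> computes g (n # r # xs) y
     \<Longrightarrow> computes (Prec f g) (Suc n # xs) y"
| "computes f (n # xs) 0 \<Longrightarrow> \<forall>m<n. \<exists>y. computes f (m # xs) (Suc y) \<Longrightarrow> computes (Mu f) xs n"

definition rec_enumerable :: "nat set \<Rightarrow> bool" where
  "rec_enumerable A \<longleftrightarrow> (\<exists>f. A = {n. \<exists>y. computes f [n] y})"


section \<open>Arithmetization of syntax and provability\<close>

definition pairT :: "tm \<Rightarrow> tm \<Rightarrow> tm" where
  "pairT s t = Succ (Plus (Times (Plus s t) (Plus s t)) s)"

definition cVar :: "tm \<Rightarrow> tm" where "cVar x = pairT (num 0) x"
definition cZero :: tm where "cZero = pairT (num 1) Zero"
definition cSucc :: "tm \<Rightarrow> tm" where "cSucc x = pairT (num 2) x"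
definition cPlus :: "tm \<Rightarrow> tm \<Rightarrow> tm" where "cPlus x y = pairT (num 3) (pairT x y)"
definition cTimes :: "tm \<Rightarrow> tm \<Rightarrow> tm" where "cTimes x y = pairT (num 4) (pairT x y)"
definition cEq :: "tm \<Rightarrow> tm \<Rightarrow> tm" where "cEq x y = pairT (num 5) (pairT x y)"
definition cLess :: "tm \<Rightarrow> tm \<Rightarrow> tm" where "cLess x y = pairT (num 6) (pairT x y)"
definition cNeg :: "tm \<Rightarrow> tm" where "cNeg x = pairT (num 7) x"
definition cImp :: "tm \<Rightarrow> tm \<Rightarrow> tm" where "cImp x y = pairT (num 8) (pairT x y)"
definition cForall :: "tm \<Rightarrow> tm" where "cForall x = pairT (num 9) x"

text \<open>Goedel's beta function: \<open>v\<close> is the remainder of \<open>a\<close> modulo \<open>1 + (i + 1) * b\<close>.\<close>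

definition beta :: "tm \<Rightarrow> tm \<Rightarrow> tm \<Rightarrow> tm \<Rightarrow> fm" where
  "beta a b i v = (let m = Succ (Times (Succ i) b) in
     Conj (Less v m)
       (ExistsB (Succ a) (Eq (liftT 0 a) (Plus (Times (Var 0) (liftT 0 m)) (liftT 0 v)))))"

text \<open>
  \<open>derivable R x\<close> expresses: there is a finite sequence, given by \<open>a, b\<close> through the beta function,
  with last entry \<open>x\<close>, each of whose entries is the conclusion of an instance of a rule in \<open>R\<close> the
  premises of which are earlier entries. The rules are formulas in the scope of the following
  variables: \<open>Var 0, \<dots>, Var 5\<close> are the existentially quantified schematic variables of the rule,
  \<open>Var 6\<close> is the position \<open>i\<close> of the entry to be justified, \<open>Var 7\<close> is the position of the last
  entry, \<open>Var 8\<close> is \<open>b\<close> and \<open>Var 9\<close> is \<open>a\<close>.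
\<close>

definition concl :: "tm \<Rightarrow> fm" where "concl w = beta (Var 9) (Var 8) (Var 6) w"

definition prem :: "tm \<Rightarrow> fm" where
  "prem w = ExistsB (Var 6) (beta (Var 10) (Var 9) (Var 0) (liftT 0 w))"

definition rule :: "fm list \<Rightarrow> tm \<Rightarrow> fm" where "rule ps w = foldr Conj ps (concl w)"

definition derivable :: "fm list \<Rightarrow> tm \<Rightarrow> fm" where
  "derivable R x = (Exists ^^ 3)
     (Conj (beta (Var 2) (Var 1) (Var 0) (renT (\<lambda>i. i + 3) x))
       (ForallB (Succ (Var 0)) ((Exists ^^ 6) (foldr Disj R Falsum))))"

text \<open>Codes of the judgements ``is a term'', ``is a formula'', \<open>lift k x = y\<close>, \<open>subst k u x = y\<close>.\<close>

definition jTrm :: "tm \<Rightarrow> tm" where "jTrm x = pairT (num 0) x"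
definition jFrm :: "tm \<Rightarrow> tm" where "jFrm x = pairT (num 1) x"
definition jLft :: "tm \<Rightarrow> tm \<Rightarrow> tm \<Rightarrow> tm" where
  "jLft k x y = pairT (num 2) (pairT k (pairT x y))"
definition jSub :: "tm \<Rightarrow> tm \<Rightarrow> tm \<Rightarrow> tm \<Rightarrow> tm" where
  "jSub k u x y = pairT (num 3) (pairT k (pairT u (pairT x y)))"

definition syntax_rules :: "fm list" where
  "syntax_rules =
    (let k = Var 0; u = Var 1; p = Var 2; q = Var 3; p' = Var 4; q' = Var 5 in
      [rule [] (jTrm (cVar k)),
       rule [] (jTrm cZero),
       rule [prem (jTrm p)] (jTrm (cSucc p)),
       rule [prem (jTrm p), prem (jTrm q)] (jTrm (cPlus p q)),
       rule [prem (jTrm p), prem (jTrm q)] (jTrm (cTimes p q)),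
       rule [prem (jTrm p), prem (jTrm q)] (jFrm (cEq p q)),
       rule [prem (jTrm p), prem (jTrm q)] (jFrm (cLess p q)),
       rule [prem (jFrm p)] (jFrm (cNeg p)),
       rule [prem (jFrm p), prem (jFrm q)] (jFrm (cImp p q)),
       rule [prem (jFrm p)] (jFrm (cForall p)),

       rule [Less p k] (jLft k (cVar p) (cVar p)),
       rule [Less k (Succ p)] (jLft k (cVar p) (cVar (Succ p))),
       rule [] (jLft k cZero cZero),
       rule [prem (jLft (Succ k) p p')] (jLft k (cForall p) (cForall p')),

       rule [Less p k] (jSub k u (cVar p) (cVar p)),
       rule [] (jSub k u (cVar k) u),
       rule [Less k (Succ p)] (jSub k u (cVar (Succ p)) (cVar p)),
       rule [] (jSub k u cZero cZero),
       rule [prem (jLft Zero u q), prem (jSub (Succ k) q p p')]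
         (jSub k u (cForall p) (cForall p'))]
      @ concat (map (\<lambda>c.
          [rule [prem (jLft k p p')] (jLft k (c p) (c p')),
           rule [prem (jSub k u p p')] (jSub k u (c p) (c p'))])
          [cSucc, cNeg])
      @ concat (map (\<lambda>c.
          [rule [prem (jLft k p p'), prem (jLft k q q')] (jLft k (c p q) (c p' q')),
           rule [prem (jSub k u p p'), prem (jSub k u q q')] (jSub k u (c p q) (c p' q'))])
          [cPlus, cTimes, cEq, cLess, cImp]))"

definition TrmF :: "tm \<Rightarrow> fm" where "TrmF x = derivable syntax_rules (jTrm x)"
definition FrmF :: "tm \<Rightarrow> fm" where "FrmF x = derivable syntax_rules (jFrm x)"
definition LftF :: "tm \<Rightarrow> tm \<Rightarrow> tm \<Rightarrow> fm" where
  "LftF k x y = derivable syntax_rules (jLft k x y)"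
definition SubF :: "tm \<Rightarrow> tm \<Rightarrow> tm \<Rightarrow> tm \<Rightarrow> fm" where
  "SubF k u x y = derivable syntax_rules (jSub k u x y)"

text \<open>The rules of \<^const>\<open>proves\<close>, in the same order; \<open>subst 0 p \<tau>\<close> is \<open>\<tau>(p)\<close>.\<close>

definition proof_rules :: "fm \<Rightarrow> fm list" where
  "proof_rules \<tau> = (let p = Var 0; q = Var 1; r = Var 2; s = Var 3; t = Var 4 in
    [rule [FrmF p, subst 0 p \<tau>] p,
     rule [FrmF p, FrmF q] (cImp p (cImp q p)),
     rule [FrmF p, FrmF q, FrmF r] (cImp (cImp p (cImp q r)) (cImp (cImp p q) (cImp p r))),
     rule [FrmF p, FrmF q] (cImp (cImp (cNeg p) (cNeg q)) (cImp q p)),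
     rule [FrmF p, TrmF t, SubF Zero t p q] (cImp (cForall p) q),
     rule [FrmF p, FrmF q] (cImp (cForall (cImp p q)) (cImp (cForall p) (cForall q))),
     rule [FrmF p, LftF Zero p q] (cImp p (cForall q)),
     rule [TrmF t] (cEq t t),
     rule [FrmF p, TrmF s, TrmF t, SubF Zero s p q, SubF Zero t p r] (cImp (cEq s t) (cImp q r)),
     rule [prem (cImp p q), prem p] q,
     rule [prem p] (cForall p)])"

text \<open>
  The standard provability predicate, applied to a term \<open>x\<close>. For \<open>\<tau>\<close> in \<open>\<Sigma>\<^sub>1\<close> it is built from
  \<open>\<Sigma>\<^sub>1\<close> formulas by conjunction, disjunction, existential and bounded universal quantification,
  hence \<open>\<Sigma>\<^sub>1\<close> up to equivalence in \<^const>\<open>ISigma1\<close>.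
\<close>

definition Pr :: "fm \<Rightarrow> tm \<Rightarrow> fm" where "Pr \<tau> x = derivable (proof_rules \<tau>) x"

text \<open>\<open>NumF x y\<close>: \<open>y\<close> is the Goedel number of the numeral of \<open>x\<close>.\<close>

definition num_rules :: "fm list" where
  "num_rules = (let p = Var 0; q = Var 1 in
     [rule [] (pairT Zero cZero),
      rule [prem (pairT p q)] (pairT (Succ p) (cSucc q))])"

definition NumF :: "tm \<Rightarrow> tm \<Rightarrow> fm" where "NumF x y = derivable num_rules (pairT x y)"

text \<open>
  The term for the Goedel number of \<open>\<phi>\<close> with the numerals whose Goedel numbers are the values of
  \<open>Var 0, Var 1, \<dots>\<close> put for the free variables \<open>0, 1, \<dots>\<close>; the argument \<open>k\<close> counts the
  quantifiers passed.
\<close>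

primrec dotT :: "nat \<Rightarrow> tm \<Rightarrow> tm" where
  "dotT k (Var i) = (if i < k then cVar (num i) else Var (i - k))"
| "dotT k Zero = cZero"
| "dotT k (Succ t) = cSucc (dotT k t)"
| "dotT k (Plus s t) = cPlus (dotT k s) (dotT k t)"
| "dotT k (Times s t) = cTimes (dotT k s) (dotT k t)"

primrec dot :: "nat \<Rightarrow> fm \<Rightarrow> tm" where
  "dot k (Eq s t) = cEq (dotT k s) (dotT k t)"
| "dot k (Less s t) = cLess (dotT k s) (dotT k t)"
| "dot k (Neg \<phi>) = cNeg (dot k \<phi>)"
| "dot k (Imp \<phi> \<psi>) = cImp (dot k \<phi>) (dot k \<psi>)"
| "dot k (Forall \<phi>) = cForall (dot (Suc k) \<phi>)"

text \<open>
  \<open>Pr_dot \<tau> \<phi>\<close> is \<open>Pr\<^sub>\<tau>(\<ulcorner>\<phi>(\<dots>)\<urcorner>)\<close> with all free variables \<open>y\<^sub>i\<close> of \<open>\<phi>\<close> dotted; it has the same free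
  variables as \<open>\<phi>\<close>. Inside the \<open>m\<close> quantifiers, \<open>Var i\<close> is the Goedel number of the numeral of
  \<open>y\<^sub>i\<close>, and \<open>y\<^sub>i\<close> itself is \<open>Var (m + i)\<close>.
\<close>

definition Pr_dot :: "fm \<Rightarrow> fm \<Rightarrow> fm" where
  "Pr_dot \<tau> \<phi> = (let m = fv_bound \<phi> in
     (Exists ^^ m)
       (foldr Conj (map (\<lambda>i. NumF (Var (m + i)) (Var i)) (sorted_list_of_set (fv \<phi>)))
         (Pr \<tau> (dot 0 \<phi>))))"


section \<open>Quantified modal logic\<close>

text \<open>
  Variables are de Bruijn indices as before. \<open>MAtom P xs\<close> applies the \<open>P\<close>-th predicate symbol of
  arity \<open>length xs\<close> to the variables \<open>xs\<close>.
\<close>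

datatype mfm = MFalsum | MAtom nat "nat list" | MNeg mfm | MImp mfm mfm | MForall mfm | MBox mfm

abbreviation MConj :: "mfm \<Rightarrow> mfm \<Rightarrow> mfm" where "MConj A B \<equiv> MNeg (MImp A (MNeg B))"
abbreviation MDisj :: "mfm \<Rightarrow> mfm \<Rightarrow> mfm" where "MDisj A B \<equiv> MImp (MNeg A) B"
abbreviation MExists :: "mfm \<Rightarrow> mfm" where "MExists A \<equiv> MNeg (MForall (MNeg A))"
abbreviation MDia :: "mfm \<Rightarrow> mfm" where "MDia A \<equiv> MNeg (MBox (MNeg A))"

primrec mfv :: "mfm \<Rightarrow> nat set" where
  "mfv MFalsum = {}"
| "mfv (MAtom P xs) = set xs"
| "mfv (MNeg A) = mfv A"
| "mfv (MImp A B) = mfv A \<union> mfv B"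
| "mfv (MForall A) = {i. Suc i \<in> mfv A}"
| "mfv (MBox A) = mfv A"

text \<open>
  An arithmetical interpretation is given by the formulas \<open>f P n\<close> assigned to the \<open>P\<close>-th \<open>n\<close>-ary
  predicate symbol applied to the variables \<open>0, \<dots>, n - 1\<close>; its value on the other atomic formulas
  is obtained by renaming.
\<close>

definition arith_interp :: "(nat \<Rightarrow> nat \<Rightarrow> fm) \<Rightarrow> bool" where
  "arith_interp f \<longleftrightarrow> (\<forall>P n. fv (f P n) = {..<n})"

primrec interp :: "(nat \<Rightarrow> nat \<Rightarrow> fm) \<Rightarrow> fm \<Rightarrow> mfm \<Rightarrow> fm" where
  "interp f \<tau> MFalsum = Falsum"
| "interp f \<tau> (MAtom P xs) = ren (\<lambda>i. xs ! i) (f P (length xs))"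
| "interp f \<tau> (MNeg A) = Neg (interp f \<tau> A)"
| "interp f \<tau> (MImp A B) = Imp (interp f \<tau> A) (interp f \<tau> B)"
| "interp f \<tau> (MForall A) = Forall (interp f \<tau> A)"
| "interp f \<tau> (MBox A) = Pr_dot \<tau> (interp f \<tau> A)"

definition QPL :: "fm \<Rightarrow> fm set \<Rightarrow> mfm set" where
  "QPL \<tau> T = {A. mfv A = {} \<and> (\<forall>f. arith_interp f \<longrightarrow> T \<turnstile> interp f \<tau> A)}"

end

theory Submission
  imports Defs "HOL-Library.Countable_Set"
begin

text \<open>
  All claims about provability in a theory are checked in its models. For a \<open>\<Pi>\<^sub>1\<close> formula
  \<open>\<phi>\<close>, consider the modal formula \<open>reflection \<tau>\<^sub>0 \<phi>\<close>: if the interpreted relational structure satisfies,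
  also provably, a few basic axioms of arithmetic, if zero, successor and an additional predicate
  \<open>Q\<close> are rigid, and if below every element some section of \<open>Q\<close> separates the provable from the
  refutable diagonal sentences of \<open>\<tau>\<^sub>0\<close>, then \<open>\<box>\<phi>\<close> implies \<open>Pr\<^bsub>\<tau>\<^sub>0\<^esub>(\<phi>)\<close>, both translated.

  In a model \<open>N\<close> of \<open>T\<^sub>0\<close>, induction embeds \<open>N\<close> definably as an initial segment of the interpreted
  structure. As in Tennenbaum's theorem the embedding is onto, since an element above the image
  would provide a set that is decided by \<open>\<tau>\<^sub>0\<close> and separates the provable from the refutable diagonal
  sentences, which is impossible by diagonalization. So \<open>\<box>\<phi>\<close> entails that \<open>\<phi>\<close> itself is provable at
  the corresponding arguments, and this \<open>\<Sigma>\<^sub>1\<close> fact persists to the interpreted structure. Hence the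
  modal formula belongs to the logic of \<open>T\<^sub>0\<close>.

  In a model of \<open>T\<^sub>1\<close>, take the standard interpretation with divisibility by the moduli of the beta
  function for \<open>Q\<close>. All hypotheses of the modal formula hold, except that separation needs the
  consistency of \<open>\<tau>\<^sub>0\<close>; but if \<open>\<tau>\<^sub>0\<close> is inconsistent there is nothing to prove.
\<close>

section \<open>Simultaneous substitution\<close>

text \<open>A modal formula has no access to \<open>\<tau>\<^sub>0\<close>, but it can contain the
  arithmetical definition of provability for \<open>\<tau>\<^sub>0\<close>, written with predicate
  symbols. In \<open>T\<^sub>0\<close> this and the box speak of the same theory; in
  \<open>T\<^sub>1\<close> the box becomes provability for \<open>\<tau>\<^sub>1\<close>, while the
  translated formula stays as it is. The price is that in \<open>T\<^sub>0\<close> the symbols may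
  mean anything. For an embedding as an initial segment, \<Pi>1 formulas descend and \<Sigma>1
  formulas ascend, but the values of the free variables of \<phi> need preimages, and finitely many
  axioms do not exclude elements above the image. This forces the argument after Tennenbaum, with
  computability replaced by being decided by \<open>\<tau>\<^sub>0\<close>; boxes enforce the
  decision. Whatever is demanded must also hold in \<open>T\<^sub>1\<close>, where only \<Sigma>1
  induction is available: hence separation only below an element, since only bounded parts of a
  \<Sigma>1 set can be coded. Full induction is applied only over \<open>T\<^sub>0\<close>, to
  formulas containing the unknown interpretation. Most derivations inside the box are not written
  out: an implication is checked in all countable models, is a theorem by completeness, and so is
  provable internally.\<close>

primrec sbT :: "(nat \<Rightarrow> tm) \<Rightarrow> tm \<Rightarrow> tm" where
  "sbT \<sigma> (Var i) = \<sigma> i"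
| "sbT \<sigma> Zero = Zero"
| "sbT \<sigma> (Succ t) = Succ (sbT \<sigma> t)"
| "sbT \<sigma> (Plus s t) = Plus (sbT \<sigma> s) (sbT \<sigma> t)"
| "sbT \<sigma> (Times s t) = Times (sbT \<sigma> s) (sbT \<sigma> t)"

definition up :: "(nat \<Rightarrow> tm) \<Rightarrow> nat \<Rightarrow> tm" where
  "up \<sigma> = case_nat (Var 0) (\<lambda>i. liftT 0 (\<sigma> i))"

lemma up_simps [simp]: "up \<sigma> 0 = Var 0" "up \<sigma> (Suc i) = liftT 0 (\<sigma> i)"
  by (simp_all add: up_def)

text \<open>\<open>lift\<close>, \<open>subst\<close> and \<open>ren\<close> are all instances of
  this operation. Identities between them reduce through \<open>sb_sb\<close> to pointwise
  comparisons of assignments of terms, without a separate induction under binders for each.\<close>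

primrec sb :: "(nat \<Rightarrow> tm) \<Rightarrow> fm \<Rightarrow> fm" where
  "sb \<sigma> (Eq s t) = Eq (sbT \<sigma> s) (sbT \<sigma> t)"
| "sb \<sigma> (Less s t) = Less (sbT \<sigma> s) (sbT \<sigma> t)"
| "sb \<sigma> (Neg \<phi>) = Neg (sb \<sigma> \<phi>)"
| "sb \<sigma> (Imp \<phi> \<psi>) = Imp (sb \<sigma> \<phi>) (sb \<sigma> \<psi>)"
| "sb \<sigma> (Forall \<phi>) = Forall (sb (up \<sigma>) \<phi>)"

lemma sb_abbrevs [simp]:
  "sb \<sigma> (Conj \<phi> \<psi>) = Conj (sb \<sigma> \<phi>) (sb \<sigma> \<psi>)"
  "sb \<sigma> (Disj \<phi> \<psi>) = Disj (sb \<sigma> \<phi>) (sb \<sigma> \<psi>)"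
  "sb \<sigma> (Exists \<phi>) = Exists (sb (up \<sigma>) \<phi>)"
  by (simp_all add: Conj_def Disj_def Exists_def)

lemma liftT_sbT: "liftT k t = sbT (\<lambda>i. if i < k then Var i else Var (Suc i)) t"
  by (induction t) auto

lemma lift_sb: "lift k \<phi> = sb (\<lambda>i. if i < k then Var i else Var (Suc i)) \<phi>"
proof (induction \<phi> arbitrary: k)
  case (Forall \<phi>)
  have "up (\<lambda>i. if i < k then Var i else Var (Suc i))
      = (\<lambda>i. if i < Suc k then Var i else Var (Suc i))"
    by (rule ext) (auto simp: up_def split: nat.split)
  with Forall show ?case by simp
qed (auto simp: liftT_sbT)

lemma substT_sbT: "substT k u t = sbT (\<lambda>i. if i < k then Var i else if i = k then u else Var (i - 1)) t"
  by (induction t) auto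

lemma subst_sb: "subst k u \<phi> = sb (\<lambda>i. if i < k then Var i else if i = k then u else Var (i - 1)) \<phi>"
proof (induction \<phi> arbitrary: k u)
  case (Forall \<phi>)
  have "up (\<lambda>i. if i < k then Var i else if i = k then u else Var (i - 1))
      = (\<lambda>i. if i < Suc k then Var i else if i = Suc k then liftT 0 u else Var (i - 1))"
    by (rule ext) (auto simp: up_def split: nat.split)
  with Forall show ?case by simp
qed (auto simp: substT_sbT)

lemma renT_sbT: "renT \<rho> t = sbT (\<lambda>i. Var (\<rho> i)) t"
  by (induction t) auto

lemma ren_sb: "ren \<rho> \<phi> = sb (\<lambda>i. Var (\<rho> i)) \<phi>"
proof (induction \<phi> arbitrary: \<rho>)
  case (Forall \<phi>)
  have "up (\<lambda>i. Var (\<rho> i)) = (\<lambda>i. Var (case i of 0 \<Rightarrow> 0 | Suc j \<Rightarrow> Suc (\<rho> j)))"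
    by (rule ext) (auto simp: up_def split: nat.split)
  with Forall show ?case by simp
qed (auto simp: renT_sbT)

lemma sbT_sbT: "sbT \<sigma> (sbT \<tau> t) = sbT (\<lambda>i. sbT \<sigma> (\<tau> i)) t"
  by (induction t) auto

lemma liftT_sbT_up: "liftT 0 (sbT \<sigma> t) = sbT (up \<sigma>) (liftT 0 t)"
  by (induction t) auto

lemma sb_sb: "sb \<sigma> (sb \<tau> \<phi>) = sb (\<lambda>i. sbT \<sigma> (\<tau> i)) \<phi>"
proof (induction \<phi> arbitrary: \<sigma> \<tau>)
  case (Forall \<phi>)
  have "(\<lambda>i. sbT (up \<sigma>) (up \<tau> i)) = up (\<lambda>i. sbT \<sigma> (\<tau> i))"
    by (rule ext) (auto simp: up_def liftT_sbT_up[unfolded up_def] split: nat.split)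
  with Forall show ?case by simp
qed (auto simp: sbT_sbT)

lemma sbT_cong: "(\<And>i. i \<in> fvT t \<Longrightarrow> \<sigma> i = \<tau> i) \<Longrightarrow> sbT \<sigma> t = sbT \<tau> t"
  by (induction t) auto

lemma sb_cong: "(\<And>i. i \<in> fv \<phi> \<Longrightarrow> \<sigma> i = \<tau> i) \<Longrightarrow> sb \<sigma> \<phi> = sb \<tau> \<phi>"
proof (induction \<phi> arbitrary: \<sigma> \<tau>)
  case (Eq s t)
  then have "sbT \<sigma> s = sbT \<tau> s" "sbT \<sigma> t = sbT \<tau> t" by (auto intro: sbT_cong)
  then show ?case by simp
next
  case (Less s t)
  then have "sbT \<sigma> s = sbT \<tau> s" "sbT \<sigma> t = sbT \<tau> t" by (auto intro: sbT_cong)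
  then show ?case by simp
next
  case (Imp \<phi> \<psi>)
  have "sb \<sigma> \<phi> = sb \<tau> \<phi>" by (rule Imp.IH(1)) (use Imp.prems in simp)
  moreover have "sb \<sigma> \<psi> = sb \<tau> \<psi>" by (rule Imp.IH(2)) (use Imp.prems in simp)
  ultimately show ?case by simp
next
  case (Forall \<phi>)
  have "sb (up \<sigma>) \<phi> = sb (up \<tau>) \<phi>"
    using Forall.prems by (intro Forall.IH) (auto simp: up_def split: nat.split)
  then show ?case by simp
next
  case (Neg \<phi>)
  have "sb \<sigma> \<phi> = sb \<tau> \<phi>" by (rule Neg.IH) (use Neg.prems in simp)
  then show ?case by simp
qed

lemma sbT_Var [simp]: "sbT Var t = t"
  by (induction t) auto

lemma up_Var [simp]: "up Var = Var"
  by (rule ext) (auto simp: up_def split: nat.split)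

lemma sb_Var [simp]: "sb Var \<phi> = \<phi>"
  by (induction \<phi>) auto

lemma sb_sentence: "fv \<phi> = {} \<Longrightarrow> sb \<sigma> \<phi> = \<phi>"
  using sb_cong[of \<phi> \<sigma> Var] by simp

lemma fvT_liftT: "fvT (liftT 0 t) = Suc ` fvT t"
  by (induction t) auto

lemma fvT_sbT: "fvT (sbT \<sigma> t) = (\<Union>i\<in>fvT t. fvT (\<sigma> i))"
  by (induction t) auto

lemma fv_sb: "fv (sb \<sigma> \<phi>) = (\<Union>i\<in>fv \<phi>. fvT (\<sigma> i))"
proof (induction \<phi> arbitrary: \<sigma>)
  case (Forall \<phi>)
  have "{i. \<exists>x\<in>fv \<phi>. Suc i \<in> fvT (up \<sigma> x)} = (\<Union>i\<in>{i. Suc i \<in> fv \<phi>}. fvT (\<sigma> i))" (is "?L = ?R")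
  proof
    show "?L \<subseteq> ?R"
    proof
      fix i assume "i \<in> ?L"
      then obtain x where "x \<in> fv \<phi>" "Suc i \<in> fvT (up \<sigma> x)" by auto
      then show "i \<in> ?R" by (cases x) (auto simp: fvT_liftT)
    qed
    show "?R \<subseteq> ?L" by (force simp: fvT_liftT)
  qed
  with Forall show ?case by simp
qed (auto simp: fvT_sbT)

lemma fv_ren: "fv (ren \<rho> \<phi>) = \<rho> ` fv \<phi>"
  by (auto simp: ren_sb fv_sb)

lemma finite_fvT [simp]: "finite (fvT t)"
  by (induction t) auto

lemma finite_fv [simp]: "finite (fv \<phi>)"
proof (induction \<phi>)
  case (Forall \<phi>)
  have "{i. Suc i \<in> fv \<phi>} = Suc -` fv \<phi>" by auto
  with Forall show ?case by (simp add: finite_vimageI)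
qed auto

lemma fv_bound: "fv \<phi> \<subseteq> {..<fv_bound \<phi>}"
proof -
  obtain m where "fv \<phi> \<subseteq> {..<m}"
    using finite_nat_set_iff_bounded[of "fv \<phi>"] by auto
  then show ?thesis unfolding fv_bound_def by (rule LeastI)
qed

lemma fv_Forall_pow: "fv ((Forall ^^ n) \<phi>) = {i. i + n \<in> fv \<phi>}"
  by (induction n) auto

lemma sentence_univ_closure: "sentence (univ_closure \<phi>)"
proof -
  have "i + fv_bound \<phi> \<notin> fv \<phi>" for i
    using fv_bound[of \<phi>] by auto
  then show ?thesis by (simp add: sentence_def univ_closure_def fv_Forall_pow)
qed

lemma Delta0_Conj [intro]: "Delta0 \<phi> \<Longrightarrow> Delta0 \<psi> \<Longrightarrow> Delta0 (Conj \<phi> \<psi>)"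
  and Delta0_Disj [intro]: "Delta0 \<phi> \<Longrightarrow> Delta0 \<psi> \<Longrightarrow> Delta0 (Disj \<phi> \<psi>)"
  unfolding Conj_def Disj_def by (blast intro: Delta0.intros)+

lemma sb_ForallB: "sb \<sigma> (ForallB t \<phi>) = ForallB (sbT \<sigma> t) (sb (up \<sigma>) \<phi>)"
  by (simp add: ForallB_def liftT_sbT_up)

lemma sb_ExistsB: "sb \<sigma> (ExistsB t \<phi>) = ExistsB (sbT \<sigma> t) (sb (up \<sigma>) \<phi>)"
  by (simp add: ExistsB_def liftT_sbT_up)

lemma Delta0_sb: "Delta0 \<phi> \<Longrightarrow> Delta0 (sb \<sigma> \<phi>)"
  by (induction arbitrary: \<sigma> rule: Delta0.induct)
    (auto simp: sb_ForallB sb_ExistsB intro: Delta0.intros)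

section \<open>Structures and soundness\<close>

record 'a la_str =
  zer :: 'a
  suc :: "'a \<Rightarrow> 'a"
  pls :: "'a \<Rightarrow> 'a \<Rightarrow> 'a"
  tms :: "'a \<Rightarrow> 'a \<Rightarrow> 'a"
  lss :: "'a \<Rightarrow> 'a \<Rightarrow> bool"

primrec ev :: "('a, 'b) la_str_scheme \<Rightarrow> (nat \<Rightarrow> 'a) \<Rightarrow> tm \<Rightarrow> 'a" where
  "ev M e (Var i) = e i"
| "ev M e Zero = zer M"
| "ev M e (Succ t) = suc M (ev M e t)"
| "ev M e (Plus s t) = pls M (ev M e s) (ev M e t)"
| "ev M e (Times s t) = tms M (ev M e s) (ev M e t)"

primrec holds :: "('a, 'b) la_str_scheme \<Rightarrow> (nat \<Rightarrow> 'a) \<Rightarrow> fm \<Rightarrow> bool" where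
  "holds M e (Eq s t) \<longleftrightarrow> ev M e s = ev M e t"
| "holds M e (Less s t) \<longleftrightarrow> lss M (ev M e s) (ev M e t)"
| "holds M e (Neg \<phi>) \<longleftrightarrow> \<not> holds M e \<phi>"
| "holds M e (Imp \<phi> \<psi>) \<longleftrightarrow> (holds M e \<phi> \<longrightarrow> holds M e \<psi>)"
| "holds M e (Forall \<phi>) \<longleftrightarrow> (\<forall>x. holds M (case_nat x e) \<phi>)"

lemma holds_abbrevs [simp]:
  "holds M e (Conj \<phi> \<psi>) \<longleftrightarrow> holds M e \<phi> \<and> holds M e \<psi>"
  "holds M e (Disj \<phi> \<psi>) \<longleftrightarrow> holds M e \<phi> \<or> holds M e \<psi>"
  "holds M e (Iff \<phi> \<psi>) \<longleftrightarrow> (holds M e \<phi> \<longleftrightarrow> holds M e \<psi>)"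
  "holds M e (Exists \<phi>) \<longleftrightarrow> (\<exists>x. holds M (case_nat x e) \<phi>)"
  by (auto simp: Conj_def Disj_def Iff_def Exists_def)

lemma ev_liftT [simp]: "ev M (case_nat x e) (liftT 0 t) = ev M e t"
  by (induction t) auto

lemma ev_sbT: "ev M e (sbT \<sigma> t) = ev M (\<lambda>i. ev M e (\<sigma> i)) t"
  by (induction t) auto

lemma holds_sb: "holds M e (sb \<sigma> \<phi>) \<longleftrightarrow> holds M (\<lambda>i. ev M e (\<sigma> i)) \<phi>"
proof (induction \<phi> arbitrary: e \<sigma>)
  case (Forall \<phi>)
  have "(\<lambda>i. ev M (case_nat x e) (up \<sigma> i)) = case_nat x (\<lambda>i. ev M e (\<sigma> i))" for x
    by (rule ext) (auto simp: up_def split: nat.split)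
  with Forall show ?case by simp
qed (auto simp: ev_sbT)

lemma ev_cong: "(\<And>i. i \<in> fvT t \<Longrightarrow> e i = e' i) \<Longrightarrow> ev M e t = ev M e' t"
  by (induction t) auto

lemma holds_cong: "(\<And>i. i \<in> fv \<phi> \<Longrightarrow> e i = e' i) \<Longrightarrow> holds M e \<phi> = holds M e' \<phi>"
proof (induction \<phi> arbitrary: e e')
  case (Eq s t)
  then have "ev M e s = ev M e' s" "ev M e t = ev M e' t" by (auto intro: ev_cong)
  then show ?case by simp
next
  case (Less s t)
  then have "ev M e s = ev M e' s" "ev M e t = ev M e' t" by (auto intro: ev_cong)
  then show ?case by simp
next
  case (Imp \<phi> \<psi>)
  have "holds M e \<phi> = holds M e' \<phi>" by (rule Imp.IH(1)) (use Imp.prems in simp)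
  moreover have "holds M e \<psi> = holds M e' \<psi>" by (rule Imp.IH(2)) (use Imp.prems in simp)
  ultimately show ?case by simp
next
  case (Forall \<phi>)
  have "holds M (case_nat x e) \<phi> = holds M (case_nat x e') \<phi>" for x
    using Forall.prems by (intro Forall.IH) (auto split: nat.split)
  then show ?case by simp
next
  case (Neg \<phi>)
  have "holds M e \<phi> = holds M e' \<phi>" by (rule Neg.IH) (use Neg.prems in simp)
  then show ?case by simp
qed

lemma holds_ren: "holds M e (ren \<rho> \<phi>) \<longleftrightarrow> holds M (\<lambda>i. e (\<rho> i)) \<phi>"
  by (simp add: ren_sb holds_sb)

lemma holds_lift: "holds M (case_nat x e) (lift 0 \<phi>) \<longleftrightarrow> holds M e \<phi>"
  by (simp add: lift_sb holds_sb)

lemma holds_subst: "holds M e (subst 0 t \<phi>) \<longleftrightarrow> holds M (case_nat (ev M e t) e) \<phi>"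
proof -
  have "(\<lambda>i. ev M e (if i < 0 then Var i else if i = 0 then t else Var (i - 1)))
      = case_nat (ev M e t) e"
    by (rule ext) (auto split: nat.split)
  then show ?thesis by (simp only: subst_sb holds_sb)
qed

lemma holds_Forall_pow:
  fixes M :: "('a, 'b) la_str_scheme"
  shows "(\<forall>e. holds M e ((Forall ^^ n) \<phi>)) \<longleftrightarrow> (\<forall>e. holds M e \<phi>)"
proof (induction n)
  case (Suc n)
  have "(\<forall>e x. holds M (case_nat x e) \<psi>) \<longleftrightarrow> (\<forall>e. holds M e \<psi>)" for \<psi>
  proof
    assume *: "\<forall>e x. holds M (case_nat x e) \<psi>"
    show "\<forall>e. holds M e \<psi>"
    proof
      fix e :: "nat \<Rightarrow> 'a"
      have "case_nat (e 0) (\<lambda>i. e (Suc i)) = e" by (rule ext) (auto split: nat.split)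
      with * show "holds M e \<psi>" by metis
    qed
  qed auto
  with Suc show ?case by simp
qed simp

lemma holds_univ_closure: "(\<forall>e. holds M e (univ_closure \<phi>)) \<longleftrightarrow> (\<forall>e. holds M e \<phi>)"
  by (simp add: univ_closure_def holds_Forall_pow)

definition models :: "('a, 'b) la_str_scheme \<Rightarrow> fm set \<Rightarrow> bool" where
  "models M T \<longleftrightarrow> (\<forall>\<phi>\<in>T. \<forall>e. holds M e \<phi>)"

theorem soundness: "T \<turnstile> \<phi> \<Longrightarrow> models M T \<Longrightarrow> holds M e \<phi>"
proof (induction arbitrary: e rule: proves.induct)
  case (Leib s t \<phi>)
  then show ?case by (simp add: holds_subst)
qed (auto simp: models_def holds_subst holds_lift)

lemma models_Th: "models M T \<Longrightarrow> Th S \<subseteq> Th T \<Longrightarrow> LA_theory S \<Longrightarrow> models M S"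
  unfolding models_def[of M S] Th_def LA_theory_def by (blast intro: soundness proves.Ax)

section \<open>Completeness\<close>

lemma proves_I: "T \<turnstile> Imp \<phi> \<phi>"
  by (meson MP S K)

text \<open>Axioms are sentences and so are fixed by \<open>sb\<close>; the logical schemes are
  closed under substitution. The free variables of a theorem thus behave as if universally
  quantified.\<close>

lemma proves_sb: 
  assumes "LA_theory T"
  shows "T \<turnstile> \<phi> \<Longrightarrow> T \<turnstile> sb \<sigma> \<phi>"
proof (induction arbitrary: \<sigma> rule: proves.induct)
  case (Ax \<phi>)
  then show ?case using assms by (simp add: LA_theory_def sentence_def sb_sentence proves.Ax)
next
  case (Inst \<phi> t)
  have "sb \<sigma> (subst 0 t \<phi>) = subst 0 (sbT \<sigma> t) (sb (up \<sigma>) \<phi>)"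
    unfolding subst_sb sb_sb
    by (rule arg_cong[where f = "\<lambda>\<sigma>. sb \<sigma> \<phi>"], rule ext) (auto simp: up_def sbT_sbT liftT_sbT split: nat.split)
  then show ?case by (simp add: proves.Inst)
next
  case (Vac \<phi>)
  have "sb (up \<sigma>) (lift 0 \<phi>) = lift 0 (sb \<sigma> \<phi>)"
    unfolding lift_sb sb_sb
    by (rule arg_cong[where f = "\<lambda>\<sigma>. sb \<sigma> \<phi>"], rule ext) (auto simp: up_def liftT_sbT split: nat.split)
  then show ?case by (simp add: proves.Vac)
next
  case (Leib s t \<phi>)
  have "sb \<sigma> (subst 0 s \<phi>) = subst 0 (sbT \<sigma> s) (sb (up \<sigma>) \<phi>)" for s
    unfolding subst_sb sb_sb
    by (rule arg_cong[where f = "\<lambda>\<sigma>. sb \<sigma> \<phi>"], rule ext) (auto simp: up_def sbT_sbT liftT_sbT split: nat.split)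
  then show ?case by (simp add: proves.Leib)
next
  case (MP \<phi> \<psi>)
  then show ?case by (metis proves.MP sb.simps(4))
qed (auto intro: proves.intros)

lemma proves_Forall_iff:
  assumes "LA_theory T"
  shows "T \<turnstile> Forall \<phi> \<longleftrightarrow> T \<turnstile> \<phi>"
proof
  assume "T \<turnstile> Forall \<phi>"
  \<comment> \<open>\<open>subst 0\<close> lowers the indices above 0, so all free variables are
    raised first; instantiation with \<open>Var 0\<close> then gives back exactly
    \<open>\<phi>\<close>.\<close>
  then have "T \<turnstile> sb (\<lambda>i. Var (Suc i)) (Forall \<phi>)" by (rule proves_sb[OF assms])
  then have "T \<turnstile> subst 0 (Var 0) (sb (up (\<lambda>i. Var (Suc i))) \<phi>)"
    using proves.Inst proves.MP by fastforce
  moreover have "subst 0 (Var 0) (sb (up (\<lambda>i. Var (Suc i))) \<phi>) = sb Var \<phi>"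
    unfolding subst_sb sb_sb
    by (rule arg_cong[where f = "\<lambda>\<sigma>. sb \<sigma> \<phi>"], rule ext) (auto simp: up_def split: nat.split)
  ultimately show "T \<turnstile> \<phi>" by simp
qed (rule proves.Gen)

lemma proves_univ_closure_iff: "LA_theory T \<Longrightarrow> T \<turnstile> univ_closure \<phi> \<longleftrightarrow> T \<turnstile> \<phi>"
proof -
  assume T: "LA_theory T"
  have "T \<turnstile> (Forall ^^ n) \<phi> \<longleftrightarrow> T \<turnstile> \<phi>" for n
    by (induction n) (auto simp: proves_Forall_iff[OF T])
  then show ?thesis by (simp add: univ_closure_def)
qed

text \<open>Hypotheses may contain free variables and may not be generalized: modus ponens over
  theorems of \<open>T\<close> is the only rule. This gives the deduction theorem without side
  conditions.\<close>

inductive ded :: "fm set \<Rightarrow> fm set \<Rightarrow> fm \<Rightarrow> bool" for T \<Gamma> where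
  hyp: "\<phi> \<in> \<Gamma> \<Longrightarrow> ded T \<Gamma> \<phi>"
| th: "T \<turnstile> \<phi> \<Longrightarrow> ded T \<Gamma> \<phi>"
| mp: "ded T \<Gamma> (Imp \<phi> \<psi>) \<Longrightarrow> ded T \<Gamma> \<phi> \<Longrightarrow> ded T \<Gamma> \<psi>"

lemma ded_deduction: "ded T (insert \<phi> \<Gamma>) \<psi> \<Longrightarrow> ded T \<Gamma> (Imp \<phi> \<psi>)"
proof (induction rule: ded.induct)
  case (hyp \<psi>)
  then show ?case by (metis K ded.hyp ded.mp ded.th insertE proves_I)
next
  case (th \<psi>)
  then show ?case by (metis K MP ded.th)
next
  case (mp \<chi> \<psi>)
  then show ?case by (metis S ded.mp ded.th)
qed

lemma ded_mono: "ded T \<Gamma> \<phi> \<Longrightarrow> \<Gamma> \<subseteq> \<Delta> \<Longrightarrow> ded T \<Delta> \<phi>"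
  by (induction rule: ded.induct) (blast intro: ded.hyp, blast intro: ded.th, blast intro: ded.mp)

lemma ded_finite: "ded T \<Gamma> \<phi> \<Longrightarrow> \<exists>\<Delta>. finite \<Delta> \<and> \<Delta> \<subseteq> \<Gamma> \<and> ded T \<Delta> \<phi>"
proof (induction rule: ded.induct)
  case (hyp \<phi>)
  then show ?case by (intro exI[of _ "{\<phi>}"]) (auto intro: ded.hyp)
next
  case (th \<phi>)
  then show ?case by (intro exI[of _ "{}"]) (auto intro: ded.th)
next
  case (mp \<phi> \<psi>)
  then obtain A B where "finite A" "A \<subseteq> \<Gamma>" "ded T A (Imp \<phi> \<psi>)" "finite B" "B \<subseteq> \<Gamma>" "ded T B \<phi>"
    by auto
  then have "ded T (A \<union> B) (Imp \<phi> \<psi>)" "ded T (A \<union> B) \<phi>"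
    by (auto intro: ded_mono)
  with \<open>finite A\<close> \<open>finite B\<close> \<open>A \<subseteq> \<Gamma>\<close> \<open>B \<subseteq> \<Gamma>\<close> show ?case
    by (intro exI[of _ "A \<union> B"] conjI) (simp_all, rule ded.mp)
qed

lemma ded_sb:
  assumes "LA_theory T"
  shows "ded T \<Gamma> \<phi> \<Longrightarrow> ded T (sb \<sigma> ` \<Gamma>) (sb \<sigma> \<phi>)"
proof (induction rule: ded.induct)
  case (mp \<phi> \<psi>)
  then show ?case by (metis ded.mp sb.simps(4))
qed (auto intro: ded.hyp ded.th proves_sb[OF assms])

text \<open>Lifted hypotheses do not contain variable 0, which is the eigenvariable condition.
  \<open>Vac\<close> generalizes a hypothesis and \<open>Dist\<close> carries the quantifier through
  modus ponens.\<close>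

lemma ded_gen: "ded T (lift 0 ` \<Gamma>) \<phi> \<Longrightarrow> ded T \<Gamma> (Forall \<phi>)"
proof (induction rule: ded.induct)
  case (hyp \<phi>)
  then obtain \<gamma> where "\<gamma> \<in> \<Gamma>" "\<phi> = lift 0 \<gamma>" by blast
  then show ?case by (metis ded.mp ded.th proves.Vac ded.hyp)
next
  case (th \<phi>)
  then show ?case by (simp add: ded.th proves.Gen)
next
  case (mp \<phi> \<psi>)
  then show ?case by (meson Dist ded.mp ded.th)
qed

lemma ded_fresh_gen:
  assumes "LA_theory T" "ded T \<Gamma> (subst 0 (Var m) \<phi>)"
    and fresh: "\<And>\<gamma>. \<gamma> \<in> insert (Forall \<phi>) \<Gamma> \<Longrightarrow> m \<notin> fv \<gamma>"
  shows "ded T \<Gamma> (Forall \<phi>)"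
proof (rule ded_gen)
  \<comment> \<open>This renaming sends the fresh variable to 0 and acts as a lift on all others:
    the instance turns back into \<open>\<phi>\<close> and each hypothesis into its lift, as
    \<open>ded_gen\<close> requires.\<close>
  let ?\<sigma> = "\<lambda>i. if i = m then Var 0 else Var (Suc i)"
  have "sb ?\<sigma> (subst 0 (Var m) \<phi>) = sb Var \<phi>"
    unfolding subst_sb sb_sb using fresh[of "Forall \<phi>"]
    by (intro sb_cong) (auto simp: gr0_conv_Suc)
  moreover have "sb ?\<sigma> \<gamma> = lift 0 \<gamma>" if "\<gamma> \<in> \<Gamma>" for \<gamma>
    unfolding lift_sb using fresh[of \<gamma>] that by (intro sb_cong) auto
  then have "sb ?\<sigma> ` \<Gamma> = lift 0 ` \<Gamma>" by (intro image_cong) auto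
  ultimately show "ded T (lift 0 ` \<Gamma>) \<phi>"
    using ded_sb[OF assms(1,2), of ?\<sigma>] by simp
qed

lemma ded_explosion: "ded T \<Gamma> \<phi> \<Longrightarrow> ded T \<Gamma> (Neg \<phi>) \<Longrightarrow> ded T \<Gamma> \<psi>"
  by (meson N K ded.mp ded.th)

lemma ded_DN: "ded T \<Gamma> (Imp (Neg (Neg \<phi>)) \<phi>)"
proof (rule ded_deduction)
  let ?\<Gamma> = "insert (Neg (Neg \<phi>)) \<Gamma>"
  have "ded T ?\<Gamma> (Imp (Neg \<phi>) (Neg (Neg (Neg \<phi>))))"
    by (rule ded_deduction) (metis ded_explosion ded.hyp insertI1 insertI2)
  then show "ded T ?\<Gamma> \<phi>"
    by (meson N ded.mp ded.th ded.hyp insertI1)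
qed

definition cons :: "fm set \<Rightarrow> fm set \<Rightarrow> bool" where
  "cons T \<Gamma> \<longleftrightarrow> (\<exists>\<phi>. \<not> ded T \<Gamma> \<phi>)"

lemma ded_ccontr: "\<not> cons T (insert (Neg \<phi>) \<Gamma>) \<Longrightarrow> ded T \<Gamma> \<phi>"
proof -
  assume "\<not> cons T (insert (Neg \<phi>) \<Gamma>)"
  then have "ded T \<Gamma> (Imp (Neg \<phi>) (Neg (Eq Zero Zero)))"
    by (auto simp: cons_def intro: ded_deduction)
  then show ?thesis by (meson N Refl ded.mp ded.th)
qed

lemma ded_Neg: "\<not> cons T (insert \<phi> \<Gamma>) \<Longrightarrow> ded T \<Gamma> (Neg \<phi>)"
proof (rule ded_ccontr)
  assume inc: "\<not> cons T (insert \<phi> \<Gamma>)"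
  have "ded T (insert (Neg (Neg \<phi>)) \<Gamma>) \<phi>"
    by (meson ded_DN ded.hyp ded.mp insertI1)
  moreover have "ded T \<Gamma> (Imp \<phi> \<psi>)" for \<psi>
    using inc by (auto simp: cons_def intro: ded_deduction)
  ultimately show "\<not> cons T (insert (Neg (Neg \<phi>)) \<Gamma>)"
    unfolding cons_def by (meson ded.mp ded_mono subset_insertI)
qed

lemma cons_witness:
  assumes T: "LA_theory T" and c: "cons T \<Gamma>" and \<Gamma>: "Neg (Forall \<phi>) \<in> \<Gamma>"
    and fresh: "\<And>\<gamma>. \<gamma> \<in> \<Gamma> \<Longrightarrow> m \<notin> fv \<gamma>"
  shows "cons T (insert (Neg (subst 0 (Var m) \<phi>)) \<Gamma>)"
proof (rule ccontr)
  assume "\<not> ?thesis"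
  then have "ded T \<Gamma> (subst 0 (Var m) \<phi>)" by (rule ded_ccontr)
  then have "ded T \<Gamma> (Forall \<phi>)"
    by (rule ded_fresh_gen[OF T]) (use fresh fresh[OF \<Gamma>] in auto)
  with \<Gamma> c show False
    unfolding cons_def by (meson ded_explosion ded.hyp)
qed

section \<open>Henkin extensions\<close>

instance tm :: countable by countable_datatype
instance fm :: countable by countable_datatype

definition fresh_var :: "fm set \<Rightarrow> nat" where
  "fresh_var \<Gamma> = (SOME m. \<forall>\<gamma>\<in>\<Gamma>. m \<notin> fv \<gamma>)"

lemma fresh_var: 
  assumes "finite \<Gamma>" "\<gamma> \<in> \<Gamma>" shows "fresh_var \<Gamma> \<notin> fv \<gamma>"
proof -
  have "finite (\<Union>(fv ` \<Gamma>))" using assms by auto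
  then obtain m where "m \<notin> \<Union>(fv ` \<Gamma>)" using ex_new_if_finite infinite_UNIV_nat by blast
  then have "\<forall>\<gamma>\<in>\<Gamma>. m \<notin> fv \<gamma>" by auto
  then have "\<forall>\<gamma>\<in>\<Gamma>. fresh_var \<Gamma> \<notin> fv \<gamma>" unfolding fresh_var_def by (rule someI)
  with assms(2) show ?thesis by blast
qed

definition wit :: "fm \<Rightarrow> fm set \<Rightarrow> fm set" where
  "wit \<psi> \<Gamma> = (case \<psi> of Neg (Forall \<phi>) \<Rightarrow> insert (Neg (subst 0 (Var (fresh_var \<Gamma>)) \<phi>)) \<Gamma> | _ \<Rightarrow> \<Gamma>)"

text \<open>Each stage adds at most two formulas, so over a finite start there is always a fresh
  variable. Free variables serve as Henkin constants and the language is not extended. A witness is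
  added in the very stage that accepts the negated universal formula.\<close>

primrec henkin :: "fm set \<Rightarrow> fm set \<Rightarrow> nat \<Rightarrow> fm set" where
  "henkin T \<Gamma> 0 = \<Gamma>"
| "henkin T \<Gamma> (Suc n) = (let \<psi> = from_nat n; \<Delta> = insert \<psi> (henkin T \<Gamma> n) in
     if cons T \<Delta> then wit \<psi> \<Delta> else henkin T \<Gamma> n)"

lemma wit_sup: "\<Gamma> \<subseteq> wit \<psi> \<Gamma>"
  by (auto simp: wit_def split: fm.split)

lemma finite_henkin: "finite \<Gamma> \<Longrightarrow> finite (henkin T \<Gamma> n)"
  by (induction n) (auto simp: wit_def Let_def split: fm.split)

lemma cons_henkin:
  assumes "LA_theory T" "finite \<Gamma>" "cons T \<Gamma>"
  shows "cons T (henkin T \<Gamma> n)"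
proof (induction n)
  case (Suc n)
  let ?\<psi> = "from_nat n :: fm" let ?\<Delta> = "insert ?\<psi> (henkin T \<Gamma> n)"
  have "cons T (wit ?\<psi> ?\<Delta>)" if c: "cons T ?\<Delta>"
  proof (cases "\<exists>\<phi>. ?\<psi> = Neg (Forall \<phi>)")
    case True
    then obtain \<phi> where \<phi>: "?\<psi> = Neg (Forall \<phi>)" by blast
    have fin: "finite ?\<Delta>" using finite_henkin[OF assms(2)] by simp
    have "cons T (insert (Neg (subst 0 (Var (fresh_var ?\<Delta>)) \<phi>)) ?\<Delta>)"
      by (rule cons_witness[OF assms(1) c _ fresh_var[OF fin]]) (simp_all add: \<phi>)
    then show ?thesis by (simp add: wit_def \<phi>)
  next
    case False
    then show ?thesis using c by (auto simp: wit_def split: fm.split)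
  qed
  then show ?case using Suc by (simp add: Let_def)
qed (use assms in simp)

lemma henkin_mono: "m \<le> n \<Longrightarrow> henkin T \<Gamma> m \<subseteq> henkin T \<Gamma> n"
proof (induction n rule: dec_induct)
  case (step n)
  have "henkin T \<Gamma> n \<subseteq> henkin T \<Gamma> (Suc n)"
    using wit_sup by (force simp: Let_def)
  with step show ?case by blast
qed simp

theorem henkin_extension:
  assumes T: "LA_theory T" and \<Gamma>: "finite \<Gamma>" "cons T \<Gamma>"
  obtains H where "\<Gamma> \<subseteq> H" "\<And>\<phi>. ded T H \<phi> \<longleftrightarrow> \<phi> \<in> H" "\<And>\<phi>. Neg \<phi> \<in> H \<longleftrightarrow> \<phi> \<notin> H"
    "\<And>\<phi>. Neg (Forall \<phi>) \<in> H \<Longrightarrow> \<exists>m. Neg (subst 0 (Var m) \<phi>) \<in> H"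
proof
  let ?H = "\<Union>n. henkin T \<Gamma> n"
  show sub: "\<Gamma> \<subseteq> ?H" by (metis UN_upper UNIV_I henkin.simps(1))
  have fin_sub: "\<exists>n. \<Delta> \<subseteq> henkin T \<Gamma> n" if "finite \<Delta>" "\<Delta> \<subseteq> ?H" for \<Delta>
    using that
  proof (induction \<Delta>)
    case (insert \<phi> \<Delta>)
    then obtain m n where "\<Delta> \<subseteq> henkin T \<Gamma> n" "\<phi> \<in> henkin T \<Gamma> m" by auto
    moreover have "henkin T \<Gamma> m \<subseteq> henkin T \<Gamma> (max m n)" "henkin T \<Gamma> n \<subseteq> henkin T \<Gamma> (max m n)"
      by (simp_all add: henkin_mono)
    ultimately show ?case by (intro exI[of _ "max m n"]) blast
  qed auto
  have cH: "cons T \<Delta>" if \<Delta>: "\<Delta> \<subseteq> ?H" for \<Delta>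
  proof (rule ccontr)
    assume inc: "\<not> cons T \<Delta>"
    then have "ded T \<Delta> (Neg (Eq Zero Zero))" by (simp add: cons_def)
    from ded_finite[OF this] obtain \<Delta>'
      where \<Delta>': "finite \<Delta>'" "\<Delta>' \<subseteq> \<Delta>" "ded T \<Delta>' (Neg (Eq Zero Zero))" by auto
    obtain n where "\<Delta>' \<subseteq> henkin T \<Gamma> n"
      using fin_sub[OF \<Delta>'(1) subset_trans[OF \<Delta>'(2) \<Delta>]] by blast
    then have "ded T (henkin T \<Gamma> n) (Neg (Eq Zero Zero))" by (rule ded_mono[OF \<Delta>'(3)])
    then have "\<not> cons T (henkin T \<Gamma> n)"
      unfolding cons_def using ded_explosion[OF ded.th[OF proves.Refl]] by blast
    then show False using cons_henkin[OF T \<Gamma>] by blast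
  qed
  have max: "\<phi> \<in> ?H" if "cons T (insert \<phi> ?H)" for \<phi>
  proof -
    obtain n where n: "\<phi> = from_nat n" by (metis from_nat_to_nat)
    have "cons T (insert \<phi> (henkin T \<Gamma> n))"
      using that ded_mono[of T "insert \<phi> (henkin T \<Gamma> n)" _ "insert \<phi> ?H"]
      unfolding cons_def by blast
    then have "\<phi> \<in> henkin T \<Gamma> (Suc n)"
      using wit_sup n by (force simp: Let_def)
    then show ?thesis by blast
  qed
  show ded: "ded T ?H \<phi> \<longleftrightarrow> \<phi> \<in> ?H" for \<phi>
  proof
    assume d: "ded T ?H \<phi>"
    show "\<phi> \<in> ?H"
    proof (rule max, rule ccontr)
      assume "\<not> cons T (insert \<phi> ?H)"
      then have "ded T ?H (Neg \<phi>)" by (rule ded_Neg)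
      with d cH[OF order_refl] show False unfolding cons_def using ded_explosion by blast
    qed
  qed (rule ded.hyp)
  show "Neg \<phi> \<in> ?H \<longleftrightarrow> \<phi> \<notin> ?H" for \<phi>
  proof
    assume "Neg \<phi> \<in> ?H"
    then show "\<phi> \<notin> ?H"
      using cH[OF order_refl] ded_explosion[OF ded.hyp ded.hyp, of \<phi> ?H] unfolding cons_def by blast
  next
    assume "\<phi> \<notin> ?H"
    then have "\<not> cons T (insert \<phi> ?H)" using max by blast
    then have "ded T ?H (Neg \<phi>)" by (rule ded_Neg)
    then show "Neg \<phi> \<in> ?H" by (simp only: ded)
  qed
  show "\<exists>m. Neg (subst 0 (Var m) \<phi>) \<in> ?H" if "Neg (Forall \<phi>) \<in> ?H" for \<phi>
  proof -
    obtain n where n: "Neg (Forall \<phi>) = from_nat n" by (metis from_nat_to_nat)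
    let ?\<Delta> = "insert (Neg (Forall \<phi>)) (henkin T \<Gamma> n)"
    have "cons T ?\<Delta>" by (rule cH) (use that in auto)
    then have "Neg (subst 0 (Var (fresh_var ?\<Delta>)) \<phi>) \<in> henkin T \<Gamma> (Suc n)"
      by (simp add: Let_def n[symmetric] wit_def)
    then show ?thesis by blast
  qed
qed

section \<open>The term model of a Henkin set\<close>

lemma substT_liftT: "substT 0 u (liftT 0 t) = t"
  by (induction t) auto

lemma sb_subst: "subst 0 t (sb (up \<sigma>) \<phi>) = sb (case_nat t \<sigma>) \<phi>"
  unfolding subst_sb sb_sb
  by (rule arg_cong[where f = "\<lambda>\<sigma>. sb \<sigma> \<phi>"], rule ext)
    (auto simp: up_def sbT_sbT liftT_sbT split: nat.split)

lemma ded_empty: "ded T {} \<phi> \<Longrightarrow> T \<turnstile> \<phi>"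
  by (induction rule: ded.induct) (auto intro: proves.MP)

text \<open>The last two premises make the term model infinite, so that it can be carried by
  all of \<^typ>\<open>nat\<close>.\<close>

theorem completeness:
  assumes T: "LA_theory T"
    and valid: "\<And>(M :: nat la_str) e. models M T \<Longrightarrow> holds M e \<phi>"
    and inf1: "\<And>t. T \<turnstile> Neg (Eq (Succ t) Zero)"
    and inf2: "\<And>s t. T \<turnstile> Imp (Eq (Succ s) (Succ t)) (Eq s t)"
  shows "T \<turnstile> \<phi>"
proof (rule ccontr)
  assume "\<not> T \<turnstile> \<phi>"
  then have "cons T {Neg \<phi>}" using ded_ccontr ded_empty by blast
  then obtain H where H0: "{Neg \<phi>} \<subseteq> H" and H: "\<And>\<phi>. ded T H \<phi> \<longleftrightarrow> \<phi> \<in> H"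
    and HN: "\<And>\<phi>. Neg \<phi> \<in> H \<longleftrightarrow> \<phi> \<notin> H"
    and HE: "\<And>\<phi>. Neg (Forall \<phi>) \<in> H \<Longrightarrow> \<exists>m. Neg (subst 0 (Var m) \<phi>) \<in> H"
    using henkin_extension[OF T, of "{Neg \<phi>}"] by (metis finite.intros)
  have pr: "T \<turnstile> \<psi> \<Longrightarrow> \<psi> \<in> H" for \<psi> using H ded.th by blast
  have mp: "Imp \<psi> \<chi> \<in> H \<Longrightarrow> \<psi> \<in> H \<Longrightarrow> \<chi> \<in> H" for \<psi> \<chi> using H ded.mp by blast
  have HI: "Imp \<psi> \<chi> \<in> H \<longleftrightarrow> (\<psi> \<in> H \<longrightarrow> \<chi> \<in> H)" for \<psi> \<chi>
  proof
    assume *: "\<psi> \<in> H \<longrightarrow> \<chi> \<in> H"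
    show "Imp \<psi> \<chi> \<in> H"
    proof (cases "\<chi> \<in> H")
      case True
      then show ?thesis using pr[OF proves.K] mp by blast
    next
      case False
      then have "Neg \<psi> \<in> H" using * HN by blast
      then have "Imp (Neg \<chi>) (Neg \<psi>) \<in> H" using pr[OF proves.K] mp by blast
      then show ?thesis using pr[OF proves.N] mp by blast
    qed
  qed (use mp in blast)
  have HA: "Forall \<psi> \<in> H \<longleftrightarrow> (\<forall>t. subst 0 t \<psi> \<in> H)" for \<psi>
    using pr[OF proves.Inst] mp HE HN by blast
  have refl: "Eq t t \<in> H" for t by (rule pr) (rule proves.Refl)
  have leib: "subst 0 t \<psi> \<in> H" if "Eq s t \<in> H" "subst 0 s \<psi> \<in> H" for s t \<psi>
    using pr[OF proves.Leib] mp that by blast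
  have sym: "Eq t s \<in> H" if "Eq s t \<in> H" for s t
    using leib[OF that, of "Eq (Var 0) (liftT 0 s)"] refl by (simp add: substT_liftT)
  have trans: "Eq s u \<in> H" if "Eq s t \<in> H" "Eq t u \<in> H" for s t u
    using leib[OF that(2), of "Eq (liftT 0 s) (Var 0)"] that by (simp add: substT_liftT)
  have cSucc: "Eq (Succ s) (Succ t) \<in> H" if "Eq s t \<in> H" for s t
    using leib[OF that, of "Eq (liftT 0 (Succ s)) (Succ (Var 0))"] refl by (simp add: substT_liftT)
  have cPlus: "Eq (Plus s s') (Plus t t') \<in> H" if "Eq s t \<in> H" "Eq s' t' \<in> H" for s t s' t'
  proof -
    have "Eq (Plus s s') (Plus t s') \<in> H"
      using leib[OF that(1), of "Eq (liftT 0 (Plus s s')) (Plus (Var 0) (liftT 0 s'))"] refl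
      by (simp add: substT_liftT)
    then show ?thesis
      using leib[OF that(2), of "Eq (liftT 0 (Plus s s')) (Plus (liftT 0 t) (Var 0))"]
      by (simp add: substT_liftT)
  qed
  have cTimes: "Eq (Times s s') (Times t t') \<in> H" if "Eq s t \<in> H" "Eq s' t' \<in> H" for s t s' t'
  proof -
    have "Eq (Times s s') (Times t s') \<in> H"
      using leib[OF that(1), of "Eq (liftT 0 (Times s s')) (Times (Var 0) (liftT 0 s'))"] refl
      by (simp add: substT_liftT)
    then show ?thesis
      using leib[OF that(2), of "Eq (liftT 0 (Times s s')) (Times (liftT 0 t) (Var 0))"]
      by (simp add: substT_liftT)
  qed
  have cLess: "Less t t' \<in> H" if "Eq s t \<in> H" "Eq s' t' \<in> H" "Less s s' \<in> H" for s t s' t'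
  proof -
    have "Less t s' \<in> H"
      using leib[OF that(1), of "Less (Var 0) (liftT 0 s')"] that(3) by (simp add: substT_liftT)
    then show ?thesis
      using leib[OF that(2), of "Less (liftT 0 t) (Var 0)"] by (simp add: substT_liftT)
  qed
  define c where "c t = {s. Eq t s \<in> H}" for t
  have c: "c s = c t \<longleftrightarrow> Eq s t \<in> H" for s t
    using refl sym trans unfolding c_def by blast
  \<comment> \<open>The numerals supply infinitely many classes: by \<open>inf1\<close> and
    \<open>inf2\<close> the successor avoids zero and is injective on classes.\<close>
  have num_neq: "Eq (num (i + Suc d)) (num i) \<notin> H" for i d
  proof (induction i)
    case 0
    then show ?case using pr[OF inf1, of "num d"] HN by (simp add: num_def)
  next
    case (Suc i)
    then show ?case using pr[OF inf2, of "num (i + Suc d)" "num i"] mp by (auto simp: num_def)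
  qed
  have "inj (\<lambda>i. c (num i))"
  proof (rule injI)
    fix i j assume "c (num i) = c (num j)"
    then have "Eq (num i) (num j) \<in> H" "Eq (num j) (num i) \<in> H" using c sym by blast+
    then show "i = j"
      using num_neq[of i] num_neq[of j] less_iff_Suc_add[of i j] less_iff_Suc_add[of j i]
      by (cases i j rule: linorder_cases) auto
  qed
  then have "infinite (range (\<lambda>i. c (num i)))" by (rule range_inj_infinite)
  moreover have "range (\<lambda>i. c (num i)) \<subseteq> range c" by auto
  ultimately have "infinite (range c)" using finite_subset by blast
  then have bij: "bij_betw (to_nat_on (range c)) (range c) UNIV"
    by (intro to_nat_on_infinite) auto
  define cls where "cls t = to_nat_on (range c) (c t)" for t
  have cls: "cls s = cls t \<longleftrightarrow> Eq s t \<in> H" for s t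
    unfolding cls_def c[symmetric] using bij by (metis bij_betw_imp_inj_on inj_onD rangeI)
  have "surj cls"
    using bij unfolding bij_betw_def cls_def by (metis image_image)
  define rp where "rp = inv cls"
  have rp: "cls (rp n) = n" for n unfolding rp_def using \<open>surj cls\<close> by (rule surj_f_inv_f)
  have rp': "Eq (rp (cls t)) t \<in> H" for t using cls rp by blast
  define M where "M = \<lparr>zer = cls Zero, suc = \<lambda>x. cls (Succ (rp x)),
      pls = \<lambda>x y. cls (Plus (rp x) (rp y)), tms = \<lambda>x y. cls (Times (rp x) (rp y)),
      lss = \<lambda>x y. Less (rp x) (rp y) \<in> H\<rparr>"
  have ev: "ev M (\<lambda>i. cls (\<sigma> i)) t = cls (sbT \<sigma> t)" for \<sigma> t
    by (induction t) (auto simp: M_def cls intro: cSucc cPlus cTimes rp')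
  have holds: "holds M (\<lambda>i. cls (\<sigma> i)) \<psi> \<longleftrightarrow> sb \<sigma> \<psi> \<in> H" for \<sigma> \<psi>
  proof (induction \<psi> arbitrary: \<sigma>)
    case (Less s t)
    have "Less (rp (cls u)) (rp (cls v)) \<in> H \<longleftrightarrow> Less u v \<in> H" for u v
      using cLess[OF rp' rp'] cLess[OF sym[OF rp'] sym[OF rp']] by blast
    moreover have "lss M x y \<longleftrightarrow> Less (rp x) (rp y) \<in> H" for x y by (simp add: M_def)
    ultimately show ?case by (simp add: ev)
  next
    case (Forall \<psi>)
    have *: "case_nat (cls t) (\<lambda>i. cls (\<sigma> i)) = (\<lambda>i. cls (case_nat t \<sigma> i))" for t
      by (rule ext) (auto split: nat.split)
    have "holds M (\<lambda>i. cls (\<sigma> i)) (Forall \<psi>)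
        \<longleftrightarrow> (\<forall>t. holds M (case_nat (cls t) (\<lambda>i. cls (\<sigma> i))) \<psi>)"
      by simp (metis rp)
    then show ?case by (simp add: * Forall HA sb_subst)
  qed (auto simp: ev cls HN HI)
  have "models M T" unfolding models_def
  proof (intro ballI allI)
    fix \<psi> and e :: "nat \<Rightarrow> nat" assume \<psi>: "\<psi> \<in> T"
    then have "fv \<psi> = {}" using T by (simp add: LA_theory_def sentence_def)
    then have "sb (\<lambda>i. rp (e i)) \<psi> \<in> H"
      using \<psi> by (simp add: sb_sentence pr proves.Ax)
    then show "holds M e \<psi>" using holds[of "\<lambda>i. rp (e i)" \<psi>] by (simp add: rp)
  qed
  then have "\<phi> \<in> H" using valid[of M "\<lambda>i. cls (Var i)"] holds[of Var \<phi>] by simp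
  then show False using H0 HN by auto
qed

section \<open>Definable relations of a structure\<close>

text \<open>The variables of a definable relation are put at the even places of an environment, the
  parameters at the odd ones.\<close>

definition mg :: "(nat \<Rightarrow> 'a) \<Rightarrow> (nat \<Rightarrow> 'a) \<Rightarrow> nat \<Rightarrow> 'a" where
  "mg e p i = (if even i then e (i div 2) else p (i div 2))"

text \<open>Definability with parameters in semantic form: closure under connectives and quantifiers
  becomes a set of introduction rules, and induction formulas need not be written with de Bruijn
  indices.\<close>

definition DT :: "('a, 'b) la_str_scheme \<Rightarrow> ((nat \<Rightarrow> 'a) \<Rightarrow> 'a) \<Rightarrow> bool" where
  "DT M t \<longleftrightarrow> (\<exists>u p. \<forall>e. t e = ev M (mg e p) u)"

definition DF :: "('a, 'b) la_str_scheme \<Rightarrow> (fm \<Rightarrow> bool) \<Rightarrow> ((nat \<Rightarrow> 'a) \<Rightarrow> bool) \<Rightarrow> bool" where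
  "DF M C P \<longleftrightarrow> (\<exists>\<phi> p. C \<phi> \<and> (\<forall>e. P e \<longleftrightarrow> holds M (mg e p) \<phi>))"

text \<open>The parameter lists of two definitions are merged into \<open>mg p q\<close>. The
  parameter at place 2k + 1 is then found at place 4k + 1 if it belongs to \<open>p\<close>, and at
  place 4k + 3 if it belongs to \<open>q\<close>.\<close>

lemma mg_left: "mg e p i = mg e (mg p q) (if even i then i else 2 * i - 1)"
proof (cases "even i")
  case False
  then obtain k where "i = 2 * k + 1" using oddE by blast
  then show ?thesis by (auto simp: mg_def)
qed (simp add: mg_def)

lemma mg_right: "mg e q i = mg e (mg p q) (if even i then i else 2 * i + 1)"
proof (cases "even i")
  case False
  then obtain k where "i = 2 * k + 1" using oddE by blast
  then show ?thesis by (auto simp: mg_def)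
qed (simp add: mg_def)

text \<open>A new variable shifts the even places by two, whereas a quantifier shifts all places by
  one; this reindexing reconciles the two conventions.\<close>

lemma mg_case_nat:
  "mg (case_nat x e) p i = case_nat x (mg e p) (if i = 0 then 0 else if even i then i - 1 else Suc i)"
proof (cases "even i")
  case True
  then obtain k where "i = 2 * k" using evenE by blast
  then show ?thesis by (cases k) (auto simp: mg_def)
next
  case False
  then obtain k where "i = 2 * k + 1" using oddE by blast
  then show ?thesis by (auto simp: mg_def)
qed

definition lf :: "nat \<Rightarrow> nat" where "lf i = (if even i then i else 2 * i - 1)"
definition rg :: "nat \<Rightarrow> nat" where "rg i = (if even i then i else 2 * i + 1)"

lemma mg_lf: "(\<lambda>i. mg e (mg p q) (lf i)) = mg e p"
  by (rule ext) (simp only: lf_def mg_left[symmetric])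

lemma mg_rg: "(\<lambda>i. mg e (mg p q) (rg i)) = mg e q"
  by (rule ext) (simp only: rg_def mg_right[symmetric])

lemma ev_renT: "ev M e (renT \<rho> t) = ev M (\<lambda>i. e (\<rho> i)) t"
  by (simp add: renT_sbT ev_sbT)

lemma DT_mg: "DT M t \<Longrightarrow> \<exists>u. \<exists>q. \<forall>e. t e = ev M (mg e (mg p q)) u"
proof -
  assume "DT M t"
  then obtain u q where "\<And>e. t e = ev M (mg e q) u" unfolding DT_def by blast
  then have "t e = ev M (mg e (mg p q)) (renT rg u)" for e by (simp add: ev_renT mg_rg)
  then show ?thesis by blast
qed

lemma DT_var: "DT M (\<lambda>e. e i)"
  unfolding DT_def by (rule exI[of _ "Var (2 * i)"]) (simp add: mg_def)

lemma DT_const: "DT M (\<lambda>e. c)"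
  unfolding DT_def by (rule exI[of _ "Var 1"], rule exI[of _ "\<lambda>_. c"]) (simp add: mg_def)

lemma DT_op2:
  assumes "DT M s" "DT M t"
  shows "\<exists>u v p. \<forall>e. s e = ev M (mg e p) u \<and> t e = ev M (mg e p) v"
proof -
  obtain u p where u: "\<And>e. s e = ev M (mg e p) u" using assms(1) unfolding DT_def by blast
  obtain v q where v: "\<And>e. t e = ev M (mg e (mg p q)) v" using DT_mg[OF assms(2)] by blast
  have "s e = ev M (mg e (mg p q)) (renT lf u)" for e
    by (simp add: u ev_renT mg_lf)
  with v show ?thesis by blast
qed

lemma DT_suc: "DT M t \<Longrightarrow> DT M (\<lambda>e. suc M (t e))"
  unfolding DT_def by (metis ev.simps(3))

lemma DT_pls: "DT M s \<Longrightarrow> DT M t \<Longrightarrow> DT M (\<lambda>e. pls M (s e) (t e))"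
  using DT_op2[of M s t] unfolding DT_def by (metis ev.simps(4))

lemma DT_tms: "DT M s \<Longrightarrow> DT M t \<Longrightarrow> DT M (\<lambda>e. tms M (s e) (t e))"
  using DT_op2[of M s t] unfolding DT_def by (metis ev.simps(5))

lemmas DT_intros = DT_const DT_var DT_suc DT_pls DT_tms

definition sb_closed :: "(fm \<Rightarrow> bool) \<Rightarrow> bool" where
  "sb_closed C \<longleftrightarrow> (\<forall>\<phi> \<sigma>. C \<phi> \<longrightarrow> C (sb \<sigma> \<phi>))"

lemma sb_closed_simps [simp]: "sb_closed Delta0" "sb_closed (\<lambda>_. True)"
  by (auto simp: sb_closed_def Delta0_sb)

text \<open>The places of the new environment are values of terms, uniformly in \<open>e\<close>,
  whose parameters are merged with those of the definition. Renaming and instantiation are special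
  cases.\<close>

lemma DF_ev:
  assumes C: "sb_closed C" and P: "DF M C P"
    and \<sigma>: "\<And>p e i. (f e) i = ev M (mg e q) (\<sigma> i)"
  shows "DF M C (\<lambda>e. P (f e))"
proof -
  obtain \<phi> p where \<phi>: "C \<phi>" "\<And>e. P e \<longleftrightarrow> holds M (mg e p) \<phi>" using P unfolding DF_def by blast
  let ?\<tau> = "\<lambda>i. if even i then renT rg (\<sigma> (i div 2)) else Var (2 * i - 1)"
  have "(\<lambda>i. ev M (mg e (mg p q)) (?\<tau> i)) = mg (f e) p" for e
  proof
    fix i
    show "ev M (mg e (mg p q)) (?\<tau> i) = mg (f e) p i"
    proof (cases "even i")
      case True
      then show ?thesis using \<sigma> by (simp add: ev_renT mg_rg mg_def[of "f e"])
    next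
      case False
      then show ?thesis using mg_left[of e p i q] by (simp add: mg_def[of "f e"]) (simp add: mg_def[of e p])
    qed
  qed
  then have "P (f e) \<longleftrightarrow> holds M (mg e (mg p q)) (sb ?\<tau> \<phi>)" for e
    by (simp only: \<phi> holds_sb)
  moreover have "C (sb ?\<tau> \<phi>)" using C \<phi> by (simp add: sb_closed_def)
  ultimately show ?thesis unfolding DF_def by blast
qed

lemma DF_ren: "sb_closed C \<Longrightarrow> DF M C P \<Longrightarrow> DF M C (\<lambda>e. P (\<lambda>i. e (\<rho> i)))"
  by (rule DF_ev[where \<sigma> = "\<lambda>i. Var (2 * \<rho> i)" and q = undefined]) (auto simp: mg_def)

lemma DF_inst:
  assumes "sb_closed C" "DF M C (\<lambda>e. Q (e 0) (\<lambda>i. e (Suc i)))" "DT M t"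
  shows "DF M C (\<lambda>e. Q (t e) e)"
proof -
  obtain u p where u: "\<And>e. t e = ev M (mg e p) u" using assms(3) unfolding DT_def by blast
  have "DF M C (\<lambda>e. (\<lambda>e. Q (e 0) (\<lambda>i. e (Suc i))) (case_nat (t e) e))"
    by (rule DF_ev[OF assms(1,2), where \<sigma> = "case_nat u (\<lambda>i. Var (2 * i))" and q = p])
      (auto simp: u mg_def split: nat.split)
  then show ?thesis by simp
qed

lemma DF_op2:
  assumes C: "sb_closed C" and P: "DF M C P" and Q: "DF M C Q"
  shows "\<exists>\<phi> \<psi> p. C \<phi> \<and> C \<psi> \<and> (\<forall>e. P e = holds M (mg e p) \<phi> \<and> Q e = holds M (mg e p) \<psi>)"
proof -
  obtain \<phi> p where \<phi>: "C \<phi>" "\<And>e. P e \<longleftrightarrow> holds M (mg e p) \<phi>" using P unfolding DF_def by blast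
  obtain \<psi> q where \<psi>: "C \<psi>" "\<And>e. Q e \<longleftrightarrow> holds M (mg e q) \<psi>" using Q unfolding DF_def by blast
  have "P e = holds M (mg e (mg p q)) (ren lf \<phi>)" for e
    by (simp add: \<phi> holds_ren mg_lf)
  moreover have "Q e = holds M (mg e (mg p q)) (ren rg \<psi>)" for e
    by (simp add: \<psi> holds_ren mg_rg)
  ultimately show ?thesis
    using C \<phi>(1) \<psi>(1) unfolding sb_closed_def ren_sb by blast
qed

lemma DF_shift:
  assumes C: "sb_closed C" and P: "DF M C (\<lambda>e. Q (e 0) (\<lambda>i. e (Suc i)))"
  shows "\<exists>\<phi> p. C \<phi> \<and> (\<forall>e x. Q x e \<longleftrightarrow> holds M (case_nat x (mg e p)) \<phi>)"
proof -
  obtain \<phi> p where \<phi>: "C \<phi>" "\<And>e. Q (e 0) (\<lambda>i. e (Suc i)) \<longleftrightarrow> holds M (mg e p) \<phi>"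
    using P unfolding DF_def by blast
  let ?\<rho> = "\<lambda>i. if i = 0 then 0 else if even i then i - 1 else Suc i"
  have "(\<lambda>i. case_nat x (mg e p) (?\<rho> i)) = mg (case_nat x e) p" for x e
    by (rule ext) (rule mg_case_nat[symmetric])
  then have "Q x e \<longleftrightarrow> holds M (case_nat x (mg e p)) (ren ?\<rho> \<phi>)" for x e
    using \<phi>(2)[of "case_nat x e"] unfolding holds_ren by simp
  then show ?thesis using C \<phi>(1) unfolding sb_closed_def ren_sb by blast
qed

lemma D0_eq: "DT M s \<Longrightarrow> DT M t \<Longrightarrow> DF M Delta0 (\<lambda>e. s e = t e)"
  using DT_op2[of M s t] unfolding DF_def by (metis holds.simps(1) Delta0.intros(1))

lemma D0_less: "DT M s \<Longrightarrow> DT M t \<Longrightarrow> DF M Delta0 (\<lambda>e. lss M (s e) (t e))"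
  using DT_op2[of M s t] unfolding DF_def by (metis holds.simps(2) Delta0.intros(2))

lemma D0_const: "DF M Delta0 (\<lambda>e. c)"
  unfolding DF_def
  by (rule exI[of _ "if c then Eq Zero Zero else Neg (Eq Zero Zero)"]) (auto intro: Delta0.intros)

lemma DF_mono: "DF M C P \<Longrightarrow> (\<And>\<phi>. C \<phi> \<Longrightarrow> C' \<phi>) \<Longrightarrow> DF M C' P"
  unfolding DF_def by blast

lemma D0_neg: "DF M Delta0 P \<Longrightarrow> DF M Delta0 (\<lambda>e. \<not> P e)"
  unfolding DF_def by (metis holds.simps(3) Delta0.intros(3))

lemma D0_imp: "DF M Delta0 P \<Longrightarrow> DF M Delta0 Q \<Longrightarrow> DF M Delta0 (\<lambda>e. P e \<longrightarrow> Q e)"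
  using DF_op2[of Delta0 M P Q] unfolding DF_def by (simp, metis holds.simps(4) Delta0.intros(4))

lemma D0_conj: "DF M Delta0 P \<Longrightarrow> DF M Delta0 Q \<Longrightarrow> DF M Delta0 (\<lambda>e. P e \<and> Q e)"
  using D0_neg[OF D0_imp[OF _ D0_neg]] by simp

lemma D0_disj: "DF M Delta0 P \<Longrightarrow> DF M Delta0 Q \<Longrightarrow> DF M Delta0 (\<lambda>e. P e \<or> Q e)"
  using D0_imp[OF D0_neg] by (simp add: disj_imp)

lemma D0_iff: "DF M Delta0 P \<Longrightarrow> DF M Delta0 Q \<Longrightarrow> DF M Delta0 (\<lambda>e. P e \<longleftrightarrow> Q e)"
  using D0_conj[OF D0_imp D0_imp, of M P Q Q P] by (simp add: iff_conv_conj_imp)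

lemma D0_all:
  assumes "DF M Delta0 (\<lambda>e. Q (e 0) (\<lambda>i. e (Suc i)))" "DT M t"
  shows "DF M Delta0 (\<lambda>e. \<forall>x. lss M x (t e) \<longrightarrow> Q x e)"
proof -
  have "DF M Delta0 (\<lambda>e. lss M (e 0) (t (\<lambda>i. e (Suc i))) \<longrightarrow> Q (e 0) (\<lambda>i. e (Suc i)))"
  proof (intro D0_imp D0_less DT_var assms(1))
    obtain u p where u: "\<And>e. t e = ev M (mg e p) u" using assms(2) unfolding DT_def by blast
    have "t (\<lambda>i. e (Suc i)) = ev M (mg e p) (sbT (\<lambda>i. Var (if even i then i + 2 else i)) u)" for e
      unfolding u ev_sbT
      by (rule arg_cong[where f = "\<lambda>e. ev M e u"], rule ext) (auto simp: mg_def)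
    then show "DT M (\<lambda>e. t (\<lambda>i. e (Suc i)))" unfolding DT_def by blast
  qed
  obtain \<phi> p where \<phi>: "Delta0 \<phi>" "\<And>e x. Q x e \<longleftrightarrow> holds M (case_nat x (mg e p)) \<phi>"
    using DF_shift[OF _ assms(1)] by auto
  obtain u q where u: "\<And>e. t e = ev M (mg e (mg p q)) u" using DT_mg[OF assms(2)] by blast
  let ?\<rho> = "case_nat 0 (\<lambda>i. Suc (lf i))"
  have "(\<lambda>i. case_nat x (mg e (mg p q)) (?\<rho> i)) = case_nat x (mg e p)" for x e
  proof
    fix i show "case_nat x (mg e (mg p q)) (?\<rho> i) = case_nat x (mg e p) i"
      using fun_cong[OF mg_lf[of e p q]] by (cases i) simp_all
  qed
  then have "Q x e \<longleftrightarrow> holds M (case_nat x (mg e (mg p q))) (ren ?\<rho> \<phi>)" for x e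
    by (simp only: \<phi> holds_ren)
  then have "(\<forall>x. lss M x (t e) \<longrightarrow> Q x e) \<longleftrightarrow> holds M (mg e (mg p q))
      (ForallB u (ren ?\<rho> \<phi>))" for e
    by (simp add: ForallB_def u)
  then show ?thesis
    using \<phi>(1) unfolding DF_def ren_sb by (blast intro: Delta0.intros Delta0_sb)
qed

lemma D0_ex:
  assumes "DF M Delta0 (\<lambda>e. Q (e 0) (\<lambda>i. e (Suc i)))" "DT M t"
  shows "DF M Delta0 (\<lambda>e. \<exists>x. lss M x (t e) \<and> Q x e)"
  using D0_neg[OF D0_all[OF D0_neg[OF assms(1)] assms(2)]] by simp

lemmas D0_intros = D0_conj D0_disj D0_all D0_ex D0_iff D0_imp D0_neg D0_eq D0_less D0_const

section \<open>Arithmetic in models of ISigma1\<close>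

locale isigma1 =
  fixes M :: "'a la_str"
  assumes models_ISigma1: "models M ISigma1"
begin

abbreviation zz ("\<zero>") where "\<zero> \<equiv> zer M"
abbreviation ss where "ss \<equiv> suc M"
abbreviation pl (infixl "\<oplus>" 65) where "x \<oplus> y \<equiv> pls M x y"
abbreviation mu (infixl "\<otimes>" 70) where "x \<otimes> y \<equiv> tms M x y"
abbreviation ls (infix "\<prec>" 50) where "x \<prec> y \<equiv> lss M x y"
definition le (infix "\<preceq>" 50) where "x \<preceq> y \<longleftrightarrow> x \<prec> y \<or> x = y"

abbreviation "D0 \<equiv> DF M Delta0"

lemma D0_le: "DT M s \<Longrightarrow> DT M t \<Longrightarrow> D0 (\<lambda>e. s e \<preceq> t e)"
  unfolding le_def by (intro D0_intros)

lemma basic_axiom: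
  assumes "univ_closure \<phi> \<in> basic_axioms"
  shows "holds M e \<phi>"
  using assms models_ISigma1 holds_univ_closure[of M \<phi>] unfolding models_def ISigma1_def by blast

lemma suc_neq_zero [simp]: "ss x \<noteq> \<zero>" "\<zero> \<noteq> ss x"
  using basic_axiom[of "Neg (Eq (Succ (Var 0)) Zero)" "\<lambda>_. x"] by (auto simp: basic_axioms_def Let_def)
lemma suc_inject [simp]: "ss x = ss y \<longleftrightarrow> x = y"
  using basic_axiom[of "Imp (Eq (Succ (Var 0)) (Succ (Var 1))) (Eq (Var 0) (Var 1))" "case_nat x (\<lambda>_. y)"]
  by (auto simp: basic_axioms_def Let_def)
lemma pl_zero [simp]: "x \<oplus> \<zero> = x"
  using basic_axiom[of "Eq (Plus (Var 0) Zero) (Var 0)" "\<lambda>_. x"] by (auto simp: basic_axioms_def Let_def)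
lemma pl_suc [simp]: "x \<oplus> ss y = ss (x \<oplus> y)"
  using basic_axiom[of "Eq (Plus (Var 0) (Succ (Var 1))) (Succ (Plus (Var 0) (Var 1)))" "case_nat x (\<lambda>_. y)"]
  by (auto simp: basic_axioms_def Let_def)
lemma mu_zero [simp]: "x \<otimes> \<zero> = \<zero>"
  using basic_axiom[of "Eq (Times (Var 0) Zero) Zero" "\<lambda>_. x"] by (auto simp: basic_axioms_def Let_def)
lemma mu_suc [simp]: "x \<otimes> ss y = x \<otimes> y \<oplus> x"
  using basic_axiom[of "Eq (Times (Var 0) (Succ (Var 1))) (Plus (Times (Var 0) (Var 1)) (Var 0))" "case_nat x (\<lambda>_. y)"]
  by (auto simp: basic_axioms_def Let_def)
lemma not_less_zero [simp]: "\<not> x \<prec> \<zero>"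
  using basic_axiom[of "Neg (Less (Var 0) Zero)" "\<lambda>_. x"] by (auto simp: basic_axioms_def Let_def)
lemma less_suc: "x \<prec> ss y \<longleftrightarrow> x \<prec> y \<or> x = y"
  using basic_axiom[of "Iff (Less (Var 0) (Succ (Var 1))) (Disj (Less (Var 0) (Var 1)) (Eq (Var 0) (Var 1)))" "case_nat x (\<lambda>_. y)"]
  by (auto simp: basic_axioms_def Let_def)

lemma less_suc_le: "x \<prec> ss y \<longleftrightarrow> x \<preceq> y"
  by (simp add: less_suc le_def)

lemma Sigma1_induction:
  assumes "Sigma1 \<phi>" "holds M (case_nat \<zero> e) \<phi>"
    "\<And>x. holds M (case_nat x e) \<phi> \<Longrightarrow> holds M (case_nat (ss x) e) \<phi>"
  shows "holds M (case_nat x e) \<phi>"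
proof -
  let ?\<psi> = "Imp (subst 0 Zero \<phi>)
    (Imp (Forall (Imp \<phi> (subst 0 (Succ (Var 0)) (lift 1 \<phi>)))) (Forall \<phi>))"
  have *: "holds M (case_nat (ss x) (case_nat x e)) (lift (Suc 0) \<phi>) \<longleftrightarrow> holds M (case_nat (ss x) e) \<phi>"
    for x
    unfolding lift_sb holds_sb
    by (rule arg_cong[where f = "\<lambda>e. holds M e \<phi>"], rule ext) (auto split: nat.split)
  have "univ_closure ?\<psi> \<in> ISigma1"
    using assms(1) unfolding ISigma1_def induction_axiom_def by blast
  then have "holds M e ?\<psi>"
    using models_ISigma1 holds_univ_closure[of M ?\<psi>] unfolding models_def by blast
  then show ?thesis using assms(2,3) by (simp add: holds_subst *)
qed

text \<open>The witness \<open>w\<close> becomes the single quantifier in front of a \<Delta>0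
  formula, so that the induction formula is literally \<open>Sigma1\<close>.\<close>

lemma Sigma1_D0_induction:
  assumes "D0 (\<lambda>e. Q (e 0) (e 1))" "\<exists>w. Q w \<zero>" "\<And>x. \<exists>w. Q w x \<Longrightarrow> \<exists>w. Q w (ss x)"
  shows "\<exists>w. Q w x"
proof -
  have "D0 (\<lambda>e. (\<lambda>x e. Q x (e 0)) (e 0) (\<lambda>i. e (Suc i)))" using assms(1) by simp
  from DF_shift[OF _ this] obtain \<phi> p
    where \<phi>: "Delta0 \<phi>" "\<And>e x. Q x (e 0) \<longleftrightarrow> holds M (case_nat x (mg e p)) \<phi>" by auto
  have mg: "case_nat x (\<lambda>i. mg e p (Suc i)) = mg (case_nat x (\<lambda>i. e (Suc i))) p" for x e
    by (rule ext) (auto simp: mg_def split: nat.split)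
  have "holds M (case_nat x (\<lambda>i. mg (\<lambda>_. \<zero>) p (Suc i))) (Exists \<phi>) \<longleftrightarrow> (\<exists>w. Q w x)" for x
    by (simp add: mg) (simp add: \<phi>(2)[symmetric])
  moreover have "Sigma1 (Exists \<phi>)"
    using \<phi>(1) unfolding Sigma1_def by (metis funpow_0 funpow_Suc_right comp_apply)
  ultimately show ?thesis
    using Sigma1_induction[of "Exists \<phi>" "\<lambda>i. mg (\<lambda>_. \<zero>) p (Suc i)"] assms(2,3) by blast
qed

lemma D0_induction:
  assumes "D0 (\<lambda>e. P (e 0))" "P \<zero>" "\<And>x. P x \<Longrightarrow> P (ss x)"
  shows "P x"
proof -
  have "D0 (\<lambda>e. (\<lambda>e. P (e 0)) (\<lambda>i. e (Suc i)))" by (rule DF_ren) (use assms in simp_all)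
  then have *: "D0 (\<lambda>e. P (e 1))" by simp
  \<comment> \<open>A dummy witness, as the scheme at hand is the one for existential
    formulas.\<close>
  have "\<exists>w :: 'a. P x"
    by (rule Sigma1_D0_induction[where Q = "\<lambda>w x. P x", OF *]) (use assms in simp_all)
  then show ?thesis by simp
qed

section \<open>The ordered semiring of a model\<close>

lemma zero_pl [simp]: "\<zero> \<oplus> x = x"
  by (rule D0_induction[where P = "\<lambda>x. \<zero> \<oplus> x = x"]) (intro D0_intros DT_intros | simp)+

lemma suc_pl [simp]: "ss x \<oplus> y = ss (x \<oplus> y)"
  by (rule D0_induction[where P = "\<lambda>y. ss x \<oplus> y = ss (x \<oplus> y)"]) (intro D0_intros DT_intros | simp)+

lemma pl_commute: "x \<oplus> y = y \<oplus> x"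
  by (rule D0_induction[where P = "\<lambda>y. x \<oplus> y = y \<oplus> x"]) (intro D0_intros DT_intros | simp)+

lemma pl_assoc: "x \<oplus> y \<oplus> z = x \<oplus> (y \<oplus> z)"
  by (rule D0_induction[where P = "\<lambda>z. x \<oplus> y \<oplus> z = x \<oplus> (y \<oplus> z)"]) (intro D0_intros DT_intros | simp)+

lemma pl_left_commute: "x \<oplus> (y \<oplus> z) = y \<oplus> (x \<oplus> z)"
  by (metis pl_assoc pl_commute)

lemma zero_mu [simp]: "\<zero> \<otimes> x = \<zero>"
  by (rule D0_induction[where P = "\<lambda>x. \<zero> \<otimes> x = \<zero>"]) (intro D0_intros DT_intros | simp)+

lemma suc_mu [simp]: "ss x \<otimes> y = x \<otimes> y \<oplus> y"
  by (rule D0_induction[where P = "\<lambda>y. ss x \<otimes> y = x \<otimes> y \<oplus> y"])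
    (intro D0_intros DT_intros | simp add: pl_assoc pl_commute pl_left_commute)+

lemma mu_commute: "x \<otimes> y = y \<otimes> x"
  by (rule D0_induction[where P = "\<lambda>y. x \<otimes> y = y \<otimes> x"]) (intro D0_intros DT_intros | simp)+

lemma mu_distrib: "x \<otimes> (y \<oplus> z) = x \<otimes> y \<oplus> x \<otimes> z"
  by (rule D0_induction[where P = "\<lambda>z. x \<otimes> (y \<oplus> z) = x \<otimes> y \<oplus> x \<otimes> z"])
    (intro D0_intros DT_intros | simp add: pl_assoc)+

lemma mu_assoc: "x \<otimes> y \<otimes> z = x \<otimes> (y \<otimes> z)"
  by (rule D0_induction[where P = "\<lambda>z. x \<otimes> y \<otimes> z = x \<otimes> (y \<otimes> z)"])
    (intro D0_intros DT_intros | simp add: mu_distrib)+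

lemma pl_left_cancel: "x \<oplus> y = x \<oplus> z \<Longrightarrow> y = z"
proof -
  have "x \<oplus> y = x \<oplus> z \<longrightarrow> y = z"
    by (rule D0_induction[where P = "\<lambda>x. x \<oplus> y = x \<oplus> z \<longrightarrow> y = z"])
      (intro D0_intros DT_intros | simp)+
  then show "x \<oplus> y = x \<oplus> z \<Longrightarrow> y = z" by simp
qed

lemma zero_or_suc: "x = \<zero> \<or> (\<exists>y. x = ss y)"
proof -
  have "x = \<zero> \<or> (\<exists>y. y \<prec> x \<and> x = ss y)"
    by (rule D0_induction[where P = "\<lambda>x. x = \<zero> \<or> (\<exists>y. y \<prec> x \<and> x = ss y)"])
      (intro D0_intros DT_intros | simp add: less_suc)+
  then show ?thesis by blast
qed

lemma less_pl_suc: "x \<prec> x \<oplus> ss d"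
  by (rule D0_induction[where P = "\<lambda>d. x \<prec> x \<oplus> ss d"]) (intro D0_intros DT_intros | simp add: less_suc)+

text \<open>The difference is carried along as the witness of a \<Sigma>1 induction on
  \<open>y\<close>, so no bound for it has to be known.\<close>

lemma less_iff: "x \<prec> y \<longleftrightarrow> (\<exists>d. y = x \<oplus> ss d)"
proof
  have "\<exists>d. x \<prec> y \<longrightarrow> y = x \<oplus> ss d"
  proof (rule Sigma1_D0_induction[where Q = "\<lambda>d y. x \<prec> y \<longrightarrow> y = x \<oplus> ss d"])
    fix y assume "\<exists>d. x \<prec> y \<longrightarrow> y = x \<oplus> ss d"
    then show "\<exists>d. x \<prec> ss y \<longrightarrow> ss y = x \<oplus> ss d"
      by (metis less_suc pl_suc pl_zero)
  qed (intro D0_intros DT_intros | simp)+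
  then show "x \<prec> y \<Longrightarrow> \<exists>d. y = x \<oplus> ss d" by blast
qed (use less_pl_suc in blast)

lemma le_iff: "x \<preceq> y \<longleftrightarrow> (\<exists>d. y = x \<oplus> d)"
  unfolding le_def less_iff by (metis zero_or_suc pl_zero)

lemma less_linear: "x \<preceq> y \<or> y \<preceq> x"
proof (rule D0_induction[where P = "\<lambda>y. x \<preceq> y \<or> y \<preceq> x"])
  show "x \<preceq> \<zero> \<or> \<zero> \<preceq> x" by (auto simp: le_iff)
  fix y assume *: "x \<preceq> y \<or> y \<preceq> x"
  show "x \<preceq> ss y \<or> ss y \<preceq> x"
  proof (cases "x \<preceq> y")
    case True
    then show ?thesis by (metis less_suc_le le_def)
  next
    case False
    with * have "y \<prec> x" by (auto simp: le_def)
    then show ?thesis unfolding less_iff le_iff by (metis pl_suc suc_pl)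
  qed
qed (intro D0_intros D0_le DT_intros)

lemma less_irrefl: "\<not> x \<prec> x"
  unfolding less_iff by (metis pl_left_cancel pl_zero suc_neq_zero(1))

text \<open>Truncated subtraction, an operation of \<^class>\<open>linordered_semidom\<close>.\<close>

definition mi where "mi x y = (if y \<preceq> x then THE d. x = y \<oplus> d else \<zero>)"

lemma mi_pl: "mi (x \<oplus> y) x = y"
proof -
  have "(THE d. x \<oplus> y = x \<oplus> d) = y" by (rule the_equality) (auto dest: pl_left_cancel)
  moreover have "x \<preceq> x \<oplus> y" using le_iff by blast
  ultimately show ?thesis by (simp add: mi_def)
qed

lemma mi_zero: "\<not> y \<preceq> x \<Longrightarrow> mi x y = \<zero>"
  by (simp add: mi_def)

lemma pl_eq_zero: "x \<oplus> y = \<zero> \<longleftrightarrow> x = \<zero> \<and> y = \<zero>"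
  using zero_or_suc[of x] zero_or_suc[of y] by auto

lemma le_antisym: "x \<preceq> y \<Longrightarrow> y \<preceq> x \<Longrightarrow> x = y"
  unfolding le_iff by (metis pl_assoc pl_eq_zero pl_left_cancel pl_zero)

lemma le_trans: "x \<preceq> y \<Longrightarrow> y \<preceq> z \<Longrightarrow> x \<preceq> z"
  unfolding le_iff by (metis pl_assoc)

lemma mi_zero_left: "mi \<zero> z = \<zero>"
  using mi_pl[of \<zero> z] mi_zero[of z \<zero>] by (metis le_iff pl_eq_zero mi_pl)

lemma mi_mi: "mi (mi x y) z = mi x (y \<oplus> z)"
proof (cases "y \<preceq> x")
  case True
  then obtain d where x: "x = y \<oplus> d" unfolding le_iff by blast
  show ?thesis
  proof (cases "z \<preceq> d")
    case True
    then obtain c where "d = z \<oplus> c" unfolding le_iff by blast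
    then show ?thesis by (simp add: x mi_pl) (simp add: pl_assoc[symmetric] mi_pl)
  next
    case False
    then have "\<not> y \<oplus> z \<preceq> x" unfolding le_iff x by (metis pl_assoc pl_left_cancel)
    with False show ?thesis by (simp add: x mi_pl mi_zero)
  qed
next
  case False
  then have "\<not> y \<oplus> z \<preceq> x" unfolding le_iff by (metis pl_assoc)
  with False show ?thesis by (simp add: mi_zero mi_zero_left)
qed

lemma mi_le: "x \<preceq> y \<Longrightarrow> mi x y = \<zero>"
  unfolding le_iff using mi_pl[of x \<zero>] mi_mi[of x x] by (auto simp: mi_zero_left)

lemma mu_strict_mono: "x \<prec> y \<Longrightarrow> \<zero> \<prec> z \<Longrightarrow> z \<otimes> x \<prec> z \<otimes> y"
  unfolding less_iff by (auto simp: mu_distrib) (metis pl_suc mu_distrib pl_assoc)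

text \<open>What this buys is \<open>algebra_simps\<close> and \<open>mult_ac\<close> inside the
  model, for the modular computations with the beta function.\<close>

sublocale linordered_semidom "(\<oplus>)" mi "(\<preceq>)" "(\<prec>)" "\<zero>" "(\<otimes>)" "ss \<zero>"
  apply unfold_locales
  subgoal by (rule pl_assoc)
  subgoal by (rule pl_commute)
  subgoal by (rule mi_pl)
  subgoal by (rule mi_mi)
  subgoal using le_antisym less_irrefl by (auto simp: le_def)
  subgoal by (simp add: le_def)
  subgoal by (rule le_trans)
  subgoal by (rule le_antisym)
  subgoal by (metis le_iff pl_assoc)
  subgoal by (rule less_linear)
  apply simp_all
  subgoal by (rule mu_assoc)
  subgoal by (rule mu_commute)
  subgoal by (metis mu_commute mu_distrib)
  subgoal by (rule mu_strict_mono)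
  subgoal for a b c
  proof (cases "c \<preceq> b")
    case False
    then have "b \<preceq> c" using less_linear by blast
    moreover from this have "a \<otimes> b \<preceq> a \<otimes> c" unfolding le_iff by (metis mu_distrib)
    ultimately show ?thesis by (simp add: mi_le)
  qed (auto simp: le_iff mi_pl mu_distrib)
  subgoal by (rule mu_distrib)
  subgoal for a b using zero_or_suc[of a] zero_or_suc[of b] by auto
  subgoal by (simp add: less_suc)
  subgoal by (metis le_iff mi_pl pl_commute)
  done
end

section \<open>Generalized \<open>\<Sigma>\<^sub>1\<close> relations\<close>

text \<open>The provability predicate is of this form, but not literally \<^const>\<open>Sigma1\<close>.\<close>

inductive gS :: "fm \<Rightarrow> bool" where
  gS_Delta0: "Delta0 \<phi> \<Longrightarrow> gS \<phi>"
| gS_Conj: "gS \<phi> \<Longrightarrow> gS \<psi> \<Longrightarrow> gS (Conj \<phi> \<psi>)"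
| gS_Disj: "gS \<phi> \<Longrightarrow> gS \<psi> \<Longrightarrow> gS (Disj \<phi> \<psi>)"
| gS_Exists: "gS \<phi> \<Longrightarrow> gS (Exists \<phi>)"
| gS_ForallB: "gS \<phi> \<Longrightarrow> gS (ForallB t \<phi>)"

lemma gS_Exists_pow: "gS \<phi> \<Longrightarrow> gS ((Exists ^^ n) \<phi>)"
  by (induction n) (auto intro: gS_Exists)

lemma gS_Sigma1: "Sigma1 \<phi> \<Longrightarrow> gS \<phi>"
  unfolding Sigma1_def by (auto intro: gS_Exists_pow gS_Delta0)

lemma gS_sb: "gS \<phi> \<Longrightarrow> gS (sb \<sigma> \<phi>)"
  by (induction arbitrary: \<sigma> rule: gS.induct) (auto simp: sb_ForallB intro: gS.intros Delta0_sb)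

lemma gS_foldr_Conj: "(\<And>\<phi>. \<phi> \<in> set \<phi>s \<Longrightarrow> gS \<phi>) \<Longrightarrow> gS \<psi> \<Longrightarrow> gS (foldr Conj \<phi>s \<psi>)"
  by (induction \<phi>s) (auto intro: gS_Conj)

lemma gS_foldr_Disj: "(\<And>\<phi>. \<phi> \<in> set \<phi>s \<Longrightarrow> gS \<phi>) \<Longrightarrow> gS \<psi> \<Longrightarrow> gS (foldr Disj \<phi>s \<psi>)"
  by (induction \<phi>s) (auto intro: gS_Disj)

lemma DT_Suc: "DT M t \<Longrightarrow> DT M (\<lambda>e. t (\<lambda>i. e (Suc i)))"
proof -
  assume "DT M t"
  then obtain u p where u: "\<And>e. t e = ev M (mg e p) u" unfolding DT_def by blast
  have "t (\<lambda>i. e (Suc i)) = ev M (mg e p) (renT (\<lambda>i. if even i then i + 2 else i) u)" for e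
    unfolding u ev_renT
    by (rule arg_cong[where f = "\<lambda>e. ev M e u"], rule ext) (auto simp: mg_def)
  then show ?thesis unfolding DT_def by blast
qed

context isigma1
begin

text \<open>The semantic counterpart of \<open>gS\<close>. There is one unbounded witness in front
  of a \<Delta>0 relation, so that \<open>Sigma1_D0_induction\<close> applies; closure under further
  quantifiers has to be earned by merging witnesses and by collection.\<close>

definition DS :: "((nat \<Rightarrow> 'a) \<Rightarrow> bool) \<Rightarrow> bool" where
  "DS P \<longleftrightarrow> (\<exists>Q. D0 (\<lambda>e. Q (e 0) (\<lambda>i. e (Suc i))) \<and> (\<forall>e. P e \<longleftrightarrow> (\<exists>w. Q w e)))"

lemma DS_D0: "D0 P \<Longrightarrow> DS P"
  unfolding DS_def by (rule exI[of _ "\<lambda>w. P"]) (simp add: DF_ren)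

lemma DS_ev:
  assumes P: "DS P" and \<sigma>: "\<And>e i. (f e) i = ev M (mg e q) (\<sigma> i)"
  shows "DS (\<lambda>e. P (f e))"
proof -
  obtain Q where Q: "D0 (\<lambda>e. Q (e 0) (\<lambda>i. e (Suc i)))" "\<And>e. P e \<longleftrightarrow> (\<exists>w. Q w e)"
    using P unfolding DS_def by blast
  have "D0 (\<lambda>e. (\<lambda>e. Q (e 0) (\<lambda>i. e (Suc i))) (case_nat (e 0) (f (\<lambda>i. e (Suc i)))))"
  proof (rule DF_ev[OF _ Q(1), where q = q
        and \<sigma> = "case_nat (Var 0) (\<lambda>i. renT (\<lambda>i. if even i then i + 2 else i) (\<sigma> i))"])
    fix e :: "nat \<Rightarrow> 'a" and i
    have *: "(\<lambda>i. mg e q (if even i then i + 2 else i)) = mg (\<lambda>i. e (Suc i)) q"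
      by (rule ext) (auto simp: mg_def)
    show "case_nat (e 0) (f (\<lambda>i. e (Suc i))) i
        = ev M (mg e q) (case_nat (Var 0) (\<lambda>i. renT (\<lambda>i. if even i then i + 2 else i) (\<sigma> i)) i)"
      by (cases i) (simp_all only: nat.case ev_renT * \<sigma>, simp add: mg_def)
  qed simp
  then have "D0 (\<lambda>e. Q (e 0) (f (\<lambda>i. e (Suc i))))" by simp
  then show ?thesis unfolding DS_def Q(2) by (intro exI[of _ "\<lambda>w e. Q w (f e)"]) simp
qed

lemma DS_ren: "DS P \<Longrightarrow> DS (\<lambda>e. P (\<lambda>i. e (\<rho> i)))"
  by (rule DS_ev[where \<sigma> = "\<lambda>i. Var (2 * \<rho> i)" and q = undefined]) (auto simp: mg_def)

lemma DS_inst: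
  assumes "DS (\<lambda>e. Q (e 0) (\<lambda>i. e (Suc i)))" "DT M t"
  shows "DS (\<lambda>e. Q (t e) e)"
proof -
  obtain u p where u: "\<And>e. t e = ev M (mg e p) u" using assms(2) unfolding DT_def by blast
  have "DS (\<lambda>e. (\<lambda>e. Q (e 0) (\<lambda>i. e (Suc i))) (case_nat (t e) e))"
    by (rule DS_ev[OF assms(1), where \<sigma> = "case_nat u (\<lambda>i. Var (2 * i))" and q = p])
      (auto simp: u mg_def split: nat.split)
  then show ?thesis by simp
qed

lemma DS_rel3:
  assumes "DS (\<lambda>e. Q (e 0) (e 1) (e 2))" and s: "DT M s" and t: "DT M t" and u: "DT M u"
  shows "DS (\<lambda>e. Q (s e) (t e) (u e))"
proof -
  have "DS (\<lambda>e. (\<lambda>x e. Q (e 0) (e 1) x) (e 0) (\<lambda>i. e (Suc i)))"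
    using DS_ren[OF assms(1), of "\<lambda>i. if i = 0 then 1 else if i = 1 then 2 else 0"] by (simp add: numeral_2_eq_2)
  then have "DS (\<lambda>e. (\<lambda>x e. Q (e 0) (e 1) x) (u (\<lambda>i. e (Suc (Suc i)))) e)"
    by (rule DS_inst) (use DT_Suc[OF DT_Suc[OF u]] in simp)
  then have "DS (\<lambda>e. (\<lambda>x e. Q (e 0) x (u (\<lambda>i. e (Suc i)))) (e 0) (\<lambda>i. e (Suc i)))"
    using DS_ren[of "\<lambda>e. Q (e 0) (e 1) (u (\<lambda>i. e (Suc (Suc i))))" "\<lambda>i. if i = 0 then 1 else if i = 1 then 0 else i"]
    by simp
  then have "DS (\<lambda>e. (\<lambda>x e. Q (e 0) x (u (\<lambda>i. e (Suc i)))) (t (\<lambda>i. e (Suc i))) e)"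
    by (rule DS_inst) (use DT_Suc[OF t] in simp)
  then have "DS (\<lambda>e. (\<lambda>x e. Q x (t e) (u e)) (e 0) (\<lambda>i. e (Suc i)))" by simp
  then have "DS (\<lambda>e. (\<lambda>x e. Q x (t e) (u e)) (s e) e)" by (rule DS_inst) (rule s)
  then show ?thesis .
qed

lemma DS_rel2:
  assumes "DS (\<lambda>e. Q (e 0) (e 1))" "DT M s" "DT M t"
  shows "DS (\<lambda>e. Q (s e) (t e))"
  using DS_rel3[of "\<lambda>x y z. Q x y" s t t] assms by simp

lemma DS_rel1:
  assumes "DS (\<lambda>e. Q (e 0))" "DT M s"
  shows "DS (\<lambda>e. Q (s e))"
  using DS_rel3[of "\<lambda>x y z. Q x" s s s] assms by simp

lemma DS_ex:
  assumes "DS (\<lambda>e. P (e 0) (\<lambda>i. e (Suc i)))"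
  shows "DS (\<lambda>e. \<exists>x. P x e)"
proof -
  obtain R where R: "D0 (\<lambda>e. R (e 0) (\<lambda>i. e (Suc i)))"
      "\<And>e. P (e 0) (\<lambda>i. e (Suc i)) \<longleftrightarrow> (\<exists>w. R w e)"
    using assms unfolding DS_def by blast
  have P: "P x e \<longleftrightarrow> (\<exists>w. R w (case_nat x e))" for x e using R(2)[of "case_nat x e"] by simp
  have "D0 (\<lambda>e. (\<lambda>e. R (e 0) (\<lambda>i. e (Suc i)))
      (\<lambda>i. e (if i < 2 then i else Suc i)))"
    by (rule DF_ren) (use R(1) in simp_all)
  moreover have "(\<lambda>i. e (if Suc i < 2 then Suc i else Suc (Suc i))) = case_nat (e 1) (\<lambda>i. e (Suc (Suc (Suc i))))"
    for e :: "nat \<Rightarrow> 'a" by (rule ext) (auto split: nat.split)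
  ultimately have *: "D0 (\<lambda>e. R (e 0) (case_nat (e (Suc 0)) (\<lambda>i. e (Suc (Suc (Suc i))))))" by simp
  show ?thesis unfolding DS_def
  \<comment> \<open>A common bound \<open>v\<close>, for instance the sum of \<open>x\<close> and
    \<open>w\<close>, merges the two unbounded quantifiers into one.\<close>
  proof (intro exI[of _ "\<lambda>v e. \<exists>x. x \<prec> ss v \<and> (\<exists>w. w \<prec> ss v \<and> R w (case_nat x e))"] conjI allI)
    fix e
    show "(\<exists>x. P x e) \<longleftrightarrow> (\<exists>v x. x \<prec> ss v \<and> (\<exists>w. w \<prec> ss v \<and> R w (case_nat x e)))"
      unfolding P less_suc_le by (metis le_iff pl_commute)
  qed (intro D0_intros DT_intros *)
qed

lemma DS_conj: assumes "DS P" "DS Q" shows "DS (\<lambda>e. P e \<and> Q e)"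
proof -
  obtain R where R: "D0 (\<lambda>e. R (e 0) (\<lambda>i. e (Suc i)))" "\<And>e. P e \<longleftrightarrow> (\<exists>w. R w e)"
    using assms unfolding DS_def by blast
  obtain S where S: "D0 (\<lambda>e. S (e 0) (\<lambda>i. e (Suc i)))" "\<And>e. Q e \<longleftrightarrow> (\<exists>w. S w e)"
    using assms unfolding DS_def by blast
  have "D0 (\<lambda>e. R (e 0) (\<lambda>i. e (Suc (Suc i))))" "D0 (\<lambda>e. S (e (Suc 0)) (\<lambda>i. e (Suc (Suc i))))"
    using DF_ren[OF _ R(1), of "\<lambda>i. if i = 0 then 0 else Suc i"] DF_ren[OF _ S(1), of Suc] by simp_all
  then have "D0 (\<lambda>e. R (e 0) (\<lambda>i. e (Suc (Suc i))) \<and> S (e (Suc 0)) (\<lambda>i. e (Suc (Suc i))))"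
    by (rule D0_conj)
  then have "DS (\<lambda>e. R (e 0) (\<lambda>i. e (Suc (Suc i))) \<and> S (e (Suc 0)) (\<lambda>i. e (Suc (Suc i))))"
    by (rule DS_D0)
  then have "DS (\<lambda>e. \<exists>v w. R w e \<and> S v e)"
    by (intro DS_ex) simp
  then show ?thesis by (simp add: R(2) S(2) conj_commute)
qed

lemma DS_disj: assumes "DS P" "DS Q" shows "DS (\<lambda>e. P e \<or> Q e)"
proof -
  obtain R where R: "D0 (\<lambda>e. R (e 0) (\<lambda>i. e (Suc i)))" "\<And>e. P e \<longleftrightarrow> (\<exists>w. R w e)"
    using assms unfolding DS_def by blast
  obtain S where S: "D0 (\<lambda>e. S (e 0) (\<lambda>i. e (Suc i)))" "\<And>e. Q e \<longleftrightarrow> (\<exists>w. S w e)"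
    using assms unfolding DS_def by blast
  have "D0 (\<lambda>e. (\<lambda>w e. R w e \<or> S w e) (e 0) (\<lambda>i. e (Suc i)))"
    by (intro D0_disj R S)
  moreover have "P e \<or> Q e \<longleftrightarrow> (\<exists>w. R w e \<or> S w e)" for e by (auto simp: R(2) S(2))
  ultimately show ?thesis unfolding DS_def by (intro exI[of _ "\<lambda>w e. R w e \<or> S w e"]) simp
qed

lemma DS_imp: "D0 P \<Longrightarrow> DS Q \<Longrightarrow> DS (\<lambda>e. P e \<longrightarrow> Q e)"
  unfolding imp_conv_disj by (rule DS_disj[OF DS_D0[OF D0_neg]])

lemma D0_fix:
  assumes "D0 (\<lambda>e. R (e 0) (\<lambda>i. e (Suc i)))"
  shows "D0 (\<lambda>e. R (e 0) (case_nat (e 1) c))"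
proof -
  have "D0 (\<lambda>e. (\<lambda>e. R (e 0) (\<lambda>i. e (Suc i))) (case_nat (e 0) (case_nat (e 1) c)))"
    by (rule DF_ev[OF _ assms, where q = c and
          \<sigma> = "case_nat (Var 0) (case_nat (Var 2) (\<lambda>i. Var (2 * i + 1)))"])
      (auto simp: mg_def split: nat.split)
  then show ?thesis by (simp only: nat.case)
qed

text \<open>\<Sigma>1 induction on the length \<open>k\<close> of an initial segment: that some
  \<open>v\<close> bounds witnesses for all \<open>x\<close> below \<open>k\<close> is \<Sigma>1,
  because only \<open>v\<close> is unbounded.\<close>

lemma collection:
  assumes "D0 (\<lambda>e. R (e 0) (e 1))" "\<And>x. x \<prec> a \<Longrightarrow> \<exists>w. R w x"
  shows "\<exists>v. \<forall>x. x \<prec> a \<longrightarrow> (\<exists>w. w \<prec> ss v \<and> R w x)"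
proof -
  have R: "D0 (\<lambda>e. R (e 0) (e (Suc 0)))" using assms(1) by simp
  have "\<exists>v. \<forall>x. x \<prec> k \<longrightarrow> x \<prec> a \<longrightarrow> (\<exists>w. w \<prec> ss v \<and> R w x)" for k
  proof (rule Sigma1_D0_induction[where Q = "\<lambda>v k. \<forall>x. x \<prec> k \<longrightarrow> x \<prec> a \<longrightarrow> (\<exists>w. w \<prec> ss v \<and> R w x)"])
    fix k assume "\<exists>v. \<forall>x. x \<prec> k \<longrightarrow> x \<prec> a \<longrightarrow> (\<exists>w. w \<prec> ss v \<and> R w x)"
    then obtain v where v: "\<And>x. x \<prec> k \<Longrightarrow> x \<prec> a \<Longrightarrow> \<exists>w. w \<preceq> v \<and> R w x" by (auto simp: less_suc_le)
    obtain w where w: "k \<prec> a \<Longrightarrow> R w k" using assms(2) by blast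
    have "\<exists>w'. w' \<preceq> v \<oplus> w \<and> R w' x" if "x \<prec> ss k" "x \<prec> a" for x
    proof (cases "x = k")
      case True
      then show ?thesis using w that by (intro exI[of _ w]) (metis le_iff pl_commute)
    next
      case False
      then show ?thesis using v[of x] that le_trans[of _ v "v \<oplus> w"] less_suc le_iff by blast
    qed
    then show "\<exists>v. \<forall>x. x \<prec> ss k \<longrightarrow> x \<prec> a \<longrightarrow> (\<exists>w. w \<prec> ss v \<and> R w x)"
      by (auto simp: less_suc_le)
  next
    have "D0 (\<lambda>e. R (e 0) (e (Suc 0)))" using assms(1) by simp
    show "D0 (\<lambda>e. \<forall>x. x \<prec> e 1 \<longrightarrow> x \<prec> a \<longrightarrow> (\<exists>w. w \<prec> ss (e 0) \<and> R w x))"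
      by (intro D0_intros DT_intros R)
  qed simp
  from this[of a] show ?thesis by blast
qed

lemma DS_all:
  assumes P: "DS (\<lambda>e. P (e 0) (\<lambda>i. e (Suc i)))" and t: "DT M t"
  shows "DS (\<lambda>e. \<forall>x. x \<prec> t e \<longrightarrow> P x e)"
proof -
  obtain R where R: "D0 (\<lambda>e. R (e 0) (\<lambda>i. e (Suc i)))"
      "\<And>e. P (e 0) (\<lambda>i. e (Suc i)) \<longleftrightarrow> (\<exists>w. R w e)"
    using P unfolding DS_def by blast
  have P: "P x e \<longleftrightarrow> (\<exists>w. R w (case_nat x e))" for x e using R(2)[of "case_nat x e"] by simp
  have "D0 (\<lambda>e. (\<lambda>e. R (e 0) (\<lambda>i. e (Suc i)))
      (\<lambda>i. e (if i < 2 then i else Suc i)))"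
    by (rule DF_ren) (use R(1) in simp_all)
  moreover have "(\<lambda>i. e (if Suc i < 2 then Suc i else Suc (Suc i))) = case_nat (e 1) (\<lambda>i. e (Suc (Suc (Suc i))))"
    for e :: "nat \<Rightarrow> 'a" by (rule ext) (auto split: nat.split)
  ultimately have *: "D0 (\<lambda>e. R (e 0) (case_nat (e (Suc 0)) (\<lambda>i. e (Suc (Suc (Suc i))))))" by simp
  show ?thesis unfolding DS_def
  proof (intro exI[of _ "\<lambda>v e. \<forall>x. x \<prec> t e \<longrightarrow> (\<exists>w. w \<prec> ss v \<and> R w (case_nat x e))"] conjI allI)
    fix e
    show "(\<forall>x. x \<prec> t e \<longrightarrow> P x e) \<longleftrightarrow> (\<exists>v. \<forall>x. x \<prec> t e \<longrightarrow> (\<exists>w. w \<prec> ss v \<and> R w (case_nat x e)))"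
      unfolding P using collection[OF D0_fix[OF R(1)], of "t e" e] by blast
  qed (intro D0_intros DT_intros * DT_Suc t)
qed

lemma DS_atoms:
  "DT M s \<Longrightarrow> DT M t \<Longrightarrow> DS (\<lambda>e. s e = t e)"
  "DT M s \<Longrightarrow> DT M t \<Longrightarrow> DS (\<lambda>e. s e \<prec> t e)"
  "DT M s \<Longrightarrow> DT M t \<Longrightarrow> DS (\<lambda>e. s e \<preceq> t e)"
  by (auto intro: DS_D0 D0_eq D0_less D0_le)

lemma DS_not: "D0 P \<Longrightarrow> DS (\<lambda>e. \<not> P e)"
  by (intro DS_D0 D0_neg)

lemmas DS_intros = DS_conj DS_disj DS_all DS_ex DS_imp DS_atoms DS_not

lemma gS_DS: "gS \<phi> \<Longrightarrow> DS (\<lambda>e. holds M e \<phi>)"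
proof (induction rule: gS.induct)
  case (gS_Delta0 \<phi>)
  have "holds M e \<phi> \<longleftrightarrow> holds M (mg e undefined) (ren (\<lambda>i. 2 * i) \<phi>)" for e
    by (simp add: holds_ren mg_def)
  then have "D0 (\<lambda>e. holds M e \<phi>)"
    using gS_Delta0 unfolding DF_def ren_sb by (blast intro: Delta0_sb)
  then show ?case by (rule DS_D0)
next
  case (gS_Exists \<phi>)
  have *: "case_nat (e 0) (\<lambda>i. e (Suc i)) = e" for e :: "nat \<Rightarrow> 'a"
    by (rule ext) (auto split: nat.split)
  show ?case using gS_Exists by (simp, intro DS_ex) (simp add: *)
next
  case (gS_ForallB \<phi> t)
  have *: "case_nat (e 0) (\<lambda>i. e (Suc i)) = e" for e :: "nat \<Rightarrow> 'a"
    by (rule ext) (auto split: nat.split)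
  have "ev M e t = ev M (mg e undefined) (renT (\<lambda>i. 2 * i) t)" for e
    by (simp add: ev_renT mg_def)
  then have "DT M (\<lambda>e. ev M e t)" unfolding DT_def by blast
  then show ?case using gS_ForallB by (simp add: ForallB_def, intro DS_all) (simp_all add: *)
qed (simp_all add: DS_intros)

lemma DS_induction:
  assumes P: "DS (\<lambda>e. P (e 0))" and "P \<zero>" "\<And>x. P x \<Longrightarrow> P (ss x)"
  shows "P x"
proof -
  obtain R where R: "D0 (\<lambda>e. R (e 0) (\<lambda>i. e (Suc i)))" "\<And>e. P (e 0) \<longleftrightarrow> (\<exists>w. R w e)"
    using P unfolding DS_def by blast
  have P: "P x \<longleftrightarrow> (\<exists>w. R w (case_nat x (\<lambda>_. \<zero>)))" for x using R(2)[of "case_nat x (\<lambda>_. \<zero>)"] by simp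
  show ?thesis
    using assms(2,3) unfolding P
    by (rule Sigma1_D0_induction[where Q = "\<lambda>w x. R w (case_nat x (\<lambda>_. \<zero>))", OF D0_fix[OF R(1)]])
qed

text \<open>A counterexample \<open>a\<close> could be descended from: for every \<open>d\<close>
  there would be a counterexample \<open>x\<close> with x + d = a. This is \<Sigma>1 in
  \<open>d\<close> and absurd for d = a + 1.\<close>

lemma Pi1_induction:
  assumes P: "DS (\<lambda>e. \<not> P (e 0))" and "P \<zero>" and step: "\<And>x. P x \<Longrightarrow> P (ss x)"
  shows "P a"
proof (rule ccontr)
  assume a: "\<not> P a"
  have "\<exists>x. x \<oplus> d = a \<and> \<not> P x" for d
  proof (rule DS_induction[where P = "\<lambda>d. \<exists>x. x \<oplus> d = a \<and> \<not> P x"])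
    fix d assume "\<exists>x. x \<oplus> d = a \<and> \<not> P x"
    then obtain x where x: "x \<oplus> d = a" "\<not> P x" by blast
    then obtain y where "x = ss y" using zero_or_suc \<open>P \<zero>\<close> by metis
    with x step show "\<exists>x. x \<oplus> ss d = a \<and> \<not> P x" by (metis pl_suc suc_pl)
  qed (intro DS_ex DS_conj DS_atoms DT_intros DS_rel1[OF P], use a in auto)
  then obtain x where "x \<oplus> ss a = a" by blast
  then show False by (metis pl_commute pl_left_cancel pl_suc pl_zero suc_neq_zero(1) suc_pl)
qed

text \<open>Without a least element, \<Sigma>1 induction shows that \<open>P\<close> fails
  everywhere below each \<open>x\<close>; this statement is \<Sigma>1 by closure under bounded
  quantification.\<close>

lemma least_Pi1:
  assumes P: "DS (\<lambda>e. \<not> P (e 0))" and a: "P a"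
  obtains x where "P x" "\<And>y. y \<prec> x \<Longrightarrow> \<not> P y"
proof -
  have "\<exists>x. P x \<and> (\<forall>y. y \<prec> x \<longrightarrow> \<not> P y)"
  proof (rule ccontr)
    assume *: "\<not> ?thesis"
    have "\<forall>y. y \<prec> x \<longrightarrow> \<not> P y" for x
      by (rule DS_induction[where P = "\<lambda>x. \<forall>y. y \<prec> x \<longrightarrow> \<not> P y"])
        (intro DS_all DT_intros DS_rel1[OF P], use * in \<open>auto simp: less_suc\<close>)
    then show False using a less_suc by blast
  qed
  then show ?thesis using that by blast
qed

section \<open>The beta function\<close>

definition dv :: "'a \<Rightarrow> 'a \<Rightarrow> bool" where "dv m x \<longleftrightarrow> (\<exists>k. x = m \<otimes> k)"

lemma dvI: "x = m \<otimes> k \<Longrightarrow> dv m x"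
  unfolding dv_def by blast

lemma dv_pl: "dv m x \<Longrightarrow> dv m y \<Longrightarrow> dv m (x \<oplus> y)"
  unfolding dv_def by (metis mu_distrib)

lemma dv_mu: "dv m x \<Longrightarrow> dv m (x \<otimes> y)"
  unfolding dv_def by (metis mu_assoc)

lemma dv_cancel: "dv m (x \<oplus> y) \<Longrightarrow> dv m x \<Longrightarrow> dv m y"
  unfolding dv_def by (metis mi_pl right_diff_distrib')

lemma division: "m \<noteq> \<zero> \<Longrightarrow> \<exists>k v. v \<prec> m \<and> a = k \<otimes> m \<oplus> v"
proof (rule DS_induction[where P = "\<lambda>a. \<exists>k v. v \<prec> m \<and> a = k \<otimes> m \<oplus> v"])
  assume "m \<noteq> \<zero>"
  then show "\<exists>k v. v \<prec> m \<and> \<zero> = k \<otimes> m \<oplus> v" by (metis zero_or_suc less_suc_le le_iff zero_pl zero_mu)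
  fix a assume "\<exists>k v. v \<prec> m \<and> a = k \<otimes> m \<oplus> v"
  then obtain k v where *: "v \<prec> m" "a = k \<otimes> m \<oplus> v" by blast
  show "\<exists>k v. v \<prec> m \<and> ss a = k \<otimes> m \<oplus> v"
  proof (cases "ss v = m")
    case True
    then have "ss a = ss k \<otimes> m \<oplus> \<zero>" using * by (simp add: algebra_simps flip: True)
    then show ?thesis using True by (metis less_suc_le le_iff zero_pl)
  next
    case False
    then have "ss v \<prec> m" using *(1) unfolding less_iff by (metis pl_suc pl_zero suc_pl zero_or_suc)
    then show ?thesis using *(2) by (metis pl_suc)
  qed
qed (intro DS_intros DT_intros)

lemma division_unique:
  assumes "v \<prec> m" "w \<prec> m" "k \<otimes> m \<oplus> v = l \<otimes> m \<oplus> w"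
  shows "v = w"
proof -
  have "\<not> l \<prec> k" if "w \<prec> m" "k \<otimes> m \<oplus> v = l \<otimes> m \<oplus> w" for k l v w
  proof
    assume "l \<prec> k"
    then obtain d where "k = l \<oplus> ss d" using less_iff by blast
    then have "l \<otimes> m \<oplus> (m \<oplus> (d \<otimes> m \<oplus> v)) = l \<otimes> m \<oplus> w"
      using that(2) by (simp add: algebra_simps)
    then have "m \<oplus> (d \<otimes> m \<oplus> v) = w" by (rule pl_left_cancel)
    then have "m \<preceq> w" using le_iff by blast
    with that(1) show False by (metis le_def less_irrefl le_antisym)
  qed
  then have "k = l" using assms less_linear unfolding le_def by metis
  then show ?thesis using assms(3) pl_left_cancel by blast
qed

text \<open>The modulus of place \<open>i\<close> in the beta function, called \<open>m\<close> in
  \<open>beta\<close>.\<close>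

definition q :: "'a \<Rightarrow> 'a \<Rightarrow> 'a" where "q b i = ss (ss i \<otimes> b)"

definition bt :: "'a \<Rightarrow> 'a \<Rightarrow> 'a \<Rightarrow> 'a" where
  "bt a b i = (THE v. v \<prec> q b i \<and> (\<exists>k. a = k \<otimes> q b i \<oplus> v))"

lemma bt_iff: "bt a b i = v \<longleftrightarrow> v \<prec> q b i \<and> (\<exists>k. a = k \<otimes> q b i \<oplus> v)"
proof -
  have "q b i \<noteq> \<zero>" by (simp add: q_def)
  then obtain w where w: "w \<prec> q b i \<and> (\<exists>k. a = k \<otimes> q b i \<oplus> w)" using division by blast
  then have u: "v \<prec> q b i \<and> (\<exists>k. a = k \<otimes> q b i \<oplus> v) \<Longrightarrow> v = w" for v
    using division_unique by blast
  have bt: "bt a b i = w" unfolding bt_def by (rule the_equality) (rule w, rule u)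
  show ?thesis
  proof
    assume "bt a b i = v"
    with bt w show "v \<prec> q b i \<and> (\<exists>k. a = k \<otimes> q b i \<oplus> v)" by simp
  qed (unfold bt, rule u[symmetric])
qed

lemma DS_bt: 
  assumes "DT M a" "DT M b" "DT M i" "DT M v"
  shows "DS (\<lambda>e. bt (a e) (b e) (i e) = v e)"
proof -
  have "DS (\<lambda>e. v e \<prec> q (b e) (i e) \<and> (\<exists>k. a e = k \<otimes> q (b e) (i e) \<oplus> v e))"
    unfolding q_def using assms by (intro DS_intros DT_intros DT_Suc)
  then show ?thesis by (simp add: bt_iff)
qed

lemma DS_bound:
  assumes G: "DS (\<lambda>e. G (e 0) (e 1))" and ex: "\<And>i. i \<prec> n \<Longrightarrow> \<exists>v. G i v"
  shows "\<exists>W. \<forall>i. i \<prec> n \<longrightarrow> (\<exists>v. v \<preceq> W \<and> G i v)"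
proof -
  have "\<exists>W. \<forall>i. i \<prec> k \<longrightarrow> i \<prec> n \<longrightarrow> (\<exists>v. v \<preceq> W \<and> G i v)" for k
  proof (rule DS_induction[where P = "\<lambda>k. \<exists>W. \<forall>i. i \<prec> k \<longrightarrow> i \<prec> n \<longrightarrow> (\<exists>v. v \<preceq> W \<and> G i v)"])
    show "DS (\<lambda>e. \<exists>W. \<forall>i. i \<prec> e 0 \<longrightarrow> i \<prec> n \<longrightarrow> (\<exists>v. v \<preceq> W \<and> G i v))"
      by (intro DS_intros D0_intros DT_intros DS_rel2[OF G])
    fix k assume "\<exists>W. \<forall>i. i \<prec> k \<longrightarrow> i \<prec> n \<longrightarrow> (\<exists>v. v \<preceq> W \<and> G i v)"
    then obtain W where W: "\<And>i. i \<prec> k \<Longrightarrow> i \<prec> n \<Longrightarrow> \<exists>v. v \<preceq> W \<and> G i v" by blast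
    obtain v where v: "k \<prec> n \<Longrightarrow> G k v" using ex by blast
    have "W \<preceq> W \<oplus> v" "v \<preceq> W \<oplus> v" using le_iff pl_commute by metis+
    then have "\<exists>w. w \<preceq> W \<oplus> v \<and> G i w" if "i \<prec> ss k" "i \<prec> n" for i
      using that W[of i] v le_trans unfolding less_suc by blast
    then show "\<exists>W. \<forall>i. i \<prec> ss k \<longrightarrow> i \<prec> n \<longrightarrow> (\<exists>v. v \<preceq> W \<and> G i v)" by blast
  qed simp
  from this[of n] show ?thesis by blast
qed

text \<open>Stands in for the factorial, whose graph would itself require coded sequences; the
  existence of some common multiple is provable by \<Sigma>1 induction directly.\<close>

lemma common_multiple: "\<exists>L. L \<noteq> \<zero> \<and> (\<forall>d. d \<prec> ss n \<longrightarrow> d \<noteq> \<zero> \<longrightarrow> (\<exists>k. L = d \<otimes> k))"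
proof (rule DS_induction[where P = "\<lambda>n. \<exists>L. L \<noteq> \<zero> \<and> (\<forall>d. d \<prec> ss n \<longrightarrow> d \<noteq> \<zero> \<longrightarrow> (\<exists>k. L = d \<otimes> k))"])
  show "\<exists>L. L \<noteq> \<zero> \<and> (\<forall>d. d \<prec> ss \<zero> \<longrightarrow> d \<noteq> \<zero> \<longrightarrow> (\<exists>k. L = d \<otimes> k))"
    by (rule exI[of _ "ss \<zero>"]) (simp add: less_suc)
  fix n assume "\<exists>L. L \<noteq> \<zero> \<and> (\<forall>d. d \<prec> ss n \<longrightarrow> d \<noteq> \<zero> \<longrightarrow> (\<exists>k. L = d \<otimes> k))"
  then obtain L where L: "L \<noteq> \<zero>" "\<And>d. d \<prec> ss n \<Longrightarrow> d \<noteq> \<zero> \<Longrightarrow> \<exists>k. L = d \<otimes> k" by blast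
  have "\<exists>k. L \<otimes> ss n = d \<otimes> k" if "d \<prec> ss (ss n)" "d \<noteq> \<zero>" for d
    using that L(2)[of d] unfolding less_suc[of d "ss n"] by (metis mu_assoc mu_commute)
  then show "\<exists>L. L \<noteq> \<zero> \<and> (\<forall>d. d \<prec> ss (ss n) \<longrightarrow> d \<noteq> \<zero> \<longrightarrow> (\<exists>k. L = d \<otimes> k))"
    using L(1) by (intro exI[of _ "L \<otimes> ss n"]) (metis no_zero_divisors suc_neq_zero(1))
qed (intro DS_intros D0_intros DT_intros)

text \<open>A number \<open>x\<close> with \<open>x t \<equiv> -1\<close> is a unit modulo \<open>m\<close>; this form of invertibility avoids
  subtraction.\<close>

lemma minus_one_mu:
  assumes "dv m (ss x)" "dv m (ss y)"
  shows "dv m (ss (x \<otimes> y \<otimes> x))"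
proof -
  have "dv m (ss y \<otimes> (x \<otimes> x) \<oplus> ss x)" using assms dv_mu dv_pl by blast
  moreover have "ss y \<otimes> (x \<otimes> x) \<oplus> ss x = ss x \<otimes> x \<oplus> ss (x \<otimes> y \<otimes> x)"
    by (simp add: algebra_simps)
  ultimately show ?thesis using dv_cancel assms(1) dv_mu by metis
qed

text \<open>The two moduli differ by (j - i) b, and b = (j - i) e because j - i divides
  \<open>b\<close>. Multiplying the difference by X = (j + 1)^2 e gives ((j + 1) b)^2, which is 1
  modulo \<open>q b j\<close>, as (j + 1) b is -1 there. Hence \<open>q b i\<close> times X is
  -1.\<close>

lemma moduli_units:
  assumes "i \<prec> j" "j \<preceq> n" "b \<noteq> \<zero>" and b: "\<And>d. d \<preceq> n \<Longrightarrow> d \<noteq> \<zero> \<Longrightarrow> dv d b"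
  shows "\<exists>t. dv (q b j) (ss (q b i \<otimes> t))"
proof -
  obtain d where d: "j = i \<oplus> ss d" using assms(1) less_iff by blast
  then have "ss d \<preceq> n" using assms(2) unfolding le_iff by (metis pl_assoc pl_commute)
  then obtain e where e: "b = ss d \<otimes> e" using b unfolding dv_def by (metis suc_neq_zero(1))
  have "ss j \<otimes> b \<noteq> \<zero>" using assms(3) by (metis no_zero_divisors suc_neq_zero(1))
  then obtain y where y: "ss j \<otimes> b = ss y" using zero_or_suc by blast
  let ?X = "ss j \<otimes> (ss j \<otimes> e)"
  have qj: "q b j = q b i \<oplus> ss d \<otimes> b" unfolding q_def d by (simp add: algebra_simps)
  have qy: "q b j = ss (ss y)" unfolding q_def y by simp
  have "ss d \<otimes> b \<otimes> ?X = (ss d \<otimes> e) \<otimes> b \<otimes> (ss j \<otimes> ss j)" by (simp only: mult_ac)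
  also have "\<dots> = (ss j \<otimes> b) \<otimes> (ss j \<otimes> b)" unfolding e[symmetric] by (simp only: mult_ac)
  finally have "ss d \<otimes> b \<otimes> ?X = (ss j \<otimes> b) \<otimes> (ss j \<otimes> b)" .
  then have *: "ss d \<otimes> b \<otimes> ?X = ss (y \<otimes> q b j)"
    unfolding y qy by (simp add: algebra_simps)
  have "q b j \<otimes> ?X = q b i \<otimes> ?X \<oplus> ss (y \<otimes> q b j)"
    unfolding * [symmetric] by (subst qj) (simp only: distrib_right)
  then have "q b j \<otimes> ?X = y \<otimes> q b j \<oplus> ss (q b i \<otimes> ?X)" by (simp add: algebra_simps)
  then have "dv (q b j) (y \<otimes> q b j \<oplus> ss (q b i \<otimes> ?X))" by (metis dvI)
  then have "dv (q b j) (ss (q b i \<otimes> ?X))" by (rule dv_cancel) (metis dvI mu_commute)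
  then show ?thesis by blast
qed

text \<open>The Chinese remainder theorem, with values chosen by \<open>\<Sigma>\<^sub>1\<close> collection.\<close>

lemma seq_exists:
  assumes G: "DS (\<lambda>e. G (e 0) (e 1))" and ex: "\<And>i. i \<prec> n \<Longrightarrow> \<exists>v. G i v"
  obtains a b where "\<And>i. i \<prec> n \<Longrightarrow> G i (bt a b i)"
proof -
  obtain W where W: "\<And>i. i \<prec> n \<Longrightarrow> \<exists>v. v \<preceq> W \<and> G i v" using DS_bound[of G n] assms by blast
  obtain L where L: "L \<noteq> \<zero>" "\<And>d. d \<prec> ss n \<Longrightarrow> d \<noteq> \<zero> \<Longrightarrow> dv d L"
    using common_multiple[of n] unfolding dv_def by blast
  \<comment> \<open>The factor \<open>L\<close> makes the moduli pairwise coprime, and the factor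
    \<open>ss W\<close> makes each of them exceed all values up to \<open>W\<close>.\<close>
  define b where "b = L \<otimes> ss W"
  have b: "b \<noteq> \<zero>" "\<And>d. d \<preceq> n \<Longrightarrow> d \<noteq> \<zero> \<Longrightarrow> dv d b"
    unfolding b_def using L by (metis no_zero_divisors suc_neq_zero(1)) (simp add: L dv_mu less_suc_le del: mu_suc)
  have "W \<preceq> b" unfolding b_def
    using L(1) zero_or_suc[of L] le_iff by (auto simp: algebra_simps) (metis pl_commute pl_assoc suc_pl)
  then have Wq: "v \<prec> q b i" if "v \<preceq> W" for v i
    unfolding q_def less_suc_le suc_mu using that le_trans le_iff pl_commute by metis
  have units: "\<exists>t. dv (q b j) (ss (q b i \<otimes> t))" if "i \<prec> j" "j \<prec> n" for i j
    by (rule moduli_units[of i j n]) (use that b in \<open>auto simp: le_def\<close>)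
  \<comment> \<open>\<open>P\<close> plays the part of the product of the moduli treated so far: it
    is divisible by these and a unit modulo each remaining one. The value is named by
    \<open>v\<close> and divisibility is unfolded, so that the invariant is visibly
    \<Sigma>1.\<close>
  let ?S = "\<lambda>k a P. (\<forall>i. i \<prec> k \<longrightarrow> i \<prec> n \<longrightarrow>
        (\<exists>v. bt a b i = v \<and> G i v) \<and> (\<exists>r. P = q b i \<otimes> r))
      \<and> (\<forall>j. j \<prec> n \<longrightarrow> k \<preceq> j \<longrightarrow> (\<exists>t r. ss (P \<otimes> t) = q b j \<otimes> r))"
  have "\<exists>a P. ?S k a P" for k
  proof (rule DS_induction[where P = "\<lambda>k. \<exists>a P. ?S k a P"])
    show "DS (\<lambda>e. \<exists>a P. ?S (e 0) a P)"
      unfolding q_def by (intro DS_bt DS_rel2[OF G] DS_intros D0_intros D0_le DT_intros)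
    show "\<exists>a P. ?S \<zero> a P"
    proof -
      have "ss (ss \<zero> \<otimes> (ss j \<otimes> b)) = q b j \<otimes> ss \<zero>" for j by (simp add: q_def)
      then have "?S \<zero> a (ss \<zero>)" for a using not_less_zero by blast
      then show ?thesis by blast
    qed
    fix k assume "\<exists>a P. ?S k a P"
    then obtain a P where aP: "\<And>i. i \<prec> k \<Longrightarrow> i \<prec> n \<Longrightarrow> G i (bt a b i) \<and> dv (q b i) P"
      "\<And>j. j \<prec> n \<Longrightarrow> k \<preceq> j \<Longrightarrow> \<exists>t. dv (q b j) (ss (P \<otimes> t))"
      unfolding dv_def by blast
    have "\<exists>a P. (\<forall>i. i \<prec> ss k \<longrightarrow> i \<prec> n \<longrightarrow> G i (bt a b i) \<and> dv (q b i) P)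
      \<and> (\<forall>j. j \<prec> n \<longrightarrow> ss k \<preceq> j \<longrightarrow> (\<exists>t. dv (q b j) (ss (P \<otimes> t))))"
    proof (cases "k \<prec> n")
      case False
      have "k \<preceq> ss k" by (metis le_iff pl_suc pl_zero suc_pl)
      then have "\<forall>j. j \<prec> n \<longrightarrow> ss k \<preceq> j \<longrightarrow> (\<exists>t. dv (q b j) (ss (P \<otimes> t)))"
        using aP(2) le_trans by blast
      moreover have "\<forall>i. i \<prec> ss k \<longrightarrow> i \<prec> n \<longrightarrow> G i (bt a b i) \<and> dv (q b i) P"
        using aP(1) False unfolding less_suc by blast
      ultimately show ?thesis by blast
    next
      case True
      obtain F where F: "F \<preceq> W" "G k F" using W[OF True] by blast
      obtain t where t: "dv (q b k) (ss (P \<otimes> t))" using aP(2)[OF True] by (auto simp: le_def)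
      \<comment> \<open>Modulo \<open>q b k\<close> both P t and (k + 1) b are -1. So Y is a - F
        there, and adding P t Y to \<open>a\<close> leaves the residue F; modulo the earlier moduli
        nothing changes, as they divide \<open>P\<close>.\<close>
      define Y where "Y = a \<oplus> ss k \<otimes> b \<otimes> F"
      define a' where "a' = a \<oplus> P \<otimes> (t \<otimes> Y)"
      have "dv (q b k) (ss (P \<otimes> t) \<otimes> Y)" using t dv_mu by blast
      also have "ss (P \<otimes> t) \<otimes> Y = a' \<oplus> ss k \<otimes> b \<otimes> F"
        unfolding a'_def Y_def by (simp add: algebra_simps)
      finally obtain c where c: "a' \<oplus> ss k \<otimes> b \<otimes> F = q b k \<otimes> c" unfolding dv_def by blast
      obtain r v where rv: "v \<prec> q b k" "a' = r \<otimes> q b k \<oplus> v"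
        using division[of "q b k" a'] by (auto simp: q_def)
      have "(r \<oplus> F) \<otimes> q b k \<oplus> v = a' \<oplus> ss k \<otimes> b \<otimes> F \<oplus> F"
        unfolding rv(2) q_def by (simp add: algebra_simps)
      also have "\<dots> = c \<otimes> q b k \<oplus> F" unfolding c by (simp add: algebra_simps)
      finally have "v = F" using division_unique rv(1) Wq[OF F(1)] by blast
      then have "bt a' b k = F" using rv bt_iff by blast
      moreover have "bt a' b i = bt a b i" if i: "i \<prec> k" "i \<prec> n" for i
      proof -
        obtain p where p: "P = q b i \<otimes> p" using aP(1)[OF i] unfolding dv_def by blast
        obtain r where r: "bt a b i \<prec> q b i" "a = r \<otimes> q b i \<oplus> bt a b i" using bt_iff by blast
        have "a' = (r \<oplus> p \<otimes> (t \<otimes> Y)) \<otimes> q b i \<oplus> bt a b i"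
          unfolding a'_def p by (subst r(2)) (simp add: algebra_simps)
        with r(1) show ?thesis using bt_iff by blast
      qed
      ultimately have "\<forall>i. i \<prec> ss k \<longrightarrow> i \<prec> n \<longrightarrow> G i (bt a' b i) \<and> dv (q b i) (P \<otimes> q b k)"
        using aP(1) F(2) dv_mu by (auto simp: less_suc) (metis dvI mu_commute)
      moreover have "\<exists>t. dv (q b j) (ss (P \<otimes> q b k \<otimes> t))" if j: "j \<prec> n" "ss k \<preceq> j" for j
      proof -
        have "k \<prec> j" using j(2) by (metis less_suc less_suc_le le_def le_trans less_irrefl le_antisym)
        then obtain s where s: "dv (q b j) (ss (q b k \<otimes> s))" using units j(1) by blast
        obtain u where u: "dv (q b j) (ss (P \<otimes> u))" using aP(2) j(1) \<open>k \<prec> j\<close> by (auto simp: le_def)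
        \<comment> \<open>Three factors congruent to -1 are taken, because the product of two would
          be +1.\<close>
        have "P \<otimes> u \<otimes> (q b k \<otimes> s) \<otimes> (P \<otimes> u) = P \<otimes> q b k \<otimes> (u \<otimes> s \<otimes> (P \<otimes> u))"
          by (simp only: mult_ac)
        then show ?thesis using minus_one_mu[OF u s] by metis
      qed
      ultimately show ?thesis by blast
    qed
    then show "\<exists>a P. ?S (ss k) a P" unfolding dv_def by blast
  qed
  from this[of n] that show ?thesis by blast
qed

lemma seq_extend:
  obtains a' b' where "\<And>i. i \<prec> n \<Longrightarrow> bt a' b' i = bt a b i" "bt a' b' n = v"
proof -
  obtain a' b' where *: "\<And>i. i \<prec> ss n \<Longrightarrow>
      i \<prec> n \<and> bt a b i = bt a' b' i \<or> i = n \<and> bt a' b' i = v"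
    by (rule seq_exists[of "\<lambda>i w. i \<prec> n \<and> bt a b i = w \<or> i = n \<and> w = v" "ss n"])
      (intro DS_intros DS_bt DT_intros | auto simp: less_suc)+
  show ?thesis
    by (rule that[of a' b']) (use * less_suc less_irrefl in metis)+
qed

section \<open>Numerals and pairing in a model\<close>

definition nm :: "nat \<Rightarrow> 'a" where "nm n = (ss ^^ n) \<zero>"

lemma nm_simps [simp]: "nm 0 = \<zero>" "nm (Suc n) = ss (nm n)"
  by (simp_all add: nm_def)

lemma ev_num [simp]: "ev M e (num n) = nm n"
  by (induction n) (simp_all add: num_def)

definition pr :: "'a \<Rightarrow> 'a \<Rightarrow> 'a" where "pr x y = ss ((x \<oplus> y) \<otimes> (x \<oplus> y) \<oplus> x)"

lemma ev_pairT [simp]: "ev M e (pairT s t) = pr (ev M e s) (ev M e t)"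
  by (simp add: pairT_def pr_def)

lemma DT_pr: "DT M s \<Longrightarrow> DT M t \<Longrightarrow> DT M (\<lambda>e. pr (s e) (t e))"
  unfolding pr_def by (intro DT_intros)

text \<open>With s = x + y, the number s^2 + x lies below (s + 1)^2, so it determines s and then
  \<open>x\<close>.\<close>

lemma pr_inject [simp]: "pr x y = pr x' y' \<longleftrightarrow> x = x' \<and> y = y'"
proof
  assume eq: "pr x y = pr x' y'"
  have False if lt: "x \<oplus> y \<prec> x' \<oplus> y'" and eq: "pr x y = pr x' y'" for x y x' y'
  proof -
    obtain d where d: "x' \<oplus> y' = x \<oplus> y \<oplus> ss d" using lt less_iff by blast
    \<comment> \<open>K is the surplus of the larger square plus x' over s^2 + x, where c is the
      difference of the sums; it contains the summand c^2, which is positive.\<close>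
    define s c K where "s = x \<oplus> y" and "c = ss d" and "K = y \<oplus> (d \<otimes> s \<oplus> s \<otimes> c \<oplus> x' \<oplus> c \<otimes> c)"
    have "s \<otimes> s \<oplus> x = (s \<oplus> c) \<otimes> (s \<oplus> c) \<oplus> x'"
      using eq unfolding pr_def d s_def c_def by simp
    also have "\<dots> = s \<otimes> s \<oplus> (c \<otimes> s \<oplus> s \<otimes> c \<oplus> x' \<oplus> c \<otimes> c)"
      by (simp only: distrib_left distrib_right add_ac)
    also have "c \<otimes> s = x \<oplus> y \<oplus> d \<otimes> s" by (simp add: c_def s_def pl_commute)
    finally have "s \<otimes> s \<oplus> x = s \<otimes> s \<oplus> (x \<oplus> K)" unfolding K_def by (simp only: add_ac)
    then have "x \<oplus> \<zero> = x \<oplus> K" using pl_left_cancel by fastforce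
    then have "K = \<zero>" using pl_left_cancel by metis
    then have "c \<otimes> c = \<zero>" unfolding K_def by (simp only: pl_eq_zero)
    then show False unfolding c_def by simp
  qed
  from this[of x y x' y'] this[of x' y' x y] eq have s: "x \<oplus> y = x' \<oplus> y'"
    using less_linear unfolding le_def by metis
  with eq have x: "x = x'" unfolding pr_def by (metis pl_left_cancel suc_inject)
  with s show "x = x' \<and> y = y'" using pl_left_cancel by metis
qed simp

lemma nm_pair: "nm (pair m n) = pr (nm m) (nm n)"
proof -
  have add: "nm (m + n) = nm m \<oplus> nm n" for m n by (induction m) simp_all
  have "nm (m * n) = nm m \<otimes> nm n" for m n
    by (induction m) (simp_all add: add pl_commute)
  with add show ?thesis by (simp add: pair_def pr_def)
qed

section \<open>Derivations in models\<close>

text \<open>The bounded quotient in \<open>beta\<close> may be taken unbounded: the modulus is a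
  successor, so the quotient never exceeds the dividend.\<close>

lemma holds_beta [simp]:
  "holds M e (beta a b i v) \<longleftrightarrow> bt (ev M e a) (ev M e b) (ev M e i) = ev M e v"
proof -
  have "k \<preceq> k \<otimes> q y z \<oplus> w" for k y z w
    unfolding q_def by (simp add: le_iff pl_assoc) (metis pl_commute pl_assoc)
  then have "(\<exists>k. k \<prec> ss x \<and> x = k \<otimes> q y z \<oplus> w) \<longleftrightarrow> (\<exists>k. x = k \<otimes> q y z \<oplus> w)" for x y z w
    unfolding less_suc_le by metis
  then show ?thesis
    by (simp add: beta_def Let_def ExistsB_def bt_iff q_def[symmetric] del: suc_mu mu_suc)
qed

text \<open>The environment in which \<open>derivable\<close> evaluates its rules, following the
  numbering of variables fixed there.\<close>

definition renv :: "(nat \<Rightarrow> 'a) \<Rightarrow> 'a \<Rightarrow> 'a \<Rightarrow> 'a \<Rightarrow> 'a \<Rightarrow> (nat \<Rightarrow> 'a) \<Rightarrow> nat \<Rightarrow> 'a" where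
  "renv v i n b a e k = (if k < 6 then v k else if k = 6 then i else if k = 7 then n
    else if k = 8 then b else if k = 9 then a else e (k - 10))"

lemma holds_Exists_pow:
  "holds M e ((Exists ^^ n) \<phi>) \<longleftrightarrow> (\<exists>v. holds M (\<lambda>k. if k < n then v k else e (k - n)) \<phi>)"
proof (induction n arbitrary: e)
  case (Suc n)
  have *: "(\<lambda>k. if k < n then v k else case_nat x e (k - n))
      = (\<lambda>k. if k < Suc n then (v(n := x)) k else e (k - Suc n))" for v x
    by (rule ext) (auto split: nat.split simp: less_Suc_eq intro!: arg_cong[where f = e])
  have "holds M e ((Exists ^^ Suc n) \<phi>)
      \<longleftrightarrow> (\<exists>x v. holds M (\<lambda>k. if k < Suc n then (v(n := x)) k else e (k - Suc n)) \<phi>)"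
    by (simp add: Suc *)
  also have "\<dots> \<longleftrightarrow> (\<exists>v. holds M (\<lambda>k. if k < Suc n then v k else e (k - Suc n)) \<phi>)"
    (is "?L \<longleftrightarrow> ?R")
  proof
    assume ?R
    then obtain v where "holds M (\<lambda>k. if k < Suc n then v k else e (k - Suc n)) \<phi>" by blast
    then have "holds M (\<lambda>k. if k < Suc n then (v(n := v n)) k else e (k - Suc n)) \<phi>"
      by (simp only: fun_upd_triv)
    then show ?L by blast
  qed blast
  finally show ?case .
qed simp

lemma holds_foldr_Disj: "holds M e (foldr Disj R \<psi>) \<longleftrightarrow> (\<exists>\<phi>\<in>set R. holds M e \<phi>) \<or> holds M e \<psi>"
  by (induction R) auto

lemma holds_foldr_Conj: "holds M e (foldr Conj R \<psi>) \<longleftrightarrow> (\<forall>\<phi>\<in>set R. holds M e \<phi>) \<and> holds M e \<psi>"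
  by (induction R) auto

lemma holds_Falsum [simp]: "\<not> holds M e Falsum"
  by (simp add: Falsum_def num_def)

text \<open>The variables below \<open>6\<close> are the schematic variables of a rule.\<close>

definition local6 :: "fm \<Rightarrow> bool" where
  "local6 p \<longleftrightarrow> (\<forall>e e'. (\<forall>i<6. e i = e' i) \<longrightarrow> holds M e p = holds M e' p)"

definition local6T :: "tm \<Rightarrow> bool" where
  "local6T t \<longleftrightarrow> (\<forall>e e'. (\<forall>i<6. e i = e' i) \<longrightarrow> ev M e t = ev M e' t)"

text \<open>A premise is either a side condition on the schematic variables alone or a reference to
  an earlier entry. Positions occur in no other way, which is what allows derivations to be cut and
  pasted.\<close>

definition good_rule :: "fm \<Rightarrow> bool" where
  "good_rule r \<longleftrightarrow> (\<exists>ps w. r = rule ps w \<and> local6T w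
     \<and> (\<forall>p\<in>set ps. local6 p \<or> (\<exists>t. p = prem t \<and> local6T t)))"

definition good_rules :: "fm list \<Rightarrow> bool" where
  "good_rules R \<longleftrightarrow> (\<forall>r\<in>set R. good_rule r)"

definition justified :: "fm list \<Rightarrow> 'a \<Rightarrow> 'a \<Rightarrow> 'a \<Rightarrow> bool" where
  "justified R a b i \<longleftrightarrow> (\<exists>v. \<exists>r\<in>set R. holds M (renv v i \<zero> b a (\<lambda>_. \<zero>)) r)"

definition dvb :: "fm list \<Rightarrow> 'a \<Rightarrow> bool" where
  "dvb R x \<longleftrightarrow> (\<exists>a b n. bt a b n = x \<and> (\<forall>i. i \<preceq> n \<longrightarrow> justified R a b i))"

lemma holds_rule: "holds M (renv v i n b a e) (rule ps w) \<longleftrightarrow>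
  (\<forall>p\<in>set ps. holds M (renv v i n b a e) p) \<and> bt a b i = ev M (renv v i n b a e) w"
  by (simp add: rule_def holds_foldr_Conj concl_def renv_def)

lemma holds_prem: "holds M (renv v i n b a e) (prem t) \<longleftrightarrow>
  (\<exists>j. j \<prec> i \<and> bt a b j = ev M (renv v i n b a e) t)"
  by (simp add: prem_def ExistsB_def renv_def)

text \<open>Justifications only depend on the set of earlier entries, so that a derivation can be moved
  to another place of another sequence.\<close>

lemma relocate:
  assumes "good_rule r" "holds M (renv v i n b a e) r" "bt a' b' i' = bt a b i"
    and earlier: "\<And>j. j \<prec> i \<Longrightarrow> \<exists>j'. j' \<prec> i' \<and> bt a' b' j' = bt a b j"
  shows "holds M (renv v i' n' b' a' e') r"
proof -
  obtain ps w where r: "r = rule ps w" and w: "local6T w"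
    and ps: "\<And>p. p \<in> set ps \<Longrightarrow> local6 p \<or> (\<exists>t. p = prem t \<and> local6T t)"
    using assms(1) unfolding good_rule_def by blast
  have eq: "renv v i n b a e k = renv v i' n' b' a' e' k" if "k < 6" for k
    using that by (simp add: renv_def)
  have ev: "ev M (renv v i' n' b' a' e') t = ev M (renv v i n b a e) t" if "local6T t" for t
    using that eq unfolding local6T_def by metis
  have "holds M (renv v i' n' b' a' e') p" if "p \<in> set ps" for p
  proof -
    have h: "holds M (renv v i n b a e) p" using assms(2) that by (simp add: r holds_rule)
    from ps[OF that] show ?thesis
    proof
      assume "local6 p"
      then show ?thesis using h eq unfolding local6_def by blast
    next
      assume "\<exists>t. p = prem t \<and> local6T t"
      then obtain t where t: "p = prem t" "local6T t" by blast
      then obtain j where "j \<prec> i" "bt a b j = ev M (renv v i n b a e) t"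
        using h by (auto simp: holds_prem)
      then show ?thesis using earlier[of j] by (auto simp: t(1) holds_prem ev[OF t(2)])
    qed
  qed
  then show ?thesis using assms(2,3) by (simp add: r holds_rule ev[OF w])
qed

lemma justified_relocate:
  assumes "good_rules R" "justified R a b i" "bt a' b' i' = bt a b i"
    "\<And>j. j \<prec> i \<Longrightarrow> \<exists>j'. j' \<prec> i' \<and> bt a' b' j' = bt a b j"
  shows "justified R a' b' i'"
  using assms relocate unfolding justified_def good_rules_def by blast

lemma holds_derivable:
  assumes "good_rules R"
  shows "holds M e (derivable R x) \<longleftrightarrow> dvb R (ev M e x)"
proof -
  have *: "(\<lambda>k. if k < 6 then v k else case_nat i (\<lambda>k. if k < 3 then u k else e (k - 3)) (k - 6))
      = renv v i (u 0) (u 1) (u 2) e" for v i u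
  proof
    fix k :: nat
    consider "k < 6" | "k = 6" | "k = 7" | "k = 8" | "k = 9" | "k \<ge> 10" by linarith
    then show "(if k < 6 then v k else case_nat i (\<lambda>k. if k < 3 then u k else e (k - 3)) (k - 6))
      = renv v i (u 0) (u 1) (u 2) e k"
      by cases (auto simp: renv_def split: nat.split intro!: arg_cong[where f = e])
  qed
  have eu: "ev M (\<lambda>k. if k < 3 then u k else e (k - 3)) (renT (\<lambda>i. i + 3) x) = ev M e x" for u
    by (simp add: ev_renT)
  have j: "(\<exists>v. \<exists>r\<in>set R. holds M (renv v i n b a e) r) \<longleftrightarrow> justified R a b i" for i n b a
    unfolding justified_def
    using relocate[of _ _ i _ b a _ a b i] assms unfolding good_rules_def by blast
  have "holds M e (derivable R x) \<longleftrightarrow> (\<exists>u :: nat \<Rightarrow> 'a. bt (u 2) (u 1) (u 0) = ev M e x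
      \<and> (\<forall>i. i \<preceq> u 0 \<longrightarrow> justified R (u 2) (u 1) i))"
    unfolding derivable_def holds_Exists_pow
    by (simp add: ForallB_def holds_Exists_pow * eu holds_foldr_Disj j less_suc_le)
  also have "\<dots> \<longleftrightarrow> dvb R (ev M e x)"
  proof
    assume "dvb R (ev M e x)"
    then obtain a b n where "bt a b n = ev M e x \<and> (\<forall>i. i \<preceq> n \<longrightarrow> justified R a b i)"
      unfolding dvb_def by blast
    then show "\<exists>u :: nat \<Rightarrow> 'a. bt (u 2) (u 1) (u 0) = ev M e x
      \<and> (\<forall>i. i \<preceq> u 0 \<longrightarrow> justified R (u 2) (u 1) i)"
      by (intro exI[of _ "\<lambda>k. if k = 0 then n else if k = 1 then b else a"]) simp
  qed (auto simp: dvb_def)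
  finally show ?thesis .
qed

lemma less_or_offset: "i \<prec> n \<or> (\<exists>j. i = n \<oplus> j)"
  using less_linear[of n i] unfolding le_iff[of n i] le_def[of i n] by (metis pl_zero)

lemma derivation_append:
  assumes R: "good_rules R"
    and 1: "\<And>i. i \<prec> n \<Longrightarrow> justified R a b i" and 2: "\<And>i. i \<prec> m \<Longrightarrow> justified R c d i"
  obtains a' b' where "\<And>i. i \<prec> n \<oplus> m \<Longrightarrow> justified R a' b' i"
    "\<And>i. i \<prec> n \<Longrightarrow> bt a' b' i = bt a b i" "\<And>i. i \<prec> m \<Longrightarrow> bt a' b' (n \<oplus> i) = bt c d i"
proof -
  have "\<exists>v. i \<prec> n \<and> bt a b i = v \<or> (\<exists>j. i = n \<oplus> j \<and> bt c d j = v)" for i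
    using less_or_offset[of i n] by blast
  moreover have "DS (\<lambda>e. e 0 \<prec> n \<and> bt a b (e 0) = e 1 \<or> (\<exists>j. e 0 = n \<oplus> j \<and> bt c d j = e 1))"
    by (intro DS_intros DS_bt DT_intros)
  ultimately obtain a' b' where ab: "\<And>i. i \<prec> n \<oplus> m \<Longrightarrow>
      i \<prec> n \<and> bt a b i = bt a' b' i \<or> (\<exists>j. i = n \<oplus> j \<and> bt c d j = bt a' b' i)"
    using seq_exists[of "\<lambda>i v. i \<prec> n \<and> bt a b i = v \<or> (\<exists>j. i = n \<oplus> j \<and> bt c d j = v)" "n \<oplus> m"]
    by blast
  have lt: "\<not> n \<oplus> j \<prec> n" for j using le_iff le_antisym less_irrefl unfolding le_def by metis
  have lt2: "n \<oplus> j \<prec> n \<oplus> m \<longleftrightarrow> j \<prec> m" for j unfolding less_iff by (metis pl_assoc pl_left_cancel)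
  have lt1: "i \<prec> n \<Longrightarrow> i \<prec> n \<oplus> j" for i j unfolding less_iff by (metis pl_assoc suc_pl pl_suc)
  have b1: "bt a' b' i = bt a b i" if "i \<prec> n" for i using ab[of i] that lt lt1 by metis
  have b2: "bt a' b' (n \<oplus> i) = bt c d i" if "i \<prec> m" for i
    using ab[of "n \<oplus> i"] that lt lt2 pl_left_cancel by metis
  have tr: "j \<prec> k \<Longrightarrow> k \<prec> l \<Longrightarrow> j \<prec> l" for j k l
    unfolding less_iff by (metis pl_assoc pl_suc)
  have "justified R a' b' i" if "i \<prec> n \<oplus> m" for i
  proof (cases "i \<prec> n")
    case True
    show ?thesis
      by (rule justified_relocate[OF R 1[OF True] b1[OF True]]) (use b1 tr True in blast)
  next
    case False
    then obtain j where i: "i = n \<oplus> j" using less_or_offset by blast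
    with that have j: "j \<prec> m" by (simp add: lt2)
    show ?thesis unfolding i
    proof (rule justified_relocate[OF R 2[OF j] b2[OF j]])
      fix k assume k: "k \<prec> j"
      then have "n \<oplus> k \<prec> n \<oplus> j" unfolding less_iff by (metis pl_assoc)
      with b2[OF tr[OF k j]] show "\<exists>j'. j' \<prec> n \<oplus> j \<and> bt a' b' j' = bt c d k" by blast
    qed
  qed
  with b1 b2 that show ?thesis by blast
qed

text \<open>Finiteness is meant in the metatheory, which suffices because a rule has a fixed list of
  premises.\<close>

lemma joint_derivation:
  assumes R: "good_rules R" and X: "finite X" "\<And>x. x \<in> X \<Longrightarrow> dvb R x"
  shows "\<exists>a b n. (\<forall>i. i \<prec> n \<longrightarrow> justified R a b i) \<and> (\<forall>x\<in>X. \<exists>i. i \<prec> n \<and> bt a b i = x)"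
  using X
proof (induction X)
  case empty
  show ?case by (intro exI[of _ \<zero>]) simp
next
  case (insert x X)
  have "\<exists>a b n. (\<forall>i. i \<prec> n \<longrightarrow> justified R a b i) \<and> (\<forall>x\<in>X. \<exists>i. i \<prec> n \<and> bt a b i = x)"
    by (rule insert.IH) (use insert.prems in simp)
  then obtain a b n where 1: "\<And>i. i \<prec> n \<Longrightarrow> justified R a b i" "\<And>x. x \<in> X \<Longrightarrow> \<exists>i. i \<prec> n \<and> bt a b i = x"
    by blast
  obtain c d m where 2: "bt c d m = x" "\<And>i. i \<prec> ss m \<Longrightarrow> justified R c d i"
    using insert.prems[of x] unfolding dvb_def less_suc_le by auto
  obtain a' b' where ab: "\<And>i. i \<prec> n \<oplus> ss m \<Longrightarrow> justified R a' b' i"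
    "\<And>i. i \<prec> n \<Longrightarrow> bt a' b' i = bt a b i" "\<And>i. i \<prec> ss m \<Longrightarrow> bt a' b' (n \<oplus> i) = bt c d i"
    using derivation_append[OF R 1(1) 2(2)] by blast
  have "bt a' b' (n \<oplus> m) = x" "n \<oplus> m \<prec> n \<oplus> ss m"
    using ab(3)[of m] 2(1) by (simp_all add: less_suc)
  moreover have "i \<prec> n \<Longrightarrow> i \<prec> n \<oplus> ss m" for i unfolding less_iff by (metis pl_assoc suc_pl pl_suc)
  ultimately have "\<forall>y\<in>insert x X. \<exists>i. i \<prec> n \<oplus> ss m \<and> bt a' b' i = y"
    using 1(2) ab(2) by (metis insert_iff)
  with ab(1) show ?case by blast
qed

definition sat_prem :: "fm list \<Rightarrow> (nat \<Rightarrow> 'a) \<Rightarrow> fm \<Rightarrow> bool" where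
  "sat_prem R v p \<longleftrightarrow> (\<exists>t. p = prem t \<and> local6T t \<and> dvb R (ev M v t)) \<or> local6 p \<and> holds M v p"

lemma sat_prem_prem: "local6T t \<Longrightarrow> dvb R (ev M v t) \<Longrightarrow> sat_prem R v (prem t)"
  unfolding sat_prem_def by blast

text \<open>Derivations of the premises are put into one sequence, to which the conclusion is
  appended as one more entry.\<close>

lemma dvb_rule:
  assumes R: "good_rules R" and r: "rule ps w \<in> set R" and w: "local6T w"
    and ps: "\<forall>p\<in>set ps. sat_prem R v p"
  shows "dvb R (ev M v w)"
proof -
  let ?X = "{ev M v t |t. prem t \<in> set ps \<and> dvb R (ev M v t)}"
  \<comment> \<open>Only the formulas \<open>prem t\<close> form a finite set by assumption;
    injectivity passes finiteness on to the terms and hence to their values.\<close>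
  have "prem s = prem t \<Longrightarrow> s = t" for s t
  proof -
    have "inj (liftT 0)"
    proof (rule injI)
      fix x y :: tm show "liftT 0 x = liftT 0 y \<Longrightarrow> x = y"
        by (metis substT_liftT)
    qed
    then show "prem s = prem t \<Longrightarrow> s = t"
      by (auto simp: prem_def ExistsB_def Exists_def Conj_def beta_def Let_def dest: injD)
  qed
  then have "inj_on prem UNIV" by (auto intro: injI)
  then have "finite (prem -` set ps)" by (simp add: finite_vimageI)
  then have "finite ((\<lambda>t. ev M v t) ` (prem -` set ps))" by simp
  then have "finite ?X" by (rule rev_finite_subset) auto
  moreover have "dvb R x" if "x \<in> ?X" for x using that by blast
  ultimately have "\<exists>a b n. (\<forall>i. i \<prec> n \<longrightarrow> justified R a b i) \<and> (\<forall>x\<in>?X. \<exists>i. i \<prec> n \<and> bt a b i = x)"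
    by (rule joint_derivation[OF R])
  then obtain a b n
    where 1: "\<And>i. i \<prec> n \<Longrightarrow> justified R a b i" "\<And>x. x \<in> ?X \<Longrightarrow> \<exists>i. i \<prec> n \<and> bt a b i = x"
    by meson
  obtain a' b' where ab: "\<And>i. i \<prec> n \<Longrightarrow> bt a' b' i = bt a b i" "bt a' b' n = ev M v w"
    using seq_extend by blast
  let ?e = "renv v n \<zero> b' a' (\<lambda>_. \<zero>)"
  have ve: "v i = ?e i" if "i < 6" for i using that by (simp add: renv_def)
  have ev: "local6T t \<Longrightarrow> ev M ?e t = ev M v t" for t using ve unfolding local6T_def by metis
  have "holds M ?e p" if "p \<in> set ps" for p
    using bspec[OF ps that] unfolding sat_prem_def
  proof
    assume "\<exists>t. p = prem t \<and> local6T t \<and> dvb R (ev M v t)"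
    then obtain t where t: "p = prem t" "local6T t" "dvb R (ev M v t)" by blast
    then have "\<exists>i. i \<prec> n \<and> bt a b i = ev M v t" using that by (intro 1(2)) blast
    then show ?thesis using ab(1) by (auto simp: t(1) holds_prem ev[OF t(2)])
  next
    assume "local6 p \<and> holds M v p"
    then show ?thesis using ve unfolding local6_def by blast
  qed
  then have "justified R a' b' n"
    unfolding justified_def using r ab(2) ev[OF w] by (intro exI[of _ v] bexI[OF _ r]) (simp add: holds_rule)
  moreover have "justified R a' b' i" if "i \<prec> n" for i
    by (rule justified_relocate[OF R 1(1)[OF that] ab(1)[OF that]])
      (use that ab(1) in \<open>metis less_iff pl_assoc pl_suc\<close>)
  ultimately show ?thesis unfolding dvb_def using ab(2) by (metis le_def)
qed

end

section \<open>Arithmetized syntax\<close>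

lemma gS_rule:
  assumes "\<forall>p\<in>set ps. gS p" shows "gS (rule ps w)"
  unfolding rule_def
proof (rule gS_foldr_Conj)
  show "gS (concl w)"
    unfolding concl_def beta_def Let_def by (intro gS_Delta0) (auto intro: Delta0.intros)
qed (use assms in blast)

lemma gS_prem: "gS (prem t)"
  unfolding prem_def beta_def Let_def
  by (intro gS_Delta0) (auto intro: Delta0.intros)

lemma gS_Less: "gS (Less s t)"
  by (intro gS_Delta0 Delta0.intros)

lemma gS_derivable: 
  assumes "\<And>r. r \<in> set R \<Longrightarrow> gS r" shows "gS (derivable R x)"
proof -
  have "gS (beta a b i v)" for a b i v
    unfolding beta_def Let_def by (intro gS_Delta0) (auto intro: Delta0.intros)
  moreover have "gS Falsum" unfolding Falsum_def by (intro gS_Delta0 Delta0.intros)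
  then have "gS (foldr Disj R Falsum)" using assms by (rule gS_foldr_Disj[rotated])
  ultimately show ?thesis
    unfolding derivable_def by (metis gS_Exists_pow gS_Conj gS_ForallB)
qed

lemma gS_syntax_rules: "r \<in> set syntax_rules \<Longrightarrow> gS r"
proof -
  have "\<forall>r\<in>set syntax_rules. gS r"
    unfolding syntax_rules_def Let_def by (simp add: gS_rule gS_prem gS_Less)
  then show "r \<in> set syntax_rules \<Longrightarrow> gS r" by blast
qed

lemma gS_num_rules: "r \<in> set num_rules \<Longrightarrow> gS r"
  unfolding num_rules_def Let_def by (auto simp: gS_rule gS_prem)

lemma gS_syntax: "gS (TrmF x)" "gS (FrmF x)" "gS (LftF y x z)" "gS (SubF y x z w)" "gS (NumF x y)"
  unfolding TrmF_def FrmF_def LftF_def SubF_def NumF_def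
  by (simp_all add: gS_derivable gS_syntax_rules gS_num_rules)

lemma gS_proof_rules:
  assumes "gS \<tau>" shows "r \<in> set (proof_rules \<tau>) \<Longrightarrow> gS r"
proof -
  have "\<forall>r\<in>set (proof_rules \<tau>). gS r"
    unfolding proof_rules_def Let_def
    by (simp add: gS_rule gS_prem gS_syntax subst_sb gS_sb[OF assms])
  then show "r \<in> set (proof_rules \<tau>) \<Longrightarrow> gS r" by blast
qed

lemma gS_Pr: "gS \<tau> \<Longrightarrow> gS (Pr \<tau> x)"
  unfolding Pr_def by (simp add: gS_derivable gS_proof_rules)

lemma gS_Pr_dot: "gS \<tau> \<Longrightarrow> gS (Pr_dot \<tau> \<phi>)"
  unfolding Pr_dot_def Let_def
  by (intro gS_Exists_pow gS_foldr_Conj gS_Pr) (auto intro: gS_syntax)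

text \<open>Keeps only the shape of a definition of a theory, which suffices to evaluate
  \<open>Pr\<close> in a model. Which theory is defined first matters for
  \<open>necessitation\<close>.\<close>

definition defining :: "fm \<Rightarrow> bool" where "defining \<tau> \<longleftrightarrow> gS \<tau> \<and> fv \<tau> \<subseteq> {0}"

context isigma1
begin

section \<open>Codes and judgements inside a model\<close>

definition mVar :: "'a \<Rightarrow> 'a" where "mVar x = pr (nm 0) x"
definition mZero :: 'a where "mZero = pr (nm 1) \<zero>"
definition mSucc :: "'a \<Rightarrow> 'a" where "mSucc x = pr (nm 2) x"
definition mPlus :: "'a \<Rightarrow> 'a \<Rightarrow> 'a" where "mPlus x y = pr (nm 3) (pr x y)"
definition mTimes :: "'a \<Rightarrow> 'a \<Rightarrow> 'a" where "mTimes x y = pr (nm 4) (pr x y)"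
definition mEq :: "'a \<Rightarrow> 'a \<Rightarrow> 'a" where "mEq x y = pr (nm 5) (pr x y)"
definition mLess :: "'a \<Rightarrow> 'a \<Rightarrow> 'a" where "mLess x y = pr (nm 6) (pr x y)"
definition mNeg :: "'a \<Rightarrow> 'a" where "mNeg x = pr (nm 7) x"
definition mImp :: "'a \<Rightarrow> 'a \<Rightarrow> 'a" where "mImp x y = pr (nm 8) (pr x y)"
definition mForall :: "'a \<Rightarrow> 'a" where "mForall x = pr (nm 9) x"

lemma ev_codes [simp]:
  "ev M e (cVar s) = mVar (ev M e s)" "ev M e cZero = mZero" "ev M e (cSucc s) = mSucc (ev M e s)"
  "ev M e (cPlus s t) = mPlus (ev M e s) (ev M e t)" "ev M e (cTimes s t) = mTimes (ev M e s) (ev M e t)"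
  "ev M e (cEq s t) = mEq (ev M e s) (ev M e t)" "ev M e (cLess s t) = mLess (ev M e s) (ev M e t)"
  "ev M e (cNeg s) = mNeg (ev M e s)" "ev M e (cImp s t) = mImp (ev M e s) (ev M e t)"
  "ev M e (cForall s) = mForall (ev M e s)"
  by (simp_all add: cVar_def cZero_def cSucc_def cPlus_def cTimes_def cEq_def cLess_def cNeg_def
      cImp_def cForall_def mVar_def mZero_def mSucc_def mPlus_def mTimes_def mEq_def mLess_def
      mNeg_def mImp_def mForall_def del: nm_simps)

lemma DT_codes:
  assumes "DT M s"
  shows "DT M (\<lambda>e. mVar (s e))" "DT M (\<lambda>e. mSucc (s e))" "DT M (\<lambda>e. mNeg (s e))"
    "DT M (\<lambda>e. mForall (s e))"
    "DT M t \<Longrightarrow> DT M (\<lambda>e. mEq (s e) (t e))" "DT M t \<Longrightarrow> DT M (\<lambda>e. mImp (s e) (t e))"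
  unfolding mVar_def mSucc_def mNeg_def mForall_def mEq_def mImp_def
  by (intro DT_pr DT_intros assms; assumption)+

definition sdv :: "'a \<Rightarrow> bool" where "sdv x \<longleftrightarrow> dvb syntax_rules x"
definition Trm :: "'a \<Rightarrow> bool" where "Trm x \<longleftrightarrow> sdv (pr (nm 0) x)"
definition Frm :: "'a \<Rightarrow> bool" where "Frm x \<longleftrightarrow> sdv (pr (nm 1) x)"
definition Lft :: "'a \<Rightarrow> 'a \<Rightarrow> 'a \<Rightarrow> bool" where
  "Lft k x y \<longleftrightarrow> sdv (pr (nm 2) (pr k (pr x y)))"
definition Sub :: "'a \<Rightarrow> 'a \<Rightarrow> 'a \<Rightarrow> 'a \<Rightarrow> bool" where
  "Sub k u x y \<longleftrightarrow> sdv (pr (nm 3) (pr k (pr u (pr x y))))"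
definition Nm :: "'a \<Rightarrow> 'a \<Rightarrow> bool" where "Nm x y \<longleftrightarrow> dvb num_rules (pr x y)"
definition Prv :: "fm \<Rightarrow> 'a \<Rightarrow> bool" where "Prv \<tau> x \<longleftrightarrow> dvb (proof_rules \<tau>) x"

lemma ev_judgements [simp]:
  "ev M e (jTrm x) = pr (nm 0) (ev M e x)" "ev M e (jFrm x) = pr (nm 1) (ev M e x)"
  "ev M e (jLft k x y) = pr (nm 2) (pr (ev M e k) (pr (ev M e x) (ev M e y)))"
  "ev M e (jSub k u x y) = pr (nm 3) (pr (ev M e k) (pr (ev M e u) (pr (ev M e x) (ev M e y))))"
  by (simp_all add: jTrm_def jFrm_def jLft_def jSub_def del: nm_simps)

lemma good_ruleI:
  "local6T w \<Longrightarrow> (\<And>p. p \<in> set ps \<Longrightarrow> local6 p \<or> (\<exists>t. p = prem t \<and> local6T t)) \<Longrightarrow> good_rule (rule ps w)"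
  unfolding good_rule_def by blast

lemma local6T_simps [simp]:
  "i < 6 \<Longrightarrow> local6T (Var i)" "local6T Zero" "local6T s \<Longrightarrow> local6T (Succ s)"
  "local6T cZero"
  "local6T s \<Longrightarrow> local6T (cVar s)" "local6T s \<Longrightarrow> local6T (cSucc s)"
  "local6T s \<Longrightarrow> local6T (cNeg s)" "local6T s \<Longrightarrow> local6T (cForall s)"
  "local6T s \<Longrightarrow> local6T t \<Longrightarrow> local6T (pairT s t)"
  "local6T s \<Longrightarrow> local6T t \<Longrightarrow> local6T (cPlus s t)"
  "local6T s \<Longrightarrow> local6T t \<Longrightarrow> local6T (cTimes s t)"
  "local6T s \<Longrightarrow> local6T t \<Longrightarrow> local6T (cEq s t)"
  "local6T s \<Longrightarrow> local6T t \<Longrightarrow> local6T (cLess s t)"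
  "local6T s \<Longrightarrow> local6T t \<Longrightarrow> local6T (cImp s t)"
  "local6T s \<Longrightarrow> local6T (jTrm s)" "local6T s \<Longrightarrow> local6T (jFrm s)"
  "local6T s \<Longrightarrow> local6T t \<Longrightarrow> local6T u \<Longrightarrow> local6T (jLft s t u)"
  "local6T s \<Longrightarrow> local6T t \<Longrightarrow> local6T u \<Longrightarrow> local6T v \<Longrightarrow> local6T (jSub s t u v)"
  unfolding local6T_def by (simp_all del: nm_simps) metis+

lemma local6_Less [simp]: "local6T s \<Longrightarrow> local6T t \<Longrightarrow> local6 (Less s t)"
  unfolding local6_def local6T_def by (simp, metis)

lemma good_syntax_rules: "good_rules syntax_rules"
  unfolding good_rules_def syntax_rules_def Let_def
  by (simp, intro conjI good_ruleI; fastforce)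

lemma good_num_rules: "good_rules num_rules"
  unfolding good_rules_def num_rules_def Let_def
  by (simp, intro conjI good_ruleI; fastforce)

lemma holds_syntax [simp]:
  "holds M e (TrmF x) \<longleftrightarrow> Trm (ev M e x)" "holds M e (FrmF x) \<longleftrightarrow> Frm (ev M e x)"
  "holds M e (LftF k x y) \<longleftrightarrow> Lft (ev M e k) (ev M e x) (ev M e y)"
  "holds M e (SubF k u x y) \<longleftrightarrow> Sub (ev M e k) (ev M e u) (ev M e x) (ev M e y)"
  "holds M e (NumF x y) \<longleftrightarrow> Nm (ev M e x) (ev M e y)"
  by (simp_all add: TrmF_def FrmF_def LftF_def SubF_def NumF_def holds_derivable good_syntax_rules
      good_num_rules sdv_def Trm_def Frm_def Lft_def Sub_def Nm_def del: nm_simps)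

lemma local6_syntax [simp]:
  "local6T x \<Longrightarrow> local6 (TrmF x)" "local6T x \<Longrightarrow> local6 (FrmF x)"
  "local6T k \<Longrightarrow> local6T x \<Longrightarrow> local6T y \<Longrightarrow> local6 (LftF k x y)"
  "local6T k \<Longrightarrow> local6T u \<Longrightarrow> local6T x \<Longrightarrow> local6T y \<Longrightarrow> local6 (SubF k u x y)"
proof -
  have *: "ev M e t = ev M e' t" if "local6T t" "\<forall>i<6. e i = e' i" for t e e'
    using that unfolding local6T_def by blast
  show "local6T x \<Longrightarrow> local6 (TrmF x)" "local6T x \<Longrightarrow> local6 (FrmF x)"
    unfolding local6_def holds_syntax using *[of x] by metis+
  show "local6 (LftF k x y)" if "local6T k" "local6T x" "local6T y"
    unfolding local6_def holds_syntax by (intro allI impI) (simp only: that[THEN *])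
  show "local6 (SubF k u x y)" if "local6T k" "local6T u" "local6T x" "local6T y"
    unfolding local6_def holds_syntax by (intro allI impI) (simp only: that[THEN *])
qed

lemma local6_subst: "defining \<tau> \<Longrightarrow> local6T x \<Longrightarrow> local6 (subst 0 x \<tau>)"
  unfolding local6_def local6T_def holds_subst
proof (intro allI impI)
  fix e e' :: "nat \<Rightarrow> 'a"
  assume "defining \<tau>" "\<forall>i<6. e i = e' i"
    "\<forall>e e'. (\<forall>i<6. e i = e' i) \<longrightarrow> ev M e x = ev M e' x"
  then show "holds M (case_nat (ev M e x) e) \<tau> = holds M (case_nat (ev M e' x) e') \<tau>"
    by (intro holds_cong) (auto simp: defining_def)
qed

lemma good_proof_rules: "defining \<tau> \<Longrightarrow> good_rules (proof_rules \<tau>)"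
  unfolding good_rules_def proof_rules_def Let_def
  by (simp, intro conjI good_ruleI; fastforce simp: local6_subst)

lemma holds_Pr [simp]: "defining \<tau> \<Longrightarrow> holds M e (Pr \<tau> x) \<longleftrightarrow> Prv \<tau> (ev M e x)"
  by (simp add: Pr_def Prv_def holds_derivable good_proof_rules)

lemma DS_dvb:
  assumes "good_rules R" "\<And>r. r \<in> set R \<Longrightarrow> gS r" "DT M t"
  shows "DS (\<lambda>e. dvb R (t e))"
proof -
  have "DS (\<lambda>e. holds M e (derivable R (Var 0)))" by (intro gS_DS gS_derivable assms)
  then show ?thesis by (intro DS_rel1[OF _ assms(3)]) (simp add: holds_derivable[OF assms(1)])
qed

lemma DS_syntax:
  assumes "DT M x"
  shows "DS (\<lambda>e. Trm (x e))" "DS (\<lambda>e. Frm (x e))"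
    "DT M k \<Longrightarrow> DT M y \<Longrightarrow> DS (\<lambda>e. Lft (k e) (x e) (y e))"
    "DT M k \<Longrightarrow> DT M y \<Longrightarrow> DT M u \<Longrightarrow> DS (\<lambda>e. Sub (k e) (u e) (x e) (y e))"
    "DT M y \<Longrightarrow> DS (\<lambda>e. Nm (x e) (y e))"
    "defining \<tau> \<Longrightarrow> DS (\<lambda>e. Prv \<tau> (x e))"
proof -
  note syn = DS_dvb[OF good_syntax_rules gS_syntax_rules]
  show "DS (\<lambda>e. Trm (x e))" "DS (\<lambda>e. Frm (x e))"
    unfolding sdv_def Trm_def Frm_def by (intro syn DT_pr DT_const assms; assumption)+
  show "DS (\<lambda>e. Lft (k e) (x e) (y e))" if "DT M k" "DT M y"
    unfolding sdv_def Lft_def by (intro syn DT_pr DT_const assms that; assumption)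
  show "DS (\<lambda>e. Sub (k e) (u e) (x e) (y e))" if "DT M k" "DT M y" "DT M u"
    unfolding sdv_def Sub_def by (intro syn DT_pr DT_const assms that; assumption)
  show "DS (\<lambda>e. Nm (x e) (y e))" if "DT M y"
    unfolding Nm_def by (intro DS_dvb[OF good_num_rules gS_num_rules] DT_pr assms that; assumption)
  show "DS (\<lambda>e. Prv \<tau> (x e))" if "defining \<tau>"
    unfolding Prv_def using that
    by (intro DS_dvb[OF good_proof_rules gS_proof_rules[of \<tau>]] assms) (simp_all add: defining_def)
qed

text \<open>The constants \<^const>\<open>sdv\<close> and \<open>ssat\<close> hide the list of rules from the simplifier, which has
  to unfold it in the first premise of the next lemma.\<close>

definition ssat :: "(nat \<Rightarrow> 'a) \<Rightarrow> fm \<Rightarrow> bool" where "ssat v p \<longleftrightarrow> sat_prem syntax_rules v p"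

lemma syntax_rule:
  "rule ps w \<in> set syntax_rules \<Longrightarrow> local6T w \<Longrightarrow> \<forall>p\<in>set ps. ssat v p \<Longrightarrow> sdv (ev M v w)"
  unfolding ssat_def sdv_def by (rule dvb_rule[OF good_syntax_rules])

lemma ssat_premise:
  "local6T t \<Longrightarrow> sdv (ev M v t) \<Longrightarrow> ssat v (prem t)" "local6 p \<Longrightarrow> holds M v p \<Longrightarrow> ssat v p"
  unfolding ssat_def sdv_def sat_prem_def by blast+

lemmas syntax_simps = syntax_rules_def Let_def ssat_premise Trm_def Frm_def Lft_def Sub_def

section \<open>Closure of the coded syntax under its rules\<close>

lemma Trm_Var: "Trm (mVar k)"
  using syntax_rule[of "[]" "jTrm (cVar (Var 0))"
    "(!) [k, k, k, k, k, k]"]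
  by (simp add: syntax_simps)

lemma Trm_Zero: "Trm mZero"
  using syntax_rule[of "[]" "jTrm cZero"
    "(!) [\<zero>, \<zero>, \<zero>, \<zero>, \<zero>, \<zero>]"]
  by (simp add: syntax_simps)

lemma Trm_Succ: "Trm p \<Longrightarrow> Trm (mSucc p)"
  using syntax_rule[of "[prem (jTrm (Var 2))]" "jTrm (cSucc (Var 2))"
    "(!) [p, p, p, p, p, p]"]
  by (simp add: syntax_simps)

lemma Trm_Plus: "Trm p \<Longrightarrow> Trm w \<Longrightarrow> Trm (mPlus p w)"
  using syntax_rule[of "[prem (jTrm (Var 2)), prem (jTrm (Var 3))]" "jTrm (cPlus (Var 2) (Var 3))"
    "(!) [p, p, p, w, p, w]"]
  by (simp add: syntax_simps)

lemma Trm_Times: "Trm p \<Longrightarrow> Trm w \<Longrightarrow> Trm (mTimes p w)"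
  using syntax_rule[of "[prem (jTrm (Var 2)), prem (jTrm (Var 3))]" "jTrm (cTimes (Var 2) (Var 3))"
    "(!) [p, p, p, w, p, w]"]
  by (simp add: syntax_simps)

lemma Frm_Eq: "Trm p \<Longrightarrow> Trm w \<Longrightarrow> Frm (mEq p w)"
  using syntax_rule[of "[prem (jTrm (Var 2)), prem (jTrm (Var 3))]" "jFrm (cEq (Var 2) (Var 3))"
    "(!) [p, p, p, w, p, w]"]
  by (simp add: syntax_simps)

lemma Frm_Less: "Trm p \<Longrightarrow> Trm w \<Longrightarrow> Frm (mLess p w)"
  using syntax_rule[of "[prem (jTrm (Var 2)), prem (jTrm (Var 3))]" "jFrm (cLess (Var 2) (Var 3))"
    "(!) [p, p, p, w, p, w]"]
  by (simp add: syntax_simps)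

lemma Frm_Neg: "Frm p \<Longrightarrow> Frm (mNeg p)"
  using syntax_rule[of "[prem (jFrm (Var 2))]" "jFrm (cNeg (Var 2))"
    "(!) [p, p, p, p, p, p]"]
  by (simp add: syntax_simps)

lemma Frm_Imp: "Frm p \<Longrightarrow> Frm w \<Longrightarrow> Frm (mImp p w)"
  using syntax_rule[of "[prem (jFrm (Var 2)), prem (jFrm (Var 3))]" "jFrm (cImp (Var 2) (Var 3))"
    "(!) [p, p, p, w, p, w]"]
  by (simp add: syntax_simps)

lemma Frm_Forall: "Frm p \<Longrightarrow> Frm (mForall p)"
  using syntax_rule[of "[prem (jFrm (Var 2))]" "jFrm (cForall (Var 2))"
    "(!) [p, p, p, p, p, p]"]
  by (simp add: syntax_simps)

lemma Lft_Var_less: "p \<prec> k \<Longrightarrow> Lft k (mVar p) (mVar p)"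
  using syntax_rule[of "[Less (Var 2) (Var 0)]" "jLft (Var 0) (cVar (Var 2)) (cVar (Var 2))"
    "(!) [k, k, p, k, k, k]"]
  by (simp add: syntax_simps)

lemma Lft_Var_ge: "k \<prec> ss p \<Longrightarrow> Lft k (mVar p) (mVar (ss p))"
  using syntax_rule[of "[Less (Var 0) (Succ (Var 2))]" "jLft (Var 0) (cVar (Var 2)) (cVar (Succ (Var 2)))"
    "(!) [k, k, p, k, k, k]"]
  by (simp add: syntax_simps)

lemma Lft_Zero: "Lft k mZero mZero"
  using syntax_rule[of "[]" "jLft (Var 0) cZero cZero"
    "(!) [k, k, k, k, k, k]"]
  by (simp add: syntax_simps)

lemma Lft_Forall: "Lft (ss k) p p' \<Longrightarrow> Lft k (mForall p) (mForall p')"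
  using syntax_rule[of "[prem (jLft (Succ (Var 0)) (Var 2) (Var 4))]" "jLft (Var 0) (cForall (Var 2)) (cForall (Var 4))"
    "(!) [k, k, p, k, p', k]"]
  by (simp add: syntax_simps)

lemma Sub_Var_less: "p \<prec> k \<Longrightarrow> Sub k u (mVar p) (mVar p)"
  using syntax_rule[of "[Less (Var 2) (Var 0)]" "jSub (Var 0) (Var 1) (cVar (Var 2)) (cVar (Var 2))"
    "(!) [k, u, p, k, k, k]"]
  by (simp add: syntax_simps)

lemma Sub_Var_eq: "Sub k u (mVar k) u"
  using syntax_rule[of "[]" "jSub (Var 0) (Var 1) (cVar (Var 0)) (Var 1)"
    "(!) [k, u, k, k, k, k]"]
  by (simp add: syntax_simps)

lemma Sub_Var_ge: "k \<prec> ss p \<Longrightarrow> Sub k u (mVar (ss p)) (mVar p)"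
  using syntax_rule[of "[Less (Var 0) (Succ (Var 2))]" "jSub (Var 0) (Var 1) (cVar (Succ (Var 2))) (cVar (Var 2))"
    "(!) [k, u, p, k, k, k]"]
  by (simp add: syntax_simps)

lemma Sub_Zero: "Sub k u mZero mZero"
  using syntax_rule[of "[]" "jSub (Var 0) (Var 1) cZero cZero"
    "(!) [k, u, k, k, k, k]"]
  by (simp add: syntax_simps)

lemma Sub_Forall: "Lft \<zero> u w \<Longrightarrow> Sub (ss k) w p p' \<Longrightarrow> Sub k u (mForall p) (mForall p')"
  using syntax_rule[of "[prem (jLft Zero (Var 1) (Var 3)), prem (jSub (Succ (Var 0)) (Var 3) (Var 2) (Var 4))]" "jSub (Var 0) (Var 1) (cForall (Var 2)) (cForall (Var 4))"
    "(!) [k, u, p, w, p', k]"]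
  by (simp add: syntax_simps)

lemma Lft_Succ: "Lft k p p' \<Longrightarrow> Lft k (mSucc p) (mSucc p')"
  using syntax_rule[of "[prem (jLft (Var 0) (Var 2) (Var 4))]" "jLft (Var 0) (cSucc (Var 2)) (cSucc (Var 4))"
    "(!) [k, k, p, k, p', k]"]
  by (simp add: syntax_simps)

lemma Sub_Succ: "Sub k u p p' \<Longrightarrow> Sub k u (mSucc p) (mSucc p')"
  using syntax_rule[of "[prem (jSub (Var 0) (Var 1) (Var 2) (Var 4))]" "jSub (Var 0) (Var 1) (cSucc (Var 2)) (cSucc (Var 4))"
    "(!) [k, u, p, k, p', k]"]
  by (simp add: syntax_simps)

lemma Lft_Neg: "Lft k p p' \<Longrightarrow> Lft k (mNeg p) (mNeg p')"
  using syntax_rule[of "[prem (jLft (Var 0) (Var 2) (Var 4))]" "jLft (Var 0) (cNeg (Var 2)) (cNeg (Var 4))"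
    "(!) [k, k, p, k, p', k]"]
  by (simp add: syntax_simps)

lemma Sub_Neg: "Sub k u p p' \<Longrightarrow> Sub k u (mNeg p) (mNeg p')"
  using syntax_rule[of "[prem (jSub (Var 0) (Var 1) (Var 2) (Var 4))]" "jSub (Var 0) (Var 1) (cNeg (Var 2)) (cNeg (Var 4))"
    "(!) [k, u, p, k, p', k]"]
  by (simp add: syntax_simps)

lemma Lft_Plus: "Lft k p p' \<Longrightarrow> Lft k w w' \<Longrightarrow> Lft k (mPlus p w) (mPlus p' w')"
  using syntax_rule[of "[prem (jLft (Var 0) (Var 2) (Var 4)), prem (jLft (Var 0) (Var 3) (Var 5))]" "jLft (Var 0) (cPlus (Var 2) (Var 3)) (cPlus (Var 4) (Var 5))"
    "(!) [k, k, p, w, p', w']"]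
  by (simp add: syntax_simps)

lemma Sub_Plus: "Sub k u p p' \<Longrightarrow> Sub k u w w' \<Longrightarrow> Sub k u (mPlus p w) (mPlus p' w')"
  using syntax_rule[of "[prem (jSub (Var 0) (Var 1) (Var 2) (Var 4)), prem (jSub (Var 0) (Var 1) (Var 3) (Var 5))]" "jSub (Var 0) (Var 1) (cPlus (Var 2) (Var 3)) (cPlus (Var 4) (Var 5))"
    "(!) [k, u, p, w, p', w']"]
  by (simp add: syntax_simps)

lemma Lft_Times: "Lft k p p' \<Longrightarrow> Lft k w w' \<Longrightarrow> Lft k (mTimes p w) (mTimes p' w')"
  using syntax_rule[of "[prem (jLft (Var 0) (Var 2) (Var 4)), prem (jLft (Var 0) (Var 3) (Var 5))]" "jLft (Var 0) (cTimes (Var 2) (Var 3)) (cTimes (Var 4) (Var 5))"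
    "(!) [k, k, p, w, p', w']"]
  by (simp add: syntax_simps)

lemma Sub_Times: "Sub k u p p' \<Longrightarrow> Sub k u w w' \<Longrightarrow> Sub k u (mTimes p w) (mTimes p' w')"
  using syntax_rule[of "[prem (jSub (Var 0) (Var 1) (Var 2) (Var 4)), prem (jSub (Var 0) (Var 1) (Var 3) (Var 5))]" "jSub (Var 0) (Var 1) (cTimes (Var 2) (Var 3)) (cTimes (Var 4) (Var 5))"
    "(!) [k, u, p, w, p', w']"]
  by (simp add: syntax_simps)

lemma Lft_Eq: "Lft k p p' \<Longrightarrow> Lft k w w' \<Longrightarrow> Lft k (mEq p w) (mEq p' w')"
  using syntax_rule[of "[prem (jLft (Var 0) (Var 2) (Var 4)), prem (jLft (Var 0) (Var 3) (Var 5))]" "jLft (Var 0) (cEq (Var 2) (Var 3)) (cEq (Var 4) (Var 5))"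
    "(!) [k, k, p, w, p', w']"]
  by (simp add: syntax_simps)

lemma Sub_Eq: "Sub k u p p' \<Longrightarrow> Sub k u w w' \<Longrightarrow> Sub k u (mEq p w) (mEq p' w')"
  using syntax_rule[of "[prem (jSub (Var 0) (Var 1) (Var 2) (Var 4)), prem (jSub (Var 0) (Var 1) (Var 3) (Var 5))]" "jSub (Var 0) (Var 1) (cEq (Var 2) (Var 3)) (cEq (Var 4) (Var 5))"
    "(!) [k, u, p, w, p', w']"]
  by (simp add: syntax_simps)

lemma Lft_Less: "Lft k p p' \<Longrightarrow> Lft k w w' \<Longrightarrow> Lft k (mLess p w) (mLess p' w')"
  using syntax_rule[of "[prem (jLft (Var 0) (Var 2) (Var 4)), prem (jLft (Var 0) (Var 3) (Var 5))]" "jLft (Var 0) (cLess (Var 2) (Var 3)) (cLess (Var 4) (Var 5))"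
    "(!) [k, k, p, w, p', w']"]
  by (simp add: syntax_simps)

lemma Sub_Less: "Sub k u p p' \<Longrightarrow> Sub k u w w' \<Longrightarrow> Sub k u (mLess p w) (mLess p' w')"
  using syntax_rule[of "[prem (jSub (Var 0) (Var 1) (Var 2) (Var 4)), prem (jSub (Var 0) (Var 1) (Var 3) (Var 5))]" "jSub (Var 0) (Var 1) (cLess (Var 2) (Var 3)) (cLess (Var 4) (Var 5))"
    "(!) [k, u, p, w, p', w']"]
  by (simp add: syntax_simps)

lemma Lft_Imp: "Lft k p p' \<Longrightarrow> Lft k w w' \<Longrightarrow> Lft k (mImp p w) (mImp p' w')"
  using syntax_rule[of "[prem (jLft (Var 0) (Var 2) (Var 4)), prem (jLft (Var 0) (Var 3) (Var 5))]" "jLft (Var 0) (cImp (Var 2) (Var 3)) (cImp (Var 4) (Var 5))"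
    "(!) [k, k, p, w, p', w']"]
  by (simp add: syntax_simps)

lemma Sub_Imp: "Sub k u p p' \<Longrightarrow> Sub k u w w' \<Longrightarrow> Sub k u (mImp p w) (mImp p' w')"
  using syntax_rule[of "[prem (jSub (Var 0) (Var 1) (Var 2) (Var 4)), prem (jSub (Var 0) (Var 1) (Var 3) (Var 5))]" "jSub (Var 0) (Var 1) (cImp (Var 2) (Var 3)) (cImp (Var 4) (Var 5))"
    "(!) [k, u, p, w, p', w']"]
  by (simp add: syntax_simps)

section \<open>Closure of coded provability under the Hilbert calculus\<close>

context
  fixes \<tau> assumes wfd: "defining \<tau>"
begin

lemma holds_subst_wf: "holds M e (subst 0 x \<tau>) \<longleftrightarrow> holds M (\<lambda>_. ev M e x) \<tau>"
  unfolding holds_subst using wfd by (intro holds_cong) (auto simp: defining_def)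

definition psat :: "(nat \<Rightarrow> 'a) \<Rightarrow> fm \<Rightarrow> bool" where "psat v p \<longleftrightarrow> sat_prem (proof_rules \<tau>) v p"

lemma proof_rule:
  "rule ps w \<in> set (proof_rules \<tau>) \<Longrightarrow> local6T w \<Longrightarrow> \<forall>p\<in>set ps. psat v p \<Longrightarrow> Prv \<tau> (ev M v w)"
  unfolding psat_def Prv_def by (rule dvb_rule[OF good_proof_rules[OF wfd]])

lemma psat_premise:
  "local6T t \<Longrightarrow> Prv \<tau> (ev M v t) \<Longrightarrow> psat v (prem t)" "local6 p \<Longrightarrow> holds M v p \<Longrightarrow> psat v p"
  unfolding psat_def Prv_def sat_prem_def by blast+

lemmas proof_simps = proof_rules_def Let_def psat_premise local6_subst[OF wfd] holds_subst_wf

lemma Prv_Ax: "Frm p \<Longrightarrow> holds M (\<lambda>_. p) \<tau> \<Longrightarrow> Prv \<tau> p"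
  using proof_rule[of "[FrmF (Var 0), subst 0 (Var 0) \<tau>]" "(Var 0)"
    "(!) [p, p, p, p, p, p]"]
  by (simp add: proof_simps)

lemma Prv_K: "Frm p \<Longrightarrow> Frm w \<Longrightarrow> Prv \<tau> (mImp p (mImp w p))"
  using proof_rule[of "[FrmF (Var 0), FrmF (Var 1)]" "cImp (Var 0) (cImp (Var 1) (Var 0))"
    "(!) [p, w, p, p, p, p]"]
  by (simp add: proof_simps)

lemma Prv_S: "Frm p \<Longrightarrow> Frm w \<Longrightarrow> Frm r \<Longrightarrow> Prv \<tau> (mImp (mImp p (mImp w r)) (mImp (mImp p w) (mImp p r)))"
  using proof_rule[of "[FrmF (Var 0), FrmF (Var 1), FrmF (Var 2)]" "cImp (cImp (Var 0) (cImp (Var 1) (Var 2))) (cImp (cImp (Var 0) (Var 1)) (cImp (Var 0) (Var 2)))"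
    "(!) [p, w, r, p, p, p]"]
  by (simp add: proof_simps)

lemma Prv_N: "Frm p \<Longrightarrow> Frm w \<Longrightarrow> Prv \<tau> (mImp (mImp (mNeg p) (mNeg w)) (mImp w p))"
  using proof_rule[of "[FrmF (Var 0), FrmF (Var 1)]" "cImp (cImp (cNeg (Var 0)) (cNeg (Var 1))) (cImp (Var 1) (Var 0))"
    "(!) [p, w, p, p, p, p]"]
  by (simp add: proof_simps)

lemma Prv_Inst: "Frm p \<Longrightarrow> Trm t \<Longrightarrow> Sub \<zero> t p w \<Longrightarrow> Prv \<tau> (mImp (mForall p) w)"
  using proof_rule[of "[FrmF (Var 0), TrmF (Var 4), SubF Zero (Var 4) (Var 0) (Var 1)]" "cImp (cForall (Var 0)) (Var 1)"
    "(!) [p, w, p, p, t, p]"]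
  by (simp add: proof_simps)

lemma Prv_Dist: "Frm p \<Longrightarrow> Frm w \<Longrightarrow> Prv \<tau> (mImp (mForall (mImp p w)) (mImp (mForall p) (mForall w)))"
  using proof_rule[of "[FrmF (Var 0), FrmF (Var 1)]" "cImp (cForall (cImp (Var 0) (Var 1))) (cImp (cForall (Var 0)) (cForall (Var 1)))"
    "(!) [p, w, p, p, p, p]"]
  by (simp add: proof_simps)

lemma Prv_Vac: "Frm p \<Longrightarrow> Lft \<zero> p w \<Longrightarrow> Prv \<tau> (mImp p (mForall w))"
  using proof_rule[of "[FrmF (Var 0), LftF Zero (Var 0) (Var 1)]" "cImp (Var 0) (cForall (Var 1))"
    "(!) [p, w, p, p, p, p]"]
  by (simp add: proof_simps)

lemma Prv_Refl: "Trm t \<Longrightarrow> Prv \<tau> (mEq t t)"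
  using proof_rule[of "[TrmF (Var 4)]" "cEq (Var 4) (Var 4)"
    "(!) [t, t, t, t, t, t]"]
  by (simp add: proof_simps)

lemma Prv_Leib: "Frm p \<Longrightarrow> Trm s \<Longrightarrow> Trm t \<Longrightarrow> Sub \<zero> s p w \<Longrightarrow> Sub \<zero> t p r \<Longrightarrow> Prv \<tau> (mImp (mEq s t) (mImp w r))"
  using proof_rule[of "[FrmF (Var 0), TrmF (Var 3), TrmF (Var 4), SubF Zero (Var 3) (Var 0) (Var 1), SubF Zero (Var 4) (Var 0) (Var 2)]" "cImp (cEq (Var 3) (Var 4)) (cImp (Var 1) (Var 2))"
    "(!) [p, w, r, s, t, p]"]
  by (simp add: proof_simps)

lemma Prv_MP: "Prv \<tau> (mImp p w) \<Longrightarrow> Prv \<tau> p \<Longrightarrow> Prv \<tau> w"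
  using proof_rule[of "[prem (cImp (Var 0) (Var 1)), prem (Var 0)]" "(Var 1)"
    "(!) [p, w, p, p, p, p]"]
  by (simp add: proof_simps)

lemma Prv_Gen: "Prv \<tau> p \<Longrightarrow> Prv \<tau> (mForall p)"
  using proof_rule[of "[prem (Var 0)]" "cForall (Var 0)"
    "(!) [p, p, p, p, p, p]"]
  by (simp add: proof_simps)

end

end

text \<open>The successor axioms of \<open>ISigma1\<close>, freed of their closures and instantiated
  by \<open>proves_sb\<close>, supply the two infinity premises of
  \<open>completeness\<close>.\<close>

lemma proves_complete:
  assumes T: "LA_theory T" and I: "Th ISigma1 \<subseteq> Th T"
    and valid: "\<And>(M :: nat la_str) e. models M T \<Longrightarrow> isigma1 M \<Longrightarrow> holds M e \<phi>"
  shows "T \<turnstile> \<phi>"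
proof (rule completeness[OF T])
  have ax: "T \<turnstile> \<psi>" if "univ_closure \<psi> \<in> basic_axioms" for \<psi>
  proof -
    have "univ_closure \<psi> \<in> Th ISigma1"
      using that by (simp add: Th_def sentence_univ_closure ISigma1_def proves.Ax)
    with I have "T \<turnstile> univ_closure \<psi>" by (auto simp: Th_def)
    then show ?thesis by (simp add: proves_univ_closure_iff[OF T])
  qed
  show "T \<turnstile> Neg (Eq (Succ t) Zero)" for t
    using proves_sb[OF T ax[of "Neg (Eq (Succ (Var 0)) Zero)"], of "\<lambda>_. t"]
    by (simp add: basic_axioms_def Let_def)
  show "T \<turnstile> Imp (Eq (Succ s) (Succ t)) (Eq s t)" for s t
    using proves_sb[OF T ax[of "Imp (Eq (Succ (Var 0)) (Succ (Var 1))) (Eq (Var 0) (Var 1))"], of "case_nat s (\<lambda>_. t)"]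
    by (simp add: basic_axioms_def Let_def)
  have LA: "LA_theory ISigma1"
    by (auto simp: LA_theory_def ISigma1_def basic_axioms_def induction_axiom_def sentence_univ_closure)
  show "holds M e \<phi>" if "models M T" for M :: "nat la_str" and e
    by (rule valid[OF that]) (rule isigma1.intro[OF models_Th[OF that I LA]])
qed

lemma sb_Exists_pow: "sb \<sigma> ((Exists ^^ n) \<delta>) = (Exists ^^ n) (sb ((up ^^ n) \<sigma>) \<delta>)"
  by (induction n arbitrary: \<sigma>) (simp_all add: funpow_swap1[of up])

lemma Sigma1_sb: "Sigma1 \<phi> \<Longrightarrow> Sigma1 (sb \<sigma> \<phi>)"
proof -
  assume "Sigma1 \<phi>"
  then obtain n \<delta> where "Delta0 \<delta>" "\<phi> = (Exists ^^ n) \<delta>" unfolding Sigma1_def by blast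
  then show ?thesis
    unfolding Sigma1_def by (intro exI[of _ n] exI[of _ "sb ((up ^^ n) \<sigma>) \<delta>"]) (simp add: sb_Exists_pow Delta0_sb)
qed

lemma fvT_dotT: "fvT (dotT k t) = {i. i + k \<in> fvT t}"
proof -
  have num: "fvT (num n) = {}" for n by (induction n) (simp_all add: num_def)
  show ?thesis
    by (induction t) (auto simp: cVar_def cZero_def cSucc_def cPlus_def cTimes_def pairT_def num)
qed

lemma fvT_dot: "fvT (dot k \<phi>) = {i. i + k \<in> fv \<phi>}"
proof -
  have num: "fvT (num n) = {}" for n by (induction n) (simp_all add: num_def)
  show ?thesis
    by (induction \<phi> arbitrary: k)
      (auto simp: fvT_dotT cEq_def cLess_def cNeg_def cImp_def cForall_def pairT_def num)
qed

context isigma1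
begin

section \<open>Codes of numerals\<close>

lemma Nm_zero: "Nm \<zero> mZero"
proof -
  have "rule [] (pairT Zero cZero) \<in> set num_rules" by (simp add: num_rules_def Let_def)
  from dvb_rule[OF good_num_rules this, of "\<lambda>_. \<zero>"] show ?thesis by (simp add: Nm_def)
qed

lemma Nm_suc: "Nm x u \<Longrightarrow> Nm (ss x) (mSucc u)"
proof -
  assume *: "Nm x u"
  have "rule [prem (pairT (Var 0) (Var 1))] (pairT (Succ (Var 0)) (cSucc (Var 1))) \<in> set num_rules"
    by (simp add: num_rules_def Let_def)
  from dvb_rule[OF good_num_rules this, of "(!) [x, u]"] * show ?thesis
    by (simp add: Nm_def sat_prem_prem)
qed

text \<open>Cutting a derivation at an earlier place again leaves a derivation.\<close>

lemma dvb_inversion: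
  assumes "dvb R x"
  shows "\<exists>a b n. bt a b n = x \<and> justified R a b n \<and> (\<forall>j. j \<prec> n \<longrightarrow> dvb R (bt a b j))"
proof -
  obtain a b n where *: "bt a b n = x" "\<And>i. i \<preceq> n \<Longrightarrow> justified R a b i"
    using assms unfolding dvb_def by blast
  have "dvb R (bt a b j)" if "j \<prec> n" for j
    unfolding dvb_def using *(2) that le_trans unfolding le_def by blast
  with * show ?thesis by (auto simp: le_def)
qed

lemma Nm_cases:
  assumes "Nm x u"
  shows "x = \<zero> \<and> u = mZero \<or> (\<exists>y w. x = ss y \<and> u = mSucc w \<and> Nm y w)"
proof -
  obtain a b n where n: "bt a b n = pr x u" "justified num_rules a b n"
    "\<And>j. j \<prec> n \<Longrightarrow> dvb num_rules (bt a b j)"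
    using dvb_inversion assms unfolding Nm_def by blast
  from n(2) obtain v r where "r \<in> set num_rules" and r: "holds M (renv v n \<zero> b a (\<lambda>_. \<zero>)) r"
    unfolding justified_def by blast
  then consider "r = rule [] (pairT Zero cZero)"
    | "r = rule [prem (pairT (Var 0) (Var 1))] (pairT (Succ (Var 0)) (cSucc (Var 1)))"
    by (auto simp: num_rules_def Let_def)
  then show ?thesis
  proof cases
    case 1
    with r n(1) show ?thesis by (simp add: holds_rule)
  next
    case 2
    with r n(1) obtain j where "j \<prec> n" "bt a b j = pr (v 0) (v 1)" and "x = ss (v 0)" "u = mSucc (v 1)"
      by (auto simp: holds_rule holds_prem renv_def)
    then show ?thesis using n(3)[of j] by (auto simp: Nm_def)
  qed
qed

lemma Nm_total: "\<exists>u. Nm x u"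
proof (rule DS_induction[where P = "\<lambda>x. \<exists>u. Nm x u"])
  show "DS (\<lambda>e. \<exists>u. Nm (e 0) u)" by (intro DS_ex DS_syntax DT_intros)
qed (use Nm_zero Nm_suc in blast)+

text \<open>Existence is \<Sigma>1 but uniqueness is \<Pi>1, hence the other induction
  principle.\<close>

lemma Nm_unique: "Nm x u \<Longrightarrow> Nm x w \<Longrightarrow> u = w"
proof -
  have "\<forall>u w. Nm x u \<longrightarrow> Nm x w \<longrightarrow> u = w"
  proof (rule Pi1_induction[where P = "\<lambda>x. \<forall>u w. Nm x u \<longrightarrow> Nm x w \<longrightarrow> u = w"])
    have "DS (\<lambda>e. \<exists>u w. Nm (e 0) u \<and> Nm (e 0) w \<and> u \<noteq> w)"
      by (intro DS_ex DS_conj DS_not D0_eq DS_syntax DT_intros)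
    then show "DS (\<lambda>e. \<not> (\<forall>u w. Nm (e 0) u \<longrightarrow> Nm (e 0) w \<longrightarrow> u = w))" by simp
  next
    show "\<forall>u w. Nm \<zero> u \<longrightarrow> Nm \<zero> w \<longrightarrow> u = w"
      using Nm_cases[of \<zero>] suc_neq_zero(2) by blast
    show "\<forall>u w. Nm (ss x) u \<longrightarrow> Nm (ss x) w \<longrightarrow> u = w" if "\<forall>u w. Nm x u \<longrightarrow> Nm x w \<longrightarrow> u = w" for x
      using Nm_cases[of "ss x"] that suc_neq_zero(1) suc_inject by metis
  qed
  then show "Nm x u \<Longrightarrow> Nm x w \<Longrightarrow> u = w" by blast
qed

definition numM :: "'a \<Rightarrow> 'a" where "numM x = (THE u. Nm x u)"

lemma Nm_iff: "Nm x u \<longleftrightarrow> u = numM x"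
proof -
  obtain w where "Nm x w" using Nm_total by blast
  moreover from this have "numM x = w" unfolding numM_def using Nm_unique by blast
  ultimately show ?thesis using Nm_unique by blast
qed

lemma numM_simps [simp]: "numM \<zero> = mZero" "numM (ss x) = mSucc (numM x)"
  using Nm_zero Nm_suc Nm_iff by metis+

text \<open>\<open>numM\<close> is not a term, but its graph is \<Sigma>1 and total, so it can be
  removed by an existential quantifier.\<close>

lemma DS_numM:
  assumes "DS (\<lambda>e. Q (e 0) (\<lambda>i. e (Suc i)))" "DT M t"
  shows "DS (\<lambda>e. Q (numM (t e)) e)"
proof -
  have "DS (\<lambda>e. \<exists>u. Nm (t e) u \<and> Q u e)"
    by (intro DS_ex DS_conj DS_syntax DT_Suc DT_intros assms)
  then show ?thesis by (simp add: Nm_iff)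
qed

lemma numM_induction:
  assumes "DS (\<lambda>e. P (e 0))" "P mZero" "\<And>u. P u \<Longrightarrow> P (mSucc u)"
  shows "P (numM x)"
proof (rule DS_induction[where P = "\<lambda>x. P (numM x)"])
  show "DS (\<lambda>e. P (numM (e 0)))" by (rule DS_numM[OF assms(1) DT_var])
qed (use assms in simp_all)

text \<open>Numerals of nonstandard elements count as closed terms too, by \<Sigma>1 induction
  inside the model.\<close>

lemma numM_code: "Trm (numM x)" "Lft k (numM x) (numM x)" "Sub k s (numM x) (numM x)"
  by (rule numM_induction, intro DS_syntax DT_intros, simp_all add: Trm_Zero Trm_Succ)
    (rule numM_induction[where P = "\<lambda>u. Lft k u u"], intro DS_syntax DT_intros, simp_all add: Lft_Zero Lft_Succ,
     rule numM_induction[where P = "\<lambda>u. Sub k s u u"], intro DS_syntax DT_intros, simp_all add: Sub_Zero Sub_Succ)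

section \<open>The standard model inside \<^term>\<open>M\<close>\<close>

lemma nm_add: "nm (m + n) = nm m \<oplus> nm n"
  by (induction m) simp_all

lemma ev_nm: "ev M (\<lambda>i. nm (e i)) t = nm (evalT e t)"
proof -
  have mult: "nm (m * n) = nm m \<otimes> nm n" for m n
    by (induction m) (simp_all add: nm_add pl_commute)
  show ?thesis by (induction t) (simp_all add: nm_add mult)
qed

lemma less_nm: "x \<prec> nm n \<longleftrightarrow> (\<exists>m<n. x = nm m)"
  by (induction n) (auto simp: less_suc less_Suc_eq)

lemma nm_inject [simp]: "nm m = nm n \<longleftrightarrow> m = n"
proof (induction m arbitrary: n)
  case 0 then show ?case by (cases n) simp_all
next
  case (Suc m) then show ?case by (cases n) simp_all
qed

lemma nm_less [simp]: "nm m \<prec> nm n \<longleftrightarrow> m < n"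
  by (auto simp: less_nm)

lemma case_nat_nm: "(\<lambda>i. nm (case_nat m e i)) = case_nat (nm m) (\<lambda>i. nm (e i))"
  by (rule ext) (simp split: nat.split)

text \<open>By \<open>less_nm\<close> the standard numbers form an initial segment, so bounded
  quantifiers have the same range in both structures.\<close>

lemma Delta0_absolute: "Delta0 \<phi> \<Longrightarrow> sat e \<phi> \<longleftrightarrow> holds M (\<lambda>i. nm (e i)) \<phi>"
proof (induction arbitrary: e rule: Delta0.induct)
  case (5 \<phi> t)
  have "evalT (case_nat x e) (liftT 0 t) = evalT e t" for x by (induction t) auto
  then show ?case by (auto simp: ForallB_def ev_nm less_nm 5 case_nat_nm)
next
  case (6 \<phi> t)
  have "evalT (case_nat x e) (liftT 0 t) = evalT e t" for x by (induction t) auto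
  then show ?case
    by (auto simp: ExistsB_def Exists_def Conj_def ev_nm less_nm 6 case_nat_nm)
qed (simp_all add: ev_nm)

lemma sat_Exists: "sat e (Exists \<phi>) \<longleftrightarrow> (\<exists>x. sat (case_nat x e) \<phi>)"
  by (simp add: Exists_def)

lemma Sigma1_complete: "Sigma1 \<phi> \<Longrightarrow> sat e \<phi> \<Longrightarrow> holds M (\<lambda>i. nm (e i)) \<phi>"
proof -
  have "sat e ((Exists ^^ n) \<delta>) \<Longrightarrow> holds M (\<lambda>i. nm (e i)) ((Exists ^^ n) \<delta>)" if "Delta0 \<delta>" for n \<delta>
  proof (induction n arbitrary: e)
    case 0
    then show ?case using Delta0_absolute[OF that] by simp
  next
    case (Suc n)
    from Suc.prems obtain x where "sat (case_nat x e) ((Exists ^^ n) \<delta>)"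
      by (auto simp: sat_Exists)
    from Suc.IH[OF this] show ?case by (auto simp: case_nat_nm)
  qed
  then show "Sigma1 \<phi> \<Longrightarrow> sat e \<phi> \<Longrightarrow> holds M (\<lambda>i. nm (e i)) \<phi>" unfolding Sigma1_def by blast
qed

text \<open>If all free variables lie below the offset, none of them is dotted, and the term
  evaluates to the ordinary Goedel number whatever the environment.\<close>

lemma gn_value: "fv \<phi> \<subseteq> {..<k} \<Longrightarrow> ev M u (dot k \<phi>) = nm (gn \<phi>)"
proof -
  have T: "fvT t \<subseteq> {..<k} \<Longrightarrow> ev M u (dotT k t) = nm (gnT t)" for t k
    by (induction t) (simp_all add: mVar_def mZero_def mSucc_def mPlus_def mTimes_def nm_pair del: nm_simps(2))
  show "fv \<phi> \<subseteq> {..<k} \<Longrightarrow> ev M u (dot k \<phi>) = nm (gn \<phi>)"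
  proof (induction \<phi> arbitrary: k)
    case (Forall \<phi>)
    have "fv \<phi> \<subseteq> {..<Suc k}"
    proof
      fix i assume "i \<in> fv \<phi>"
      with Forall.prems show "i \<in> {..<Suc k}" by (cases i) auto
    qed
    from Forall.IH[OF this] show ?case by (simp add: mForall_def nm_pair del: nm_simps)
  qed (simp_all add: T mEq_def mLess_def mNeg_def mImp_def nm_pair del: nm_simps)
qed

section \<open>Internal provability of theorems\<close>

definition nd :: "(nat \<Rightarrow> 'a) \<Rightarrow> nat \<Rightarrow> 'a" where "nd e i = numM (e i)"

lemma Trm_dotT: "Trm (ev M (nd e) (dotT k t))"
  by (induction t) (auto simp: nd_def numM_code Trm_Var Trm_Zero Trm_Succ Trm_Plus Trm_Times)

lemma Frm_dot: "Frm (ev M (nd e) (dot k \<phi>))"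
  by (induction \<phi> arbitrary: k)
    (auto simp: Trm_dotT Frm_Eq Frm_Less Frm_Neg Frm_Imp Frm_Forall)

text \<open>Variables below \<open>k\<close> are coded as variables and get shifted; those from
  \<open>k\<close> on stand for codes of numerals, which a lift leaves alone by
  \<open>numM_code\<close>.\<close>

lemma Lft_dotT:
  assumes "j \<le> k"
  shows "Lft (nm j) (ev M (nd e) (dotT k t)) (ev M (nd e) (dotT (Suc k) (liftT j t)))"
proof (induction t)
  case (Var i)
  consider "i < j" | "j \<le> i" "i < k" | "k \<le> i" using assms by linarith
  then show ?case
  proof cases
    case 2
    then have "nm j \<prec> nm (Suc i)" by (simp del: nm_simps)
    with 2 show ?thesis using Lft_Var_ge[of "nm j" "nm i"] by simp
  qed (use assms in \<open>simp_all add: Lft_Var_less nd_def numM_code\<close>)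
qed (simp_all add: Lft_Zero Lft_Succ Lft_Plus Lft_Times)

lemma Lft_dot: "j \<le> k \<Longrightarrow> Lft (nm j) (ev M (nd e) (dot k \<phi>)) (ev M (nd e) (dot (Suc k) (lift j \<phi>)))"
proof (induction \<phi> arbitrary: j k)
  case (Forall \<phi>)
  from Forall.IH[of "Suc j" "Suc k"] Forall.prems show ?case by (simp add: Lft_Forall)
qed (simp_all add: Lft_dotT Lft_Eq Lft_Less Lft_Neg Lft_Imp)

lemma Sub_dotT:
  assumes "j \<le> k"
  shows "Sub (nm j) (ev M (nd e) (dotT k s)) (ev M (nd e) (dotT (Suc k) t))
    (ev M (nd e) (dotT k (substT j s t)))"
proof (induction t)
  case (Var i)
  consider "i < j" | "i = j" | "j < i" "i \<le> k" | "k < i" using assms by linarith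
  then show ?case
  proof cases
    case 3
    then obtain i' where "i = Suc i'" by (cases i) auto
    with 3 show ?thesis using Sub_Var_ge[of "nm j" "nm i'"] by (simp flip: nm_simps)
  next
    case 4
    then obtain i' where "i = Suc i'" by (cases i) auto
    with 4 assms show ?thesis by (simp add: nd_def numM_code)
  qed (use assms in \<open>simp_all add: Sub_Var_less Sub_Var_eq\<close>)
qed (simp_all add: Sub_Zero Sub_Succ Sub_Plus Sub_Times)

lemma Sub_dot: "j \<le> k \<Longrightarrow> Sub (nm j) (ev M (nd e) (dotT k s)) (ev M (nd e) (dot (Suc k) \<phi>))
    (ev M (nd e) (dot k (subst j s \<phi>)))"
proof (induction \<phi> arbitrary: j k s)
  case (Forall \<phi>)
  have "Lft \<zero> (ev M (nd e) (dotT k s)) (ev M (nd e) (dotT (Suc k) (liftT 0 s)))"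
    using Lft_dotT[of 0 k e s] by simp
  from Sub_Forall[OF this] Forall.IH[of "Suc j" "Suc k" "liftT 0 s"] Forall.prems show ?case by simp
qed (simp_all add: Sub_dotT Sub_Eq Sub_Less Sub_Neg Sub_Imp)

text \<open>The offset \<open>k\<close> keeps the first variables as variables; without it the generalization rule
  could not be treated.\<close>

theorem necessitation:
  assumes T: "LA_theory T" and \<tau>: "Sigma1 \<tau>" "is_definition \<tau> T"
  shows "T \<turnstile> \<psi> \<Longrightarrow> Prv \<tau> (ev M (nd e) (dot k \<psi>))"
proof (induction arbitrary: k rule: proves.induct)
  have wfd: "defining \<tau>" using \<tau> gS_Sigma1 by (simp add: defining_def is_definition_def)
  {
    case (Ax \<phi>)
    have "fv \<phi> = {}" using T Ax by (simp add: LA_theory_def sentence_def)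
    then have gn: "ev M (nd e) (dot k \<phi>) = nm (gn \<phi>)" using gn_value by simp
    \<comment> \<open>That \<open>\<tau>\<close> holds of the number of an axiom is a true \<Sigma>1
      sentence, so it persists to every model of \<open>ISigma1\<close>.\<close>
    have "true_in_N (subst 0 (num (gn \<phi>)) \<tau>)" using Ax \<tau> by (simp add: is_definition_def)
    moreover have "Sigma1 (subst 0 (num (gn \<phi>)) \<tau>)"
      unfolding subst_sb using \<tau>(1) by (rule Sigma1_sb)
    ultimately have "holds M (\<lambda>_. nm 0) (subst 0 (num (gn \<phi>)) \<tau>)"
      using Sigma1_complete[of _ "\<lambda>_. 0"] by (simp add: true_in_N_def)
    then have "holds M (\<lambda>_. nm (gn \<phi>)) \<tau>" using holds_subst_wf[OF wfd] by simp
    then show ?case using Prv_Ax[OF wfd] Frm_dot gn by metis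
  next
    case (K \<phi> \<psi>) show ?case by (simp add: Prv_K[OF wfd] Frm_dot)
  next
    case (S \<phi> \<psi> \<chi>) show ?case by (simp add: Prv_S[OF wfd] Frm_dot)
  next
    case (N \<phi> \<psi>) show ?case by (simp add: Prv_N[OF wfd] Frm_dot)
  next
    case (Inst \<phi> t) 
    show ?case using Prv_Inst[OF wfd Frm_dot Trm_dotT Sub_dot[of 0 k, unfolded nm_simps]] by simp
  next
    case (Dist \<phi> \<psi>) show ?case by (simp add: Prv_Dist[OF wfd] Frm_dot)
  next
    case (Vac \<phi>) 
    show ?case using Prv_Vac[OF wfd Frm_dot Lft_dot[of 0 k, unfolded nm_simps]] by simp
  next
    case (Refl t) show ?case by (simp add: Prv_Refl[OF wfd] Trm_dotT)
  next
    case (Leib s t \<phi>)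
    show ?case
      using Prv_Leib[OF wfd Frm_dot Trm_dotT Trm_dotT Sub_dot[of 0 k, unfolded nm_simps]
          Sub_dot[of 0 k, unfolded nm_simps]] by simp
  next
    case (MP \<phi> \<psi>)
    from MP.IH(1)[of k] have "Prv \<tau> (mImp (ev M (nd e) (dot k \<phi>)) (ev M (nd e) (dot k \<psi>)))" by simp
    then show ?case by (rule Prv_MP[OF wfd]) (rule MP.IH)
  next
    case (Gen \<phi>)
    then have "Prv \<tau> (ev M (nd e) (dot (Suc k) \<phi>))" by blast
    then show ?case using Prv_Gen[OF wfd] by simp
  }
qed

definition Bx :: "fm \<Rightarrow> fm \<Rightarrow> (nat \<Rightarrow> 'a) \<Rightarrow> bool" where
  "Bx \<tau> \<phi> e \<longleftrightarrow> Prv \<tau> (ev M (nd e) (dot 0 \<phi>))"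

lemma holds_Pr_dot [simp]:
  assumes "defining \<tau>"
  shows "holds M e (Pr_dot \<tau> \<phi>) \<longleftrightarrow> Bx \<tau> \<phi> e"
proof -
  let ?m = "fv_bound \<phi>"
  have fv: "i \<in> fv \<phi> \<Longrightarrow> i < ?m" for i using fv_bound by blast
  have "holds M e (Pr_dot \<tau> \<phi>) \<longleftrightarrow> (\<exists>v. (\<forall>i\<in>fv \<phi>. v i = numM (e i)) \<and>
      Prv \<tau> (ev M (\<lambda>k. if k < ?m then v k else e (k - ?m)) (dot 0 \<phi>)))"
    unfolding Pr_dot_def Let_def holds_Exists_pow holds_foldr_Conj
    by (simp add: assms Nm_iff fv cong: conj_cong)
  also have "\<dots> \<longleftrightarrow> (\<exists>v. (\<forall>i\<in>fv \<phi>. v i = numM (e i)) \<and> Bx \<tau> \<phi> e)"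
  proof (intro ex_cong1 conj_cong refl)
    fix v assume v: "\<forall>i\<in>fv \<phi>. v i = numM (e i)"
    have "ev M (\<lambda>k. if k < ?m then v k else e (k - ?m)) (dot 0 \<phi>) = ev M (nd e) (dot 0 \<phi>)"
      by (rule ev_cong) (use v fv in \<open>auto simp: fvT_dot nd_def\<close>)
    then show "Prv \<tau> (ev M (\<lambda>k. if k < ?m then v k else e (k - ?m)) (dot 0 \<phi>)) \<longleftrightarrow> Bx \<tau> \<phi> e"
      by (simp add: Bx_def)
  qed
  also have "\<dots> \<longleftrightarrow> Bx \<tau> \<phi> e" by auto
  finally show ?thesis .
qed

lemma Bx_nec: "LA_theory T \<Longrightarrow> Sigma1 \<tau> \<Longrightarrow> is_definition \<tau> T \<Longrightarrow> T \<turnstile> \<psi> \<Longrightarrow> Bx \<tau> \<psi> e"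
  unfolding Bx_def by (rule necessitation)

lemma Bx_MP: "defining \<tau> \<Longrightarrow> Bx \<tau> (Imp \<phi> \<psi>) e \<Longrightarrow> Bx \<tau> \<phi> e \<Longrightarrow> Bx \<tau> \<psi> e"
  unfolding Bx_def by (auto intro: Prv_MP)

lemma dotT_liftT: "fvT t \<inter> {..<k} = {} \<Longrightarrow> ev M u (dotT (Suc k) (liftT 0 t)) = ev M u (dotT k t)"
  by (induction t) (auto simp: Int_Un_distrib2)

lemma dot_sb:
  assumes "\<And>i. i < k \<Longrightarrow> \<sigma> i = Var i" "\<And>i. k \<le> i \<Longrightarrow> ev M u (dotT k (\<sigma> i)) = u' (i - k)"
    "\<And>i. k \<le> i \<Longrightarrow> fvT (\<sigma> i) \<inter> {..<k} = {}"
  shows "ev M u (dot k (sb \<sigma> \<phi>)) = ev M u' (dot k \<phi>)"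
proof -
  have T: "ev M u (dotT k (sbT \<sigma> t)) = ev M u' (dotT k t)"
    if "\<And>i. i < k \<Longrightarrow> \<sigma> i = Var i" "\<And>i. k \<le> i \<Longrightarrow> ev M u (dotT k (\<sigma> i)) = u' (i - k)" for k \<sigma> t
  proof (induction t)
    case (Var i)
    then show ?case by (cases "i < k") (simp_all add: that)
  qed auto
  show ?thesis using assms
  proof (induction \<phi> arbitrary: k \<sigma>)
    case (Eq s t) then show ?case using T[of k \<sigma>] by simp
  next
    case (Less s t) then show ?case using T[of k \<sigma>] by simp
  next
    case (Neg \<phi>) then show ?case by simp
  next
    case (Imp \<phi> \<psi>)
    then show ?case by simp
  next
    case (Forall \<phi>)
    have "ev M u (dot (Suc k) (sb (up \<sigma>) \<phi>)) = ev M u' (dot (Suc k) \<phi>)"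
    proof (rule Forall.IH)
      show "up \<sigma> i = Var i" if "i < Suc k" for i
        using that Forall.prems(1) by (cases i) auto
      show "ev M u (dotT (Suc k) (up \<sigma> i)) = u' (i - Suc k)" if "Suc k \<le> i" for i
        using that Forall.prems(2,3)[of "i - 1"] by (cases i) (auto simp: dotT_liftT)
      show "fvT (up \<sigma> i) \<inter> {..<Suc k} = {}" if "Suc k \<le> i" for i
        using that Forall.prems(3)[of "i - 1"] by (cases i) (auto simp: fvT_liftT)
    qed
    then show ?case by simp
  qed
qed

text \<open>Only substitutions of terms built from variables by \<open>0\<close> and \<open>S\<close> commute with dotting
  literally.\<close>

lemma Bx_sb:
  assumes "\<And>i. ev M (nd e) (dotT 0 (\<sigma> i)) = numM (e' i)"
  shows "Bx \<tau> (sb \<sigma> \<phi>) e \<longleftrightarrow> Bx \<tau> \<phi> e'"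
proof -
  have "ev M (nd e) (dot 0 (sb \<sigma> \<phi>)) = ev M (nd e') (dot 0 \<phi>)"
    by (rule dot_sb) (use assms in \<open>auto simp: nd_def\<close>)
  then show ?thesis by (simp add: Bx_def)
qed

lemma Bx_ren: "Bx \<tau> (ren \<rho> \<phi>) e \<longleftrightarrow> Bx \<tau> \<phi> (\<lambda>i. e (\<rho> i))"
  unfolding ren_sb by (rule Bx_sb) (simp add: nd_def)

lemma Bx_cong: "(\<And>i. i \<in> fv \<phi> \<Longrightarrow> e i = e' i) \<Longrightarrow> Bx \<tau> \<phi> e \<longleftrightarrow> Bx \<tau> \<phi> e'"
  unfolding Bx_def using ev_cong[of "dot 0 \<phi>" "nd e" "nd e'" M] by (simp add: fvT_dot nd_def)

end

section \<open>Modal formulas over a structure\<close>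

text \<open>The box is an oracle for whole formulas, since provability of an interpreted formula is
  not determined by its truth in the structure.\<close>

primrec msat :: "(nat \<Rightarrow> 'a list \<Rightarrow> bool) \<Rightarrow> ((nat \<Rightarrow> 'a) \<Rightarrow> mfm \<Rightarrow> bool) \<Rightarrow> (nat \<Rightarrow> 'a) \<Rightarrow> mfm \<Rightarrow> bool" where
  "msat R B h MFalsum \<longleftrightarrow> False"
| "msat R B h (MAtom P xs) \<longleftrightarrow> R P (map h xs)"
| "msat R B h (MNeg A) \<longleftrightarrow> \<not> msat R B h A"
| "msat R B h (MImp A A') \<longleftrightarrow> (msat R B h A \<longrightarrow> msat R B h A')"
| "msat R B h (MForall A) \<longleftrightarrow> (\<forall>x. msat R B (case_nat x h) A)"
| "msat R B h (MBox A) \<longleftrightarrow> B h A"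

definition mclosure :: "mfm \<Rightarrow> mfm" where
  "mclosure A = (MForall ^^ Suc (Max (insert 0 (mfv A)))) A"

lemma finite_mfv [simp]: "finite (mfv A)"
proof (induction A)
  case (MForall A)
  have "{i. Suc i \<in> mfv A} = Suc -` mfv A" by auto
  with MForall show ?case by (simp add: finite_vimageI)
qed auto

lemma mfv_mclosure: "mfv (mclosure A) = {}"
proof -
  have *: "mfv ((MForall ^^ n) A) = {i. i + n \<in> mfv A}" for n by (induction n) auto
  have "i + Suc (Max (insert 0 (mfv A))) \<notin> mfv A" for i
  proof
    assume "i + Suc (Max (insert 0 (mfv A))) \<in> mfv A"
    then have "i + Suc (Max (insert 0 (mfv A))) \<le> Max (insert 0 (mfv A))" by (intro Max_ge) auto
    then show False by simp
  qed
  then show ?thesis unfolding mclosure_def * by simp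
qed

lemma mclosure_QPL:
  assumes "LA_theory T"
  shows "mclosure A \<in> QPL \<tau> T \<longleftrightarrow> (\<forall>f. arith_interp f \<longrightarrow> T \<turnstile> interp f \<tau> A)"
proof -
  have "T \<turnstile> interp f \<tau> ((MForall ^^ n) A) \<longleftrightarrow> T \<turnstile> interp f \<tau> A" for f n
    by (induction n) (simp_all add: proves_Forall_iff[OF assms])
  then show ?thesis by (simp add: QPL_def mfv_mclosure) (simp add: mclosure_def del: funpow.simps)
qed

text \<open>The relational translation: \<open>trT t \<rho> r\<close> says that \<open>r\<close> is the value of \<open>t\<close>. The predicate
  symbols \<open>0, \<dots>, 5\<close> stand for zero, successor, sum, product, order, and equality.\<close>

primrec trT :: "tm \<Rightarrow> (nat \<Rightarrow> nat) \<Rightarrow> nat \<Rightarrow> mfm" where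
  "trT (Var i) \<rho> r = MAtom 5 [\<rho> i, r]"
| "trT Zero \<rho> r = MAtom 0 [r]"
| "trT (Succ t) \<rho> r = MExists (MConj (trT t (\<lambda>i. Suc (\<rho> i)) 0) (MAtom 1 [0, Suc r]))"
| "trT (Plus s t) \<rho> r = MExists (MExists (MConj (trT s (\<lambda>i. Suc (Suc (\<rho> i))) (Suc 0))
    (MConj (trT t (\<lambda>i. Suc (Suc (\<rho> i))) 0) (MAtom 2 [Suc 0, 0, Suc (Suc r)]))))"
| "trT (Times s t) \<rho> r = MExists (MExists (MConj (trT s (\<lambda>i. Suc (Suc (\<rho> i))) (Suc 0))
    (MConj (trT t (\<lambda>i. Suc (Suc (\<rho> i))) 0) (MAtom 3 [Suc 0, 0, Suc (Suc r)]))))"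

primrec tr :: "fm \<Rightarrow> mfm" where
  "tr (Eq s t) = MExists (MConj (trT s Suc 0) (trT t Suc 0))"
| "tr (Less s t) = MExists (MExists (MConj (trT s (\<lambda>i. Suc (Suc i)) (Suc 0))
    (MConj (trT t (\<lambda>i. Suc (Suc i)) 0) (MAtom 4 [Suc 0, 0]))))"
| "tr (Neg \<phi>) = MNeg (tr \<phi>)"
| "tr (Imp \<phi> \<psi>) = MImp (tr \<phi>) (tr \<psi>)"
| "tr (Forall \<phi>) = MForall (tr \<phi>)"

text \<open>Equality is merely a congruence, because its symbol may be interpreted by any formula.
  Existence is demanded only of zero and successor; \<open>emb_plus\<close> and
  \<open>emb_times\<close> produce sums and products on the image by induction.\<close>

locale rel_arith =
  fixes Zr :: "'a \<Rightarrow> bool" and Sr :: "'a \<Rightarrow> 'a \<Rightarrow> bool" and Ar Mr :: "'a \<Rightarrow> 'a \<Rightarrow> 'a \<Rightarrow> bool"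
    and Lr Er :: "'a \<Rightarrow> 'a \<Rightarrow> bool" and Qr :: "'a \<Rightarrow> 'a \<Rightarrow> 'a \<Rightarrow> bool"
  assumes E_refl: "\<And>x. Er x x"
    and E_sym: "\<And>x y. Er x y \<Longrightarrow> Er y x"
    and E_trans: "\<And>x y z. Er x y \<Longrightarrow> Er y z \<Longrightarrow> Er x z"
    and Z_cong: "\<And>x y. Zr x \<Longrightarrow> Er x y \<Longrightarrow> Zr y"
    and Z_unique: "\<And>x y. Zr x \<Longrightarrow> Zr y \<Longrightarrow> Er x y"
    and Z_ex: "\<exists>x. Zr x"
    and S_cong: "\<And>x y x' y'. Sr x y \<Longrightarrow> Er x x' \<Longrightarrow> Er y y' \<Longrightarrow> Sr x' y'"
    and S_fun: "\<And>x y y'. Sr x y \<Longrightarrow> Sr x y' \<Longrightarrow> Er y y'"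
    and S_ex: "\<And>x. \<exists>y. Sr x y"
    and S_inj: "\<And>x y x'. Sr x y \<Longrightarrow> Sr x' y \<Longrightarrow> Er x x'"
    and S_not_Z: "\<And>x y. Sr x y \<Longrightarrow> \<not> Zr y"
    and A_cong: "\<And>x y z x' y' z'. Ar x y z \<Longrightarrow> Er x x' \<Longrightarrow> Er y y' \<Longrightarrow> Er z z' \<Longrightarrow> Ar x' y' z'"
    and A_fun: "\<And>x y z z'. Ar x y z \<Longrightarrow> Ar x y z' \<Longrightarrow> Er z z'"
    and A_Z: "\<And>x y. Zr y \<Longrightarrow> Ar x y x"
    and A_S: "\<And>x y z y' z'. Ar x y z \<Longrightarrow> Sr y y' \<Longrightarrow> Sr z z' \<Longrightarrow> Ar x y' z'"
    and M_cong: "\<And>x y z x' y' z'. Mr x y z \<Longrightarrow> Er x x' \<Longrightarrow> Er y y' \<Longrightarrow> Er z z' \<Longrightarrow> Mr x' y' z'"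
    and M_fun: "\<And>x y z z'. Mr x y z \<Longrightarrow> Mr x y z' \<Longrightarrow> Er z z'"
    and M_Z: "\<And>x y z. Zr y \<Longrightarrow> Zr z \<Longrightarrow> Mr x y z"
    and M_S: "\<And>x y z y' w. Mr x y z \<Longrightarrow> Sr y y' \<Longrightarrow> Ar z x w \<Longrightarrow> Mr x y' w"
    and L_cong: "\<And>x y x' y'. Lr x y \<Longrightarrow> Er x x' \<Longrightarrow> Er y y' \<Longrightarrow> Lr x' y'"
    and L_Z: "\<And>x y. Zr y \<Longrightarrow> \<not> Lr x y"
    and L_S: "\<And>x y y'. Sr y y' \<Longrightarrow> (Lr x y' \<longrightarrow> Lr x y \<or> Er x y) \<and> (Lr x y \<or> Er x y \<longrightarrow> Lr x y')"
    and Z_least: "\<And>x y. Zr x \<Longrightarrow> Lr x y \<or> Er x y"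
    and S_least: "\<And>x y x'. Lr x y \<Longrightarrow> Sr x x' \<Longrightarrow> Lr x' y \<or> Er x' y"
    and Q_cong: "\<And>x y z x'. Qr x y z \<Longrightarrow> Er x x' \<Longrightarrow> Qr x' y z"

definition MConjs :: "mfm list \<Rightarrow> mfm" where "MConjs As = foldr MConj As (MNeg MFalsum)"

lemma msat_MConjs [simp]: "msat R B h (MConjs As) \<longleftrightarrow> (\<forall>A\<in>set As. msat R B h A)"
  by (induction As) (auto simp: MConjs_def)

text \<open>Each open clause is closed by the same six quantifiers, so that the six names can be
  fixed indices, \<open>x\<close> being the outermost variable.\<close>

definition base :: mfm where
  "base = (let x = 5; y = 4; z = 3; x' = 2; y' = 1; z' = 0; all = map (MForall ^^ 6);
      Z = (\<lambda>x. MAtom 0 [x]); S = (\<lambda>x y. MAtom 1 [x, y]); A = (\<lambda>x y z. MAtom 2 [x, y, z]);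
      M = (\<lambda>x y z. MAtom 3 [x, y, z]); L = (\<lambda>x y. MAtom 4 [x, y]); E = (\<lambda>x y. MAtom 5 [x, y]);
      Q = (\<lambda>x y z. MAtom 6 [x, y, z])
    in MConjs ([MExists (Z 0), MForall (MExists (S 1 0))] @ all
    [E x x, MImp (E x y) (E y x), MImp (E x y) (MImp (E y z) (E x z)),
     MImp (Z x) (MImp (E x y) (Z y)), MImp (Z x) (MImp (Z y) (E x y)),
     MImp (S x y) (MImp (E x x') (MImp (E y y') (S x' y'))),
     MImp (S x y) (MImp (S x y') (E y y')), 
     MImp (S x y) (MImp (S x' y) (E x x')), MImp (S x y) (MNeg (Z y)),
     MImp (A x y z) (MImp (E x x') (MImp (E y y') (MImp (E z z') (A x' y' z')))),
     MImp (A x y z) (MImp (A x y z') (E z z')), MImp (Z y) (A x y x),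
     MImp (A x y z) (MImp (S y y') (MImp (S z z') (A x y' z'))),
     MImp (M x y z) (MImp (E x x') (MImp (E y y') (MImp (E z z') (M x' y' z')))),
     MImp (M x y z) (MImp (M x y z') (E z z')), MImp (Z y) (MImp (Z z) (M x y z)),
     MImp (M x y z) (MImp (S y y') (MImp (A z x z') (M x y' z'))),
     MImp (L x y) (MImp (E x x') (MImp (E y y') (L x' y'))),
     MImp (Z y) (MNeg (L x y)),
     MImp (S y y') (MConj (MImp (L x y') (MDisj (L x y) (E x y))) (MImp (MDisj (L x y) (E x y)) (L x y'))),
     MImp (Z x) (MDisj (L x y) (E x y)),
     MImp (L x y) (MImp (S x x') (MDisj (L x' y) (E x' y))),
     MImp (Q x y z) (MImp (E x x') (Q x' y z))]))"

abbreviation rel_arith_of :: "(nat \<Rightarrow> 'a list \<Rightarrow> bool) \<Rightarrow> bool" where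
  "rel_arith_of R \<equiv> rel_arith (\<lambda>x. R 0 [x]) (\<lambda>x y. R 1 [x, y]) (\<lambda>x y z. R 2 [x, y, z])
    (\<lambda>x y z. R 3 [x, y, z]) (\<lambda>x y. R 4 [x, y]) (\<lambda>x y. R 5 [x, y]) (\<lambda>x y z. R 6 [x, y, z])"

lemma msat_base: "msat R B h base \<longleftrightarrow> rel_arith_of R"
  unfolding base_def Let_def rel_arith_def
  apply (simp only: msat.simps msat_MConjs list.set set_append list.map append.simps ball_simps ball_Un insert_iff Un_iff
    nat.case eval_nat_numeral BitM.simps One_nat_def funpow.simps comp_apply id_apply not_not de_Morgan_conj simp_thms
    not_imp not_all not_ex disj_imp)
  by (rule iffI; elim conjE; intro conjI; assumption)

lemma fv_interp_MAtom: "arith_interp f \<Longrightarrow> fv (interp f \<tau> (MAtom P xs)) = set xs"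
  by (auto simp: arith_interp_def fv_ren in_set_conv_nth)

text \<open>Being closed, the boxed axioms may be moved to any environment; \<open>Bx_derive\<close>
  depends on this.\<close>

lemma fv_interp_base: "arith_interp f \<Longrightarrow> fv (interp f \<tau> base) = {}"
  by (simp add: base_def Let_def MConjs_def eval_nat_numeral fv_interp_MAtom Falsum_def num_def
      del: interp.simps(2))

context isigma1
begin

definition Rel :: "(nat \<Rightarrow> nat \<Rightarrow> fm) \<Rightarrow> nat \<Rightarrow> 'a list \<Rightarrow> bool" where
  "Rel f P vs \<longleftrightarrow> holds M ((!) vs) (f P (length vs))"

lemma holds_interp:
  assumes "arith_interp f" "defining \<tau>"
  shows "holds M h (interp f \<tau> A) \<longleftrightarrow> msat (Rel f) (\<lambda>h A. Bx \<tau> (interp f \<tau> A) h) h A"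
proof (induction A arbitrary: h)
  case (MAtom P xs)
  have "holds M (\<lambda>i. h (xs ! i)) (f P (length xs)) \<longleftrightarrow> holds M ((!) (map h xs)) (f P (length xs))"
    by (rule holds_cong) (use assms(1) in \<open>auto simp: arith_interp_def\<close>)
  then show ?case by (simp add: Rel_def holds_ren)
qed (simp_all add: assms)

end

section \<open>The reflection formula\<close>

text \<open>Self-application in Tarski's form: the numeral enters through an equation and is not
  substituted. The code is thus a polynomial in \<open>u\<close> and \<open>x\<close>, and no
  substitution function has to be represented.\<close>

definition diag_code :: "tm \<Rightarrow> tm \<Rightarrow> tm" where
  "diag_code u x = cForall (cImp (cEq (cVar Zero) u) x)"

text \<open>\<open>DPr \<tau>\<close> says of (the code of) a formula \<open>\<psi>(v)\<close> that the sentence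
  \<open>\<forall>v. v = \<ulcorner>\<psi>\<urcorner> \<longrightarrow> \<psi>(v)\<close> is provable, and \<open>DRef \<tau>\<close> that it is refutable.\<close>

definition DPr :: "fm \<Rightarrow> fm" where
  "DPr \<tau> = ren (\<lambda>_. 0) (Exists (Conj (NumF (Var 1) (Var 0)) (Pr \<tau> (diag_code (Var 0) (Var 1)))))"
definition DRef :: "fm \<Rightarrow> fm" where
  "DRef \<tau> = ren (\<lambda>_. 0) (Exists (Conj (NumF (Var 1) (Var 0))
    (Conj (FrmF (Var 1)) (Pr \<tau> (cNeg (diag_code (Var 0) (Var 1)))))))"

lemma gS_DPr: "gS \<tau> \<Longrightarrow> gS (DPr \<tau>)"
  unfolding DPr_def ren_sb by (intro gS_sb gS_Exists gS_Conj gS_syntax gS_Pr)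

lemma gS_DRef: "gS \<tau> \<Longrightarrow> gS (DRef \<tau>)"
  unfolding DRef_def ren_sb by (intro gS_sb gS_Exists gS_Conj gS_syntax gS_Pr)

text \<open>\<open>Q\<close> is rigid in both directions because the theory has to decide it. For
  zero and successor the positive direction suffices to carry the embedding into the box.\<close>

definition rigid :: mfm where
  "rigid = MConjs [MForall (MImp (MAtom 0 [0]) (MBox (MAtom 0 [0]))),
     MForall (MForall (MImp (MAtom 1 [1, 0]) (MBox (MAtom 1 [1, 0])))),
     MForall (MForall (MForall (MImp (MAtom 6 [2, 1, 0]) (MBox (MAtom 6 [2, 1, 0]))))),
     MForall (MForall (MForall (MImp (MNeg (MAtom 6 [2, 1, 0])) (MBox (MNeg (MAtom 6 [2, 1, 0]))))))]"

text \<open>Innermost, 3 is the bound, 2 and 1 are the codes of a section of \<open>Q\<close>, and 0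
  is the tested element. A bound is imposed since \<open>set_coding\<close> provides sections only
  for initial segments.\<close>

definition separation :: "fm \<Rightarrow> mfm" where
  "separation \<tau> = MForall (MExists (MExists (MForall (MImp (MAtom 4 [0, 3])
     (MConj (MImp (tr (DPr \<tau>)) (MAtom 6 [0, 2, 1])) (MImp (tr (DRef \<tau>)) (MNeg (MAtom 6 [0, 2, 1]))))))))"

definition reflection :: "fm \<Rightarrow> fm \<Rightarrow> mfm" where
  "reflection \<tau> \<phi> = MImp (MConjs [base, MBox base, rigid, separation \<tau>, MBox (tr \<phi>)])
     (tr (Pr_dot \<tau> \<phi>))"

text \<open>A filler for the other symbols: \<open>arith_interp\<close> demands that exactly the
  variables below the arity occur.\<close>

definition all_vars :: "nat \<Rightarrow> fm" where
  "all_vars n = foldr Conj (map (\<lambda>i. Eq (Var i) (Var i)) [0..<n]) (Eq Zero Zero)"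

text \<open>Predicate \<open>6\<close> is interpreted by divisibility of \<open>a\<close> by the modulus \<open>1 + (x + 1) b\<close>.\<close>

definition std :: "nat \<Rightarrow> nat \<Rightarrow> fm" where
  "std P n = (if P = 0 \<and> n = 1 then Eq (Var 0) Zero
    else if P = 1 \<and> n = 2 then Eq (Succ (Var 0)) (Var 1)
    else if P = 2 \<and> n = 3 then Eq (Plus (Var 0) (Var 1)) (Var 2)
    else if P = 3 \<and> n = 3 then Eq (Times (Var 0) (Var 1)) (Var 2)
    else if P = 4 \<and> n = 2 then Less (Var 0) (Var 1)
    else if P = 5 \<and> n = 2 then Eq (Var 0) (Var 1)
    else if P = 6 \<and> n = 3 then
      Exists (Eq (Var 2) (Times (Succ (Times (Succ (Var 1)) (Var 3))) (Var 0)))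
    else all_vars n)"

lemma arith_interp_std: "arith_interp std"
proof -
  have foldr: "fv (foldr Conj \<phi>s \<psi>) = (\<Union>\<phi>\<in>set \<phi>s. fv \<phi>) \<union> fv \<psi>" for \<phi>s \<psi>
    by (induction \<phi>s) (auto simp: Conj_def)
  have "fv (all_vars n) = {..<n}" for n by (auto simp: all_vars_def foldr)
  then show ?thesis by (auto simp: arith_interp_def std_def Exists_def)
qed

context isigma1
begin

definition mDiag :: "'a \<Rightarrow> 'a" where
  "mDiag x = mForall (mImp (mEq (mVar \<zero>) (numM x)) x)"

lemma holds_DPr [simp]: "defining \<tau> \<Longrightarrow> holds M e (DPr \<tau>) \<longleftrightarrow> Prv \<tau> (mDiag (e 0))"
  by (simp add: DPr_def diag_code_def mDiag_def Nm_iff holds_ren)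

lemma holds_DRef [simp]: "defining \<tau> \<Longrightarrow> holds M e (DRef \<tau>) \<longleftrightarrow> Frm (e 0) \<and> Prv \<tau> (mNeg (mDiag (e 0)))"
  by (auto simp: DRef_def diag_code_def mDiag_def Nm_iff holds_ren)

lemma Rel_std [simp]:
  "Rel std 0 [x] \<longleftrightarrow> x = \<zero>" "Rel std (Suc 0) [x, y] \<longleftrightarrow> ss x = y" "Rel std 2 [x, y, z] \<longleftrightarrow> x \<oplus> y = z"
  "Rel std 3 [x, y, z] \<longleftrightarrow> x \<otimes> y = z" "Rel std 4 [x, y] \<longleftrightarrow> x \<prec> y" "Rel std 5 [x, y] \<longleftrightarrow> x = y"
  "Rel std 6 [x, y, z] \<longleftrightarrow> dv (q z x) y"
  by (simp_all add: Rel_def std_def q_def dv_def numeral_3_eq_3 numeral_2_eq_2 del: suc_mu mu_suc)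

lemma msat_trT_std: "msat (Rel std) B h (trT t \<rho> r) \<longleftrightarrow> h r = ev M (\<lambda>i. h (\<rho> i)) t"
  by (induction t arbitrary: h \<rho> r) auto

lemma msat_tr_std: "msat (Rel std) B h (tr \<phi>) \<longleftrightarrow> holds M h \<phi>"
  by (induction \<phi> arbitrary: h) (auto simp: msat_trT_std)

lemma rel_arith_std: "rel_arith_of (Rel std)"
proof -
  have "\<zero> \<preceq> y" for y by (simp add: le_iff)
  moreover have "ss x \<preceq> y" if "x \<prec> y" for x y
    using that unfolding less_iff le_iff by (metis pl_suc suc_pl)
  ultimately show ?thesis
    unfolding rel_arith_def by (auto simp: less_suc le_def)
qed

end

definition good_theory :: "fm set \<Rightarrow> fm \<Rightarrow> bool" where
  "good_theory T \<tau> \<longleftrightarrow> LA_theory T \<and> Th ISigma1 \<subseteq> Th T \<and> Sigma1 \<tau> \<and> is_definition \<tau> T"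

lemma good_defining: "good_theory T \<tau> \<Longrightarrow> defining \<tau>"
  by (simp add: good_theory_def defining_def is_definition_def gS_Sigma1)

lemma good_complete:
  assumes "good_theory T \<tau>"
    and "\<And>(M :: nat la_str) e. models M T \<Longrightarrow> isigma1 M \<Longrightarrow> holds M e \<phi>"
  shows "T \<turnstile> \<phi>"
  using assms unfolding good_theory_def by (blast intro: proves_complete)

context isigma1
begin

text \<open>Validity in countable models yields an actual derivation, which
  \<open>necessitation\<close> copies into the model; nonstandard elements enter only through the
  environment, as numerals.\<close>

lemma Bx_valid:
  assumes "good_theory T \<tau>"
    and "\<And>(M :: nat la_str) e. models M T \<Longrightarrow> isigma1 M \<Longrightarrow> holds M e \<phi>"
  shows "Bx \<tau> \<phi> e"
  using good_complete[OF assms] assms(1) unfolding good_theory_def by (blast intro: Bx_nec)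

lemma Bx_valid_Imp:
  assumes "good_theory T \<tau>" "Bx \<tau> \<phi> e"
    and "\<And>(M :: nat la_str) e. models M T \<Longrightarrow> isigma1 M \<Longrightarrow> holds M e \<phi> \<Longrightarrow> holds M e \<psi>"
  shows "Bx \<tau> \<psi> e"
proof (rule Bx_MP[OF good_defining[OF assms(1)] _ assms(2)])
  show "Bx \<tau> (Imp \<phi> \<psi>) e" by (rule Bx_valid[OF assms(1)]) (simp add: assms(3))
qed

section \<open>Provable facts about nonstandard numerals\<close>

lemma DT_mcodes:
  "DT M s \<Longrightarrow> DT M t \<Longrightarrow> DT M (\<lambda>e. mPlus (s e) (t e))"
  "DT M s \<Longrightarrow> DT M t \<Longrightarrow> DT M (\<lambda>e. mTimes (s e) (t e))"
  unfolding mPlus_def mTimes_def by (intro DT_pr DT_const; assumption)+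

lemma DS_Prv_graph:
  assumes "defining \<tau>" "DT M t" "DT M s" "\<And>u v. DT M u \<Longrightarrow> DT M v \<Longrightarrow> DT M (\<lambda>e. f (u e) (v e))"
  shows "DS (\<lambda>e. Prv \<tau> (f (numM (t e)) (numM (s e))))"
proof -
  have "DS (\<lambda>e. \<exists>u v. Nm (t e) u \<and> Nm (s e) v \<and> Prv \<tau> (f u v))"
    by (intro DS_ex DS_conj DS_syntax assms DT_Suc DT_intros)
  then show ?thesis by (simp add: Nm_iff)
qed

text \<open>The arguments may be nonstandard, so the induction is internal; its step is a theorem
  about three variables, the third of which names the sum already computed.\<close>

lemma Prv_plus:
  assumes T: "good_theory T \<tau>"
  shows "Prv \<tau> (mEq (mPlus (numM x) (numM y)) (numM (x \<oplus> y)))"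
proof (rule DS_induction[where P = "\<lambda>y. Prv \<tau> (mEq (mPlus (numM x) (numM y)) (numM (x \<oplus> y)))"])
  show "DS (\<lambda>e. Prv \<tau> (mEq (mPlus (numM x) (numM (e 0))) (numM (x \<oplus> e 0))))"
    by (rule DS_Prv_graph[OF good_defining[OF T]]) (intro DT_codes DT_mcodes DT_intros; assumption)+
  have "Bx \<tau> (Eq (Plus (Var 0) Zero) (Var 0)) (\<lambda>_. x)"
    by (rule Bx_valid[OF T]) (simp add: isigma1.pl_zero)
  then show "Prv \<tau> (mEq (mPlus (numM x) (numM \<zero>)) (numM (x \<oplus> \<zero>)))" by (simp add: Bx_def nd_def)
next
  fix y assume "Prv \<tau> (mEq (mPlus (numM x) (numM y)) (numM (x \<oplus> y)))"
  then have "Bx \<tau> (Eq (Plus (Var 0) (Var 1)) (Var 2)) ((!) [x, y, x \<oplus> y])"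
    by (simp add: Bx_def nd_def)
  then have "Bx \<tau> (Eq (Plus (Var 0) (Succ (Var 1))) (Succ (Var 2))) ((!) [x, y, x \<oplus> y])"
    by (rule Bx_valid_Imp[OF T]) (simp add: isigma1.pl_suc)
  then show "Prv \<tau> (mEq (mPlus (numM x) (numM (ss y))) (numM (x \<oplus> ss y)))" by (simp add: Bx_def nd_def)
qed

lemma Bx_Conj: "good_theory T \<tau> \<Longrightarrow> Bx \<tau> \<phi> e \<Longrightarrow> Bx \<tau> \<psi> e \<Longrightarrow> Bx \<tau> (Conj \<phi> \<psi>) e"
proof -
  assume T: "good_theory T \<tau>" and 1: "Bx \<tau> \<phi> e" and 2: "Bx \<tau> \<psi> e"
  from 1 have "Bx \<tau> (Imp \<psi> (Conj \<phi> \<psi>)) e" by (rule Bx_valid_Imp[OF T]) simp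
  then show ?thesis using 2 by (rule Bx_MP[OF good_defining[OF T]])
qed

lemma Prv_times:
  assumes T: "good_theory T \<tau>"
  shows "Prv \<tau> (mEq (mTimes (numM x) (numM y)) (numM (x \<otimes> y)))"
proof (rule DS_induction[where P = "\<lambda>y. Prv \<tau> (mEq (mTimes (numM x) (numM y)) (numM (x \<otimes> y)))"])
  show "DS (\<lambda>e. Prv \<tau> (mEq (mTimes (numM x) (numM (e 0))) (numM (x \<otimes> e 0))))"
    by (rule DS_Prv_graph[OF good_defining[OF T]]) (intro DT_codes DT_mcodes DT_intros; assumption)+
  have "Bx \<tau> (Eq (Times (Var 0) Zero) Zero) (\<lambda>_. x)"
    by (rule Bx_valid[OF T]) (simp add: isigma1.mu_zero)
  then show "Prv \<tau> (mEq (mTimes (numM x) (numM \<zero>)) (numM (x \<otimes> \<zero>)))" by (simp add: Bx_def nd_def)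
next
  fix y assume *: "Prv \<tau> (mEq (mTimes (numM x) (numM y)) (numM (x \<otimes> y)))"
  let ?e = "(!) [x, y, x \<otimes> y, x \<otimes> y \<oplus> x]"
  have "Bx \<tau> (Conj (Eq (Times (Var 0) (Var 1)) (Var 2)) (Eq (Plus (Var 2) (Var 0)) (Var 3))) ?e"
    using * Prv_plus[OF T, of "x \<otimes> y" x] by (intro Bx_Conj[OF T]) (simp_all add: Bx_def nd_def)
  then have "Bx \<tau> (Eq (Times (Var 0) (Succ (Var 1))) (Var 3)) ?e"
    by (rule Bx_valid_Imp[OF T]) (simp add: isigma1.mu_suc)
  then show "Prv \<tau> (mEq (mTimes (numM x) (numM (ss y))) (numM (x \<otimes> ss y)))" by (simp add: Bx_def nd_def)
qed

lemma Bx_divisor: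
  assumes T: "good_theory T \<tau>" and "dv (q b x) a"
  shows "Bx \<tau> (std 6 3) ((!) [x, a, b])"
proof -
  obtain k where a: "a = q b x \<otimes> k" using assms(2) unfolding dv_def by blast
  \<comment> \<open>The further entries name values of subterms, so that only single sums and
    products of numerals have to be evaluated inside the box.\<close>
  let ?e = "(!) [x, a, b, ss x \<otimes> b, k]"
  have "Bx \<tau> (Conj (Eq (Times (Succ (Var 0)) (Var 2)) (Var 3)) (Eq (Times (Succ (Var 3)) (Var 4)) (Var 1))) ?e"
    using Prv_times[OF T, of "ss x" b] Prv_times[OF T, of "q b x" k]
    by (intro Bx_Conj[OF T]) (simp_all add: Bx_def nd_def q_def a del: suc_mu)
  then have "Bx \<tau> (std 6 3) ?e"
    by (rule Bx_valid_Imp[OF T]) (auto simp: std_def intro: sym)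
  then show ?thesis by (rule Bx_cong[THEN iffD1, rotated]) (auto simp: std_def Exists_def)
qed

text \<open>Nondivisibility is made existential: there is a positive remainder r + 1, and r + 1 + d
  = (x + 1) b certifies that it is below the modulus. Uniqueness of division, applied in the models
  of \<open>T\<close>, excludes remainder zero.\<close>

lemma Bx_nondivisor:
  assumes T: "good_theory T \<tau>" and "\<not> dv (q b x) a"
  shows "Bx \<tau> (Neg (std 6 3)) ((!) [x, a, b])"
proof -
  obtain k v where v: "v \<prec> q b x" "a = k \<otimes> q b x \<oplus> v"
    using division[of "q b x" a] by (auto simp: q_def)
  have "v \<noteq> \<zero>" using v assms(2) mu_commute by (auto simp: dv_def)
  then obtain r where r: "v = ss r" using zero_or_suc by blast
  obtain d where d: "ss x \<otimes> b = ss r \<oplus> d"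
    using v(1) unfolding q_def less_suc_le r le_iff by blast
  have a: "a = q b x \<otimes> k \<oplus> ss r" by (simp only: v(2) r mu_commute)
  let ?e = "(!) [x, a, b, ss x \<otimes> b, k, q b x \<otimes> k, r, d]"
  have "Bx \<tau> (Conj (Eq (Times (Succ (Var 0)) (Var 2)) (Var 3)) (Conj (Eq (Times (Succ (Var 3)) (Var 4)) (Var 5))
      (Conj (Eq (Plus (Var 5) (Succ (Var 6))) (Var 1)) (Eq (Plus (Succ (Var 6)) (Var 7)) (Var 3))))) ?e"
    using Prv_times[OF T, of "ss x" b] Prv_times[OF T, of "q b x" k]
      Prv_plus[OF T, of "q b x \<otimes> k" "ss r"] Prv_plus[OF T, of "ss r" d] unfolding a[symmetric] d[symmetric]
    by (intro Bx_Conj[OF T]) (simp_all add: Bx_def nd_def q_def del: suc_mu)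
  then have "Bx \<tau> (Neg (std 6 3)) ?e"
  proof (rule Bx_valid_Imp[OF T])
    fix N :: "nat la_str" and e
    assume "isigma1 N"
    then interpret N: isigma1 N .
    assume *: "holds N e (Conj (Eq (Times (Succ (Var 0)) (Var 2)) (Var 3)) (Conj (Eq (Times (Succ (Var 3)) (Var 4)) (Var 5))
      (Conj (Eq (Plus (Var 5) (Succ (Var 6))) (Var 1)) (Eq (Plus (Succ (Var 6)) (Var 7)) (Var 3)))))"
    have "pls N (suc N (e 6)) (e 7) = tms N (suc N (e 0)) (e 2)" using * by (simp del: N.suc_mu N.mu_suc)
    then have lt: "lss N (suc N (e 6)) (N.q (e 2) (e 0))"
      unfolding N.q_def N.less_suc_le N.le_iff by (metis)
    have a: "e 1 = pls N (tms N (e 4) (N.q (e 2) (e 0))) (suc N (e 6))"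
      using * N.mu_commute unfolding N.q_def by (simp del: N.suc_mu N.mu_suc N.pl_suc)
    have "e 1 \<noteq> tms N (N.q (e 2) (e 0)) k" for k
    proof
      assume "e 1 = tms N (N.q (e 2) (e 0)) k"
      then have "pls N (tms N k (N.q (e 2) (e 0))) (zer N) = pls N (tms N (e 4) (N.q (e 2) (e 0))) (suc N (e 6))"
        using a N.mu_commute by (simp del: N.suc_mu N.mu_suc N.pl_suc)
      moreover have "lss N (zer N) (N.q (e 2) (e 0))" by (simp add: N.q_def N.less_suc_le N.le_iff)
      ultimately have "zer N = suc N (e 6)" using lt N.division_unique by blast
      then show False by simp
    qed
    then show "holds N e (Neg (std 6 3))" by (simp add: std_def N.q_def del: N.suc_mu)
  qed
  then show ?thesis by (rule Bx_cong[THEN iffD1, rotated]) (auto simp: std_def Exists_def)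
qed

text \<open>The code \<open>a\<close> is the least positive number divisible by the moduli of the elements of the
  set: a superfluous modulus could be cancelled from \<open>a\<close>.\<close>

lemma set_coding:
  assumes P: "DS (\<lambda>e. P (e 0))"
  shows "\<exists>a b. \<forall>x. x \<prec> n \<longrightarrow> (dv (q b x) a \<longleftrightarrow> P x)"
proof -
  obtain b where b: "b \<noteq> \<zero>" "\<And>d. d \<prec> ss n \<Longrightarrow> d \<noteq> \<zero> \<Longrightarrow> \<exists>k. b = d \<otimes> k"
    using common_multiple[of n] by blast
  \<comment> \<open>All moduli in question are at most \<open>q b n\<close>, so \<open>N\<close> is
    a first positive number divisible by all of them; the least number principle starts from
    it.\<close>
  obtain N where N: "N \<noteq> \<zero>" "\<And>d. d \<prec> ss (q b n) \<Longrightarrow> d \<noteq> \<zero> \<Longrightarrow> \<exists>k. N = d \<otimes> k"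
    using common_multiple[of "q b n"] by blast
  have unit: "\<exists>t. dv (q b j) (ss (q b i \<otimes> t))" if "i \<prec> j" "j \<prec> n" for i j
    by (rule moduli_units[of i j n]) (use that b in \<open>auto simp: le_def less_suc dv_def\<close>)
  \<comment> \<open>\<open>moduli_units\<close> inverts the smaller modulus modulo the larger one.
    In the other case the same relation, read modulo the smaller modulus, inverts the larger
    one.\<close>
  have euclid: "dv (q b j) c" if ij: "i \<noteq> j" "i \<prec> n" "j \<prec> n" and d: "dv (q b j) (q b i \<otimes> c)" for i j c
  proof (cases "i \<prec> j")
    case True
    then obtain t where "dv (q b j) (ss (q b i \<otimes> t))" using unit ij by blast
    then have "dv (q b j) (ss (q b i \<otimes> t) \<otimes> c)" by (rule dv_mu)
    moreover have "ss (q b i \<otimes> t) \<otimes> c = q b i \<otimes> c \<otimes> t \<oplus> c" by (simp add: algebra_simps)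
    ultimately show ?thesis using d dv_mu dv_cancel by metis
  next
    case False
    then have "j \<prec> i" using ij(1) less_linear unfolding le_def by metis
    then obtain t s where s: "ss (q b j \<otimes> t) = q b i \<otimes> s" using unit ij unfolding dv_def by metis
    have "q b i \<otimes> c \<otimes> s = ss (q b j \<otimes> t) \<otimes> c" unfolding s by (simp only: mult_ac)
    also have "\<dots> = q b j \<otimes> (t \<otimes> c) \<oplus> c" by (simp add: algebra_simps)
    finally show ?thesis using d dv_mu dv_cancel dvI by metis
  qed
  \<comment> \<open>The quotient is bounded, so divisibility is \<Delta>0 and the property to be
    minimized is \<Pi>1.\<close>
  have dv_iff: "dv (q b x) a \<longleftrightarrow> (\<exists>k. k \<prec> ss a \<and> a = q b x \<otimes> k)" for x a
    unfolding dv_def less_suc_le q_def le_iff by (metis suc_mu pl_commute)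
  let ?P = "\<lambda>a. a \<noteq> \<zero> \<and> (\<forall>x. x \<prec> n \<longrightarrow> P x \<longrightarrow> dv (q b x) a)"
  obtain a where a: "?P a" and least: "\<And>c. c \<prec> a \<Longrightarrow> \<not> ?P c"
  proof (rule least_Pi1[of ?P N])
    have "DS (\<lambda>e. e 0 = \<zero> \<or> (\<exists>x. x \<prec> n \<and> P x \<and> \<not> (\<exists>k. k \<prec> ss (e 0) \<and> e 0 = q b x \<otimes> k)))"
      unfolding q_def by (intro DS_intros D0_intros DS_rel1[OF P] DT_intros)
    then show "DS (\<lambda>e. \<not> ?P (e 0))" unfolding dv_iff by (simp add: de_Morgan_conj)
    have "q b x \<prec> ss (q b n)" if x: "x \<prec> n" for x
    proof -
      obtain d where d: "n = x \<oplus> ss d" using x less_iff by blast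
      have "q b n = q b x \<oplus> ss d \<otimes> b" unfolding q_def d by (simp add: algebra_simps)
      then show ?thesis unfolding less_suc_le le_iff by blast
    qed
    then have "dv (q b x) N" if "x \<prec> n" for x
      using N(2)[of "q b x"] that unfolding dv_def by (auto simp: q_def)
    with N(1) show "?P N" by blast
  qed blast
  have "P x" if x: "x \<prec> n" and d: "dv (q b x) a" for x
  proof (rule ccontr)
    assume "\<not> P x"
    obtain c where c: "a = q b x \<otimes> c" using d unfolding dv_def by blast
    have "c \<noteq> \<zero>" using a c by auto
    moreover have "dv (q b y) c" if "y \<prec> n" "P y" for y
      using euclid[of x y c] a that x \<open>\<not> P x\<close> unfolding c by blast
    moreover have "c \<prec> a"
    proof -
      \<comment> \<open>As \<open>b\<close> is positive the modulus is at least 2, and cancelling it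
        makes \<open>a\<close> properly smaller.\<close>
      have "q b x \<noteq> ss \<zero>" using b(1) unfolding q_def by (auto simp: pl_eq_zero)
      then obtain d where "q b x = ss (ss d)" unfolding q_def using zero_or_suc by (metis)
      then have "a = c \<oplus> (d \<otimes> c \<oplus> c)" unfolding c by (simp add: algebra_simps)
      moreover have "d \<otimes> c \<oplus> c \<noteq> \<zero>" using \<open>c \<noteq> \<zero>\<close> by (simp add: pl_eq_zero)
      ultimately show ?thesis unfolding less_iff using zero_or_suc by metis
    qed
    ultimately show False using least by blast
  qed
  with a show ?thesis by blast
qed

lemma Prv_explosion:
  assumes "defining \<tau>" "Frm p" "Frm r" "Prv \<tau> p" "Prv \<tau> (mNeg p)"
  shows "Prv \<tau> r"
proof -
  have "Prv \<tau> (mImp (mNeg r) (mNeg p))"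
    using Prv_MP[OF assms(1) Prv_K[OF assms(1)]] assms Frm_Neg by blast
  then have "Prv \<tau> (mImp p r)" using Prv_MP[OF assms(1) Prv_N[OF assms(1)]] assms by blast
  then show ?thesis using Prv_MP[OF assms(1)] assms by blast
qed

lemma Frm_mDiag: "Frm x \<Longrightarrow> Frm (mDiag x)"
  unfolding mDiag_def by (intro Frm_Forall Frm_Imp Frm_Eq Trm_Var numM_code)

lemma std_rigid:
  assumes T: "good_theory T \<tau>"
  shows "msat (Rel std) (\<lambda>h A. Bx \<tau> (interp std \<tau> A) h) h rigid"
proof -
  have *: "Bx \<tau> (ren (\<lambda>i. [2, 1, 0] ! i) \<phi>) (case_nat b (case_nat a (case_nat x h))) \<longleftrightarrow> Bx \<tau> \<phi> ((!) [x, a, b])"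
    if "fv \<phi> \<subseteq> {..<3}" for \<phi> x a b
    unfolding Bx_ren
  proof (rule Bx_cong)
    fix i assume "i \<in> fv \<phi>"
    with that have "i < 3" by auto
    then consider "i = 0" | "i = 1" | "i = 2" by linarith
    then show "case_nat b (case_nat a (case_nat x h)) ([2, 1, 0] ! i) = [x, a, b] ! i" by cases simp_all
  qed
  have fv: "fv (std 6 3) \<subseteq> {..<3}" using arith_interp_std by (simp add: arith_interp_def)
  have Z: "Bx \<tau> (ren (\<lambda>i. [0] ! i) (std 0 1)) (case_nat \<zero> h)"
    by (simp add: std_def Bx_def nd_def Prv_Refl good_defining[OF T] Trm_Zero)
  have S: "Bx \<tau> (ren (\<lambda>i. [1, 0] ! i) (std 1 2)) (case_nat (ss x) (case_nat x h))" for x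
    using Prv_Refl[OF good_defining[OF T] Trm_Succ[OF numM_code(1)]] by (simp add: std_def Bx_def nd_def)
  have D: "Bx \<tau> (ren (\<lambda>i. [2, 1, 0] ! i) (std 6 3)) (case_nat b (case_nat a (case_nat x h)))"
    if "dv (q b x) a" for x a b
    using *[OF fv] Bx_divisor[OF T that] by blast
  have N: "Bx \<tau> (Neg (ren (\<lambda>i. [2, 1, 0] ! i) (std 6 3))) (case_nat b (case_nat a (case_nat x h)))"
    if "\<not> dv (q b x) a" for x a b
    using *[of "Neg (std 6 3)"] fv Bx_nondivisor[OF T that] by simp
  show ?thesis
    using Z S D N by (simp add: rigid_def numeral_3_eq_3 numeral_2_eq_2)
qed

text \<open>Used with \<open>T\<^sub>1\<close> and \<open>\<tau>\<^sub>1\<close> for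
  \<open>T\<close> and \<open>\<tau>\<close>, and with \<open>\<tau>\<^sub>0\<close> for
  \<open>\<sigma>\<close>; the model has \<Sigma>1 induction only.\<close>

theorem provable_transfer:
  assumes T: "good_theory T \<tau>" and M: "models M T" and \<sigma>: "defining \<sigma>"
    and refl: "\<And>f. arith_interp f \<Longrightarrow> T \<turnstile> interp f \<tau> (reflection \<sigma> \<phi>)"
    and e: "Bx \<tau> \<phi> e"
  shows "Bx \<sigma> \<phi> e"
\<comment> \<open>A diagonal sentence that is both provable and refutable makes
  \<open>\<sigma>\<close> prove every formula; explosion needs it to be a formula, whence the
  conjunct \<open>Frm\<close> in \<open>DRef\<close>. Otherwise the provable diagonal sentences
  themselves are a separating \<Sigma>1 set.\<close>
proof (cases "\<exists>x. Prv \<sigma> (mDiag x) \<and> Frm x \<and> Prv \<sigma> (mNeg (mDiag x))")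
  case True
  then show ?thesis
    unfolding Bx_def using Prv_explosion[OF \<sigma>] Frm_mDiag Frm_dot by blast
next
  case False
  let ?B = "\<lambda>h A. Bx \<tau> (interp std \<tau> A) h"
  note wf = good_defining[OF T]
  have "holds M e (interp std \<tau> (reflection \<sigma> \<phi>))"
    using soundness[OF refl[OF arith_interp_std] M] .
  then have R: "msat (Rel std) ?B e (reflection \<sigma> \<phi>)"
    by (simp add: holds_interp[OF arith_interp_std wf])
  have 1: "msat (Rel std) ?B e base" by (simp add: msat_base rel_arith_std[simplified])
  have 2: "Bx \<tau> (interp std \<tau> base) e"
    by (rule Bx_valid[OF T])
      (simp add: isigma1.holds_interp[OF _ arith_interp_std wf] msat_base isigma1.rel_arith_std[simplified])
  have "DS (\<lambda>e. Prv \<sigma> (mDiag (e 0)))"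
    using gS_DS[OF gS_DPr, of \<sigma>] \<sigma> unfolding holds_DPr[OF \<sigma>] defining_def by blast
  then have "\<exists>a b. \<forall>x. x \<prec> y \<longrightarrow> (dv (q b x) a \<longleftrightarrow> Prv \<sigma> (mDiag x))" for y
    by (rule set_coding)
  then have 3: "msat (Rel std) ?B e (separation \<sigma>)"
    using False by (simp add: separation_def msat_tr_std \<sigma>) blast
  have 4: "Bx \<tau> (interp std \<tau> (tr \<phi>)) e"
    using e by (rule Bx_valid_Imp[OF T])
      (simp add: isigma1.holds_interp[OF _ arith_interp_std wf] isigma1.msat_tr_std)
  have "msat (Rel std) ?B e (tr (Pr_dot \<sigma> \<phi>))"
    using R 1 2 3 4 std_rigid[OF T] by (simp add: reflection_def)
  then show ?thesis by (simp add: msat_tr_std \<sigma>)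
qed

end

lemma DF_rel3:
  assumes C: "sb_closed C" and Q: "DF M C (\<lambda>e. Q (e 0) (e 1) (e 2))"
    and s: "DT M s" and t: "DT M t" and u: "DT M u"
  shows "DF M C (\<lambda>e. Q (s e) (t e) (u e))"
proof -
  have "DF M C (\<lambda>e. (\<lambda>x e. Q (e 0) (e 1) x) (e 0) (\<lambda>i. e (Suc i)))"
    using DF_ren[OF C Q, of "\<lambda>i. if i = 0 then 1 else if i = 1 then 2 else 0"] by (simp add: numeral_2_eq_2)
  then have "DF M C (\<lambda>e. (\<lambda>x e. Q (e 0) (e 1) x) (u (\<lambda>i. e (Suc (Suc i)))) e)"
    by (rule DF_inst[OF C]) (use DT_Suc[OF DT_Suc[OF u]] in simp)
  then have "DF M C (\<lambda>e. (\<lambda>x e. Q (e 0) x (u (\<lambda>i. e (Suc i)))) (e 0) (\<lambda>i. e (Suc i)))"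
    using DF_ren[OF C, of M "\<lambda>e. Q (e 0) (e 1) (u (\<lambda>i. e (Suc (Suc i))))" "\<lambda>i. if i = 0 then 1 else if i = 1 then 0 else i"]
    by simp
  then have "DF M C (\<lambda>e. (\<lambda>x e. Q (e 0) x (u (\<lambda>i. e (Suc i)))) (t (\<lambda>i. e (Suc i))) e)"
    by (rule DF_inst[OF C]) (use DT_Suc[OF t] in simp)
  then have "DF M C (\<lambda>e. (\<lambda>x e. Q x (t e) (u e)) (e 0) (\<lambda>i. e (Suc i)))" by simp
  then have "DF M C (\<lambda>e. (\<lambda>x e. Q x (t e) (u e)) (s e) e)" by (rule DF_inst[OF C]) (rule s)
  then show ?thesis .
qed

section \<open>Arithmetical definability and induction in models of PA\<close>

abbreviation "DA M \<equiv> DF M (\<lambda>_. True)"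

lemma DA_D0: "DF M Delta0 P \<Longrightarrow> DA M P"
  by (erule DF_mono) simp

lemma DA_atoms: "DT M s \<Longrightarrow> DT M t \<Longrightarrow> DA M (\<lambda>e. s e = t e)" "DT M s \<Longrightarrow> DT M t \<Longrightarrow> DA M (\<lambda>e. lss M (s e) (t e))"
  by (auto intro: DA_D0 D0_eq D0_less)

lemma DA_imp: "DA M P \<Longrightarrow> DA M Q \<Longrightarrow> DA M (\<lambda>e. P e \<longrightarrow> Q e)"
  using DF_op2[of "\<lambda>_. True" M P Q] unfolding DF_def by (simp, metis holds.simps(4))

lemma DA_neg: "DA M P \<Longrightarrow> DA M (\<lambda>e. \<not> P e)"
  unfolding DF_def by (metis holds.simps(3))

lemma DA_conj: "DA M P \<Longrightarrow> DA M Q \<Longrightarrow> DA M (\<lambda>e. P e \<and> Q e)"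
  using DA_neg[OF DA_imp[OF _ DA_neg]] by simp

lemma DA_all:
  assumes "DA M (\<lambda>e. Q (e 0) (\<lambda>i. e (Suc i)))"
  shows "DA M (\<lambda>e. \<forall>x. Q x e)"
proof -
  obtain \<phi> p where "\<And>e x. Q x e \<longleftrightarrow> holds M (case_nat x (mg e p)) \<phi>"
    using DF_shift[OF _ assms] by auto
  then have "(\<forall>x. Q x e) \<longleftrightarrow> holds M (mg e p) (Forall \<phi>)" for e by simp
  then show ?thesis unfolding DF_def by blast
qed

lemma DA_ex: "DA M (\<lambda>e. Q (e 0) (\<lambda>i. e (Suc i))) \<Longrightarrow> DA M (\<lambda>e. \<exists>x. Q x e)"
  using DA_neg[OF DA_all[OF DA_neg]] by simp

lemmas DA_intros = DA_conj DA_imp DA_neg DA_all DA_ex DA_atoms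

lemma DA_holds: "DA M (\<lambda>e. holds M e \<phi>)"
proof -
  have "holds M e \<phi> \<longleftrightarrow> holds M (mg e undefined) (ren (\<lambda>i. 2 * i) \<phi>)" for e
    by (simp add: holds_ren mg_def)
  then show ?thesis unfolding DF_def by blast
qed

lemma DA_induction:
  assumes PA: "models M PA" and P: "DA M (\<lambda>e. P (e 0))"
    and 0: "P (zer M)" and step: "\<And>x. P x \<Longrightarrow> P (suc M x)"
  shows "P x"
proof -
  have "DA M (\<lambda>e. (\<lambda>x _. P x) (e 0) (\<lambda>i. e (Suc i)))" using P by simp
  from DF_shift[OF _ this] obtain \<phi> p where \<phi>: "\<And>e x. P x \<longleftrightarrow> holds M (case_nat x (mg e p)) \<phi>" by auto
  define e where "e = mg undefined p"
  have P: "holds M (case_nat x e) \<phi> \<longleftrightarrow> P x" for x unfolding e_def using \<phi> by blast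
  let ?\<psi> = "Imp (subst 0 Zero \<phi>)
    (Imp (Forall (Imp \<phi> (subst 0 (Succ (Var 0)) (lift 1 \<phi>)))) (Forall \<phi>))"
  have *: "holds M (case_nat (suc M x) (case_nat x e)) (lift (Suc 0) \<phi>) \<longleftrightarrow> holds M (case_nat (suc M x) e) \<phi>"
    for x
    unfolding lift_sb holds_sb
    by (rule arg_cong[where f = "\<lambda>e. holds M e \<phi>"], rule ext) (auto split: nat.split)
  have "univ_closure ?\<psi> \<in> PA" unfolding PA_def induction_axiom_def by blast
  then have "holds M e ?\<psi>"
    using PA holds_univ_closure[of M ?\<psi>] unfolding models_def by blast
  then show ?thesis using 0 step by (simp add: holds_subst * P)
qed

lemma LA_theory_PA: "LA_theory PA"
  by (auto simp: LA_theory_def PA_def basic_axioms_def induction_axiom_def sentence_univ_closure)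

lemma isigma1_PA: "models M PA \<Longrightarrow> isigma1 M"
  by (rule isigma1.intro) (auto simp: models_def PA_def ISigma1_def)

section \<open>The standard part of an interpreted structure\<close>

text \<open>The relation \<open>emb\<close> as an explicit formula, since it also has to occur
  inside the box. The outer renaming confines the free variables to 0 and 1, whatever
  \<open>f\<close> is.\<close>

definition EMB :: "(nat \<Rightarrow> nat \<Rightarrow> fm) \<Rightarrow> fm" where
  "EMB f = ren (\<lambda>i. if i = 0 then 0 else 1) (Exists (Exists (Conj
     (Exists (Conj (beta (Var 2) (Var 1) Zero (Var 0)) (ren (\<lambda>i. 0) (f 0 1))))
     (Conj (ForallB (Var 2) (Exists (Exists (Conj (beta (Var 4) (Var 3) (Var 2) (Var 1))
         (Conj (beta (Var 4) (Var 3) (Succ (Var 2)) (Var 0))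
           (ren (\<lambda>i. if i = 0 then 1 else 0) (f 1 2)))))))
       (beta (Var 1) (Var 0) (Var 2) (Var 3))))))"

lemma fv_EMB: "fv (EMB f) \<subseteq> {0, 1}"
  by (auto simp: EMB_def fv_ren)

locale pa_rel = isigma1 M for M :: "'a la_str" +
  fixes f :: "nat \<Rightarrow> nat \<Rightarrow> fm"
  assumes PA: "models M PA" and f: "arith_interp f" and rel: "rel_arith_of (Rel f)"
begin

abbreviation "Zf x \<equiv> Rel f 0 [x]"
abbreviation "Sf x y \<equiv> Rel f 1 [x, y]"
abbreviation "Af x y z \<equiv> Rel f 2 [x, y, z]"
abbreviation "Mf x y z \<equiv> Rel f 3 [x, y, z]"
abbreviation "Lf x y \<equiv> Rel f 4 [x, y]"
abbreviation "Ef x y \<equiv> Rel f 5 [x, y]"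
abbreviation "Qf x y z \<equiv> Rel f 6 [x, y, z]"

sublocale R: rel_arith Zf Sf Af Mf Lf Ef Qf by (rule rel)

text \<open>Iterates the interpreted successor \<open>x\<close> times from an interpreted zero,
  along a sequence coded in the model. The value is determined only up to interpreted
  equality.\<close>

definition emb :: "'a \<Rightarrow> 'a \<Rightarrow> bool" where
  "emb x z \<longleftrightarrow> (\<exists>a b. Zf (bt a b \<zero>) \<and> (\<forall>i. i \<prec> x \<longrightarrow> Sf (bt a b i) (bt a b (ss i))) \<and> bt a b x = z)"

lemma fv_f: "fv (f P n) = {..<n}"
  using f by (simp add: arith_interp_def)

lemma Rel1: "Rel f P [x] \<longleftrightarrow> holds M (\<lambda>_. x) (f P (Suc 0))"
  unfolding Rel_def by (simp, rule holds_cong) (auto simp: fv_f)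

lemma Rel2: "e 0 = x \<Longrightarrow> e 1 = y \<Longrightarrow> holds M e (f P 2) \<longleftrightarrow> Rel f P [x, y]"
  unfolding Rel_def by (simp add: numeral_2_eq_2, rule holds_cong) (auto simp: fv_f less_Suc_eq)

lemma Rel3: "e 0 = x \<Longrightarrow> e 1 = y \<Longrightarrow> e 2 = z \<Longrightarrow> holds M e (f P 3) \<longleftrightarrow> Rel f P [x, y, z]"
  unfolding Rel_def by (simp add: numeral_3_eq_3 numeral_2_eq_2, rule holds_cong) (auto simp: fv_f less_Suc_eq)

lemma holds_EMB: "holds M e (EMB f) \<longleftrightarrow> emb (e 0) (e 1)"
  unfolding EMB_def emb_def
  by (simp add: holds_ren Rel1[symmetric] Rel2[OF refl refl] ForallB_def)

lemma DA_emb: "DT M s \<Longrightarrow> DT M t \<Longrightarrow> DA M (\<lambda>e. emb (s e) (t e))"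
  using DF_rel3[of "\<lambda>_. True" M "\<lambda>x y z. emb x y" s t t] DA_holds[of M "EMB f"]
  by (simp add: holds_EMB)

lemma DA_Rel2: "DT M s \<Longrightarrow> DT M t \<Longrightarrow> DA M (\<lambda>e. Rel f P [s e, t e])"
  using DF_rel3[of "\<lambda>_. True" M "\<lambda>x y z. Rel f P [x, y]" s t t] DA_holds[of M "f P 2"]
  by (simp add: Rel2[OF refl refl])

lemma DA_Rel3: "DT M s \<Longrightarrow> DT M t \<Longrightarrow> DT M u \<Longrightarrow> DA M (\<lambda>e. Rel f P [s e, t e, u e])"
  using DF_rel3[of "\<lambda>_. True" M "\<lambda>x y z. Rel f P [x, y, z]" s t u] DA_holds[of M "f P 3"]
  by (simp add: Rel3[OF refl refl refl])

lemmas DA_rules = DA_intros DA_emb DA_Rel2 DA_Rel3 DT_intros DT_Suc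

lemma emb_zero: "emb \<zero> z \<longleftrightarrow> Zf z"
proof
  assume "Zf z"
  moreover obtain a b where "bt a b \<zero> = z" using seq_extend[of \<zero>] by blast
  ultimately show "emb \<zero> z" unfolding emb_def by auto
qed (auto simp: emb_def)

lemma emb_suc: "emb (ss x) z \<longleftrightarrow> (\<exists>y. emb x y \<and> Sf y z)"
proof
  assume "emb (ss x) z"
  then obtain a b where *: "Zf (bt a b \<zero>)" "\<And>i. i \<prec> ss x \<Longrightarrow> Sf (bt a b i) (bt a b (ss i))"
    "bt a b (ss x) = z" unfolding emb_def by blast
  then have "emb x (bt a b x)" unfolding emb_def less_suc by blast
  moreover have "Sf (bt a b x) z" using *(2)[of x] *(3) by (simp add: less_suc)
  ultimately show "\<exists>y. emb x y \<and> Sf y z" by blast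
next
  assume "\<exists>y. emb x y \<and> Sf y z"
  then obtain y a b where y: "Sf y z" and *: "Zf (bt a b \<zero>)"
    "\<And>i. i \<prec> x \<Longrightarrow> Sf (bt a b i) (bt a b (ss i))" "bt a b x = y" unfolding emb_def by blast
  obtain a' b' where ab: "\<And>i. i \<prec> ss x \<Longrightarrow> bt a' b' i = bt a b i" "bt a' b' (ss x) = z"
    using seq_extend by blast
  have "\<zero> \<prec> ss x" by (simp add: less_suc_le le_iff)
  then have "Zf (bt a' b' \<zero>)" using ab *(1) by simp
  moreover have "Sf (bt a' b' i) (bt a' b' (ss i))" if "i \<prec> ss x" for i
  proof (cases "i = x")
    case True
    then show ?thesis using ab *(3) y by (simp add: less_suc)
  next
    case False
    then have "i \<prec> x" using that by (simp add: less_suc)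
    moreover from this have "ss i \<prec> ss x" unfolding less_iff by (metis suc_pl)
    ultimately show ?thesis using ab(1) that *(2) by simp
  qed
  ultimately show "emb (ss x) z" unfolding emb_def using ab(2) by blast
qed

lemma emb_E: "emb x z \<Longrightarrow> Ef z z' \<Longrightarrow> emb x z'"
  using zero_or_suc[of x] emb_zero emb_suc R.Z_cong R.S_cong R.E_refl by metis

lemma emb_unique: "emb x z \<Longrightarrow> emb x z' \<Longrightarrow> Ef z z'"
proof -
  have "\<forall>z z'. emb x z \<longrightarrow> emb x z' \<longrightarrow> Ef z z'"
  proof (rule DA_induction[OF PA, where P = "\<lambda>x. \<forall>z z'. emb x z \<longrightarrow> emb x z' \<longrightarrow> Ef z z'"])
    fix x assume IH: "\<forall>z z'. emb x z \<longrightarrow> emb x z' \<longrightarrow> Ef z z'"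
    show "\<forall>z z'. emb (ss x) z \<longrightarrow> emb (ss x) z' \<longrightarrow> Ef z z'"
      unfolding emb_suc using IH R.S_cong R.S_fun R.E_refl by meson
  qed (intro DA_rules, simp add: emb_zero R.Z_unique)
  then show "emb x z \<Longrightarrow> emb x z' \<Longrightarrow> Ef z z'" by blast
qed

lemma emb_total: "\<exists>z. emb x z"
proof (rule DA_induction[OF PA, where P = "\<lambda>x. \<exists>z. emb x z"])
  show "\<exists>z. emb (ss x) z" if "\<exists>z. emb x z" for x
    unfolding emb_suc using that R.S_ex by meson
qed (intro DA_rules, simp add: emb_zero R.Z_ex)

lemma emb_inj: "emb x z \<Longrightarrow> emb y z \<Longrightarrow> x = y"
proof -
  have "\<forall>y z. emb x z \<longrightarrow> emb y z \<longrightarrow> x = y"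
  proof (rule DA_induction[OF PA, where P = "\<lambda>x. \<forall>y z. emb x z \<longrightarrow> emb y z \<longrightarrow> x = y"])
    show "\<forall>y z. emb \<zero> z \<longrightarrow> emb y z \<longrightarrow> \<zero> = y"
      using zero_or_suc emb_zero emb_suc R.S_not_Z by metis
    fix x assume IH: "\<forall>y z. emb x z \<longrightarrow> emb y z \<longrightarrow> x = y"
    show "\<forall>y z. emb (ss x) z \<longrightarrow> emb y z \<longrightarrow> ss x = y"
    proof (intro allI impI)
      fix y z assume 1: "emb (ss x) z" and 2: "emb y z"
      obtain u where u: "emb x u" "Sf u z" using 1 emb_suc by blast
      then have "\<not> Zf z" using R.S_not_Z by blast
      then obtain y' where y: "y = ss y'" using 2 zero_or_suc[of y] emb_zero by blast
      then obtain w where w: "emb y' w" "Sf w z" using 2 emb_suc by blast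
      then have "emb y' u" using emb_E R.S_inj u(2) by blast
      then show "ss x = y" using IH u(1) y by simp
    qed
  qed (intro DA_rules)
  then show "emb x z \<Longrightarrow> emb y z \<Longrightarrow> x = y" by blast
qed

text \<open>Induction on \<open>y\<close> shows that the image of the sum is a sum of the images;
  the converse follows because interpreted addition is functional and the image of the sum
  exists.\<close>

lemma emb_plus:
  assumes "emb x a" "emb y b"
  shows "Af a b c \<longleftrightarrow> emb (x \<oplus> y) c"
proof -
  have "\<forall>b c. emb y b \<longrightarrow> emb (x \<oplus> y) c \<longrightarrow> Af a b c"
  proof (rule DA_induction[OF PA, where P = "\<lambda>y. \<forall>b c. emb y b \<longrightarrow> emb (x \<oplus> y) c \<longrightarrow> Af a b c"])
    show "\<forall>b c. emb \<zero> b \<longrightarrow> emb (x \<oplus> \<zero>) c \<longrightarrow> Af a b c"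
    proof (intro allI impI)
      fix b c assume "emb \<zero> b" "emb (x \<oplus> \<zero>) c"
      then have "Zf b" "Ef a c" using assms(1) emb_unique by (simp_all add: emb_zero)
      then show "Af a b c" using R.A_Z R.A_cong R.E_refl by blast
    qed
    fix y assume IH: "\<forall>b c. emb y b \<longrightarrow> emb (x \<oplus> y) c \<longrightarrow> Af a b c"
    show "\<forall>b c. emb (ss y) b \<longrightarrow> emb (x \<oplus> ss y) c \<longrightarrow> Af a b c"
      unfolding pl_suc emb_suc using IH R.A_S by blast
  qed (intro DA_rules)
  then have *: "emb (x \<oplus> y) c \<Longrightarrow> Af a b c" for c using assms(2) by blast
  obtain c0 where "emb (x \<oplus> y) c0" using emb_total by blast
  then show ?thesis using * R.A_fun emb_E by blast
qed

lemma emb_times: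
  assumes "emb x a" "emb y b"
  shows "Mf a b c \<longleftrightarrow> emb (x \<otimes> y) c"
proof -
  have "\<forall>b c. emb y b \<longrightarrow> emb (x \<otimes> y) c \<longrightarrow> Mf a b c"
  proof (rule DA_induction[OF PA, where P = "\<lambda>y. \<forall>b c. emb y b \<longrightarrow> emb (x \<otimes> y) c \<longrightarrow> Mf a b c"])
    show "\<forall>b c. emb \<zero> b \<longrightarrow> emb (x \<otimes> \<zero>) c \<longrightarrow> Mf a b c"
      by (simp add: emb_zero R.M_Z)
    fix y assume IH: "\<forall>b c. emb y b \<longrightarrow> emb (x \<otimes> y) c \<longrightarrow> Mf a b c"
    show "\<forall>b c. emb (ss y) b \<longrightarrow> emb (x \<otimes> ss y) c \<longrightarrow> Mf a b c"
    proof (intro allI impI)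
      fix b c assume b: "emb (ss y) b" and c: "emb (x \<otimes> ss y) c"
      obtain b' where b': "emb y b'" "Sf b' b" using b emb_suc by blast
      obtain c' where c': "emb (x \<otimes> y) c'" using emb_total by blast
      have "Af c' a c" using emb_plus[OF c' assms(1)] c by simp
      moreover have "Mf a b' c'" using IH b' c' by blast
      ultimately show "Mf a b c" using R.M_S b'(2) by blast
    qed
  qed (intro DA_rules)
  then have *: "emb (x \<otimes> y) c \<Longrightarrow> Mf a b c" for c using assms(2) by blast
  obtain c0 where "emb (x \<otimes> y) c0" using emb_total by blast
  then show ?thesis using * R.M_fun emb_E by blast
qed

lemma emb_initial: "emb y b \<Longrightarrow> Lf c b \<Longrightarrow> \<exists>x. x \<prec> y \<and> emb x c"
proof -
  have "\<forall>b c. emb y b \<longrightarrow> Lf c b \<longrightarrow> (\<exists>x. x \<prec> y \<and> emb x c)"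
  proof (rule DA_induction[OF PA, where P = "\<lambda>y. \<forall>b c. emb y b \<longrightarrow> Lf c b \<longrightarrow> (\<exists>x. x \<prec> y \<and> emb x c)"])
    show "\<forall>b c. emb \<zero> b \<longrightarrow> Lf c b \<longrightarrow> (\<exists>x. x \<prec> \<zero> \<and> emb x c)"
      using R.L_Z by (auto simp: emb_zero)
    fix y assume IH: "\<forall>b c. emb y b \<longrightarrow> Lf c b \<longrightarrow> (\<exists>x. x \<prec> y \<and> emb x c)"
    show "\<forall>b c. emb (ss y) b \<longrightarrow> Lf c b \<longrightarrow> (\<exists>x. x \<prec> ss y \<and> emb x c)"
    proof (intro allI impI)
      fix b c assume "emb (ss y) b" and c: "Lf c b"
      then obtain b' where b': "emb y b'" "Sf b' b" using emb_suc by blast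
      then have "Lf c b' \<or> Ef c b'" using R.L_S c by blast
      then show "\<exists>x. x \<prec> ss y \<and> emb x c"
        using IH b'(1) emb_E R.E_sym less_suc by blast
    qed
  qed (intro DA_rules)
  then show "emb y b \<Longrightarrow> Lf c b \<Longrightarrow> \<exists>x. x \<prec> y \<and> emb x c" by blast
qed

lemma emb_less:
  assumes "emb x a" "emb y b"
  shows "Lf a b \<longleftrightarrow> x \<prec> y"
proof
  assume "Lf a b"
  then show "x \<prec> y" using emb_initial assms emb_inj by blast
next
  have "\<forall>b. emb y b \<longrightarrow> x \<prec> y \<longrightarrow> Lf a b"
  proof (rule DA_induction[OF PA, where P = "\<lambda>y. \<forall>b. emb y b \<longrightarrow> x \<prec> y \<longrightarrow> Lf a b"])
    fix y assume IH: "\<forall>b. emb y b \<longrightarrow> x \<prec> y \<longrightarrow> Lf a b"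
    show "\<forall>b. emb (ss y) b \<longrightarrow> x \<prec> ss y \<longrightarrow> Lf a b"
    proof (intro allI impI)
      fix b assume "emb (ss y) b" and x: "x \<prec> ss y"
      then obtain b' where b': "emb y b'" "Sf b' b" using emb_suc by blast
      have "Lf a b' \<or> Ef a b'" using x IH b'(1) assms(1) emb_unique unfolding less_suc by blast
      then show "Lf a b" using R.L_S b'(2) by blast
    qed
  qed (intro DA_rules, simp)
  then show "x \<prec> y \<Longrightarrow> Lf a b" using assms(2) by blast
qed

text \<open>Zero is least, and the successor of an element below \<open>y\<close> is below or equal
  to \<open>y\<close>; equality would put \<open>y\<close> into the image.\<close>

lemma nonstandard_above:
  assumes "\<And>x. \<not> emb x y" "emb x z"
  shows "Lf z y"
proof -
  have "\<forall>z. emb x z \<longrightarrow> Lf z y"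
  proof (rule DA_induction[OF PA, where P = "\<lambda>x. \<forall>z. emb x z \<longrightarrow> Lf z y"])
    show "\<forall>z. emb \<zero> z \<longrightarrow> Lf z y" using R.Z_least emb_E assms(1) emb_zero by blast
    fix x assume IH: "\<forall>z. emb x z \<longrightarrow> Lf z y"
    show "\<forall>z. emb (ss x) z \<longrightarrow> Lf z y"
    proof (intro allI impI)
      fix z assume z: "emb (ss x) z"
      then obtain w where "emb x w" "Sf w z" using emb_suc by blast
      then have "Lf z y \<or> Ef z y" using IH R.S_least by blast
      then show "Lf z y" using emb_E[OF z] assms(1) by blast
    qed
  qed (intro DA_rules)
  with assms(2) show ?thesis by blast
qed

lemma msat_trT:
  assumes "\<And>i. i \<in> fvT t \<Longrightarrow> emb (e i) (h (\<rho> i))"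
  shows "msat (Rel f) B h (trT t \<rho> r) \<longleftrightarrow> emb (ev M e t) (h r)"
  using assms
proof (induction t arbitrary: h \<rho> r)
  case (Var i)
  then have i: "emb (e i) (h (\<rho> i))" by simp
  show ?case using emb_E[OF i] emb_unique[OF i] by auto
next
  case Zero
  show ?case by (simp add: emb_zero)
next
  case (Succ t)
  have "msat (Rel f) B (case_nat v h) (trT t (\<lambda>i. Suc (\<rho> i)) 0) \<longleftrightarrow> emb (ev M e t) v" for v
    by (subst Succ.IH) (use Succ.prems in auto)
  then show ?case by (simp add: emb_suc)
next
  case (Plus s t)
  have s: "msat (Rel f) B (case_nat v (case_nat w h)) (trT s (\<lambda>i. Suc (Suc (\<rho> i))) (Suc 0)) \<longleftrightarrow> emb (ev M e s) w" for v w
    by (subst Plus.IH(1)) (use Plus.prems in auto)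
  have t: "msat (Rel f) B (case_nat v (case_nat w h)) (trT t (\<lambda>i. Suc (Suc (\<rho> i))) 0) \<longleftrightarrow> emb (ev M e t) v" for v w
    by (subst Plus.IH(2)) (use Plus.prems in auto)
  show ?case using emb_plus emb_total by (simp add: s t)
next
  case (Times s t)
  have s: "msat (Rel f) B (case_nat v (case_nat w h)) (trT s (\<lambda>i. Suc (Suc (\<rho> i))) (Suc 0)) \<longleftrightarrow> emb (ev M e s) w" for v w
    by (subst Times.IH(1)) (use Times.prems in auto)
  have t: "msat (Rel f) B (case_nat v (case_nat w h)) (trT t (\<lambda>i. Suc (Suc (\<rho> i))) 0) \<longleftrightarrow> emb (ev M e t) v" for v w
    by (subst Times.IH(2)) (use Times.prems in auto)
  show ?case using emb_times emb_total by (simp add: s t)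
qed

text \<open>The image is an initial segment, so the range of a quantifier bounded by the value of a
  term at embedded arguments consists of embedded elements.\<close>

lemma msat_bound:
  assumes "\<And>i. i \<in> fvT t \<Longrightarrow> emb (e i) (h i)"
  shows "msat (Rel f) B (case_nat z h) (tr (Less (Var 0) (liftT 0 t))) \<longleftrightarrow> (\<exists>x. x \<prec> ev M e t \<and> emb x z)"
proof -
  have t: "msat (Rel f) B (case_nat v (case_nat w (case_nat z h))) (trT (liftT 0 t) (\<lambda>i. Suc (Suc i)) 0) \<longleftrightarrow> emb (ev M e t) v"
    for v w
    by (subst msat_trT[where e = "case_nat undefined e"]) (use assms in \<open>auto simp: fvT_liftT\<close>)
  have "msat (Rel f) B (case_nat z h) (tr (Less (Var 0) (liftT 0 t))) \<longleftrightarrow>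
      (\<exists>w v. Ef z w \<and> emb (ev M e t) v \<and> Lf w v)"
    by (simp add: t)
  also have "\<dots> \<longleftrightarrow> (\<exists>x. x \<prec> ev M e t \<and> emb x z)"
    using emb_initial emb_E R.E_sym R.E_refl emb_less emb_total by (metis (no_types))
  finally show ?thesis .
qed

lemma emb_case_nat:
  assumes "emb x z" "\<And>i. Suc i \<in> fv \<phi> \<Longrightarrow> emb (e i) (h i)" "i \<in> fv \<phi>"
  shows "emb (case_nat x e i) (case_nat z h i)"
  using assms by (cases i) auto

lemma msat_Delta0:
  "Delta0 \<phi> \<Longrightarrow> (\<And>i. i \<in> fv \<phi> \<Longrightarrow> emb (e i) (h i)) \<Longrightarrow> msat (Rel f) B h (tr \<phi>) \<longleftrightarrow> holds M e \<phi>"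
proof (induction arbitrary: e h rule: Delta0.induct)
  case (1 s t)
  have "msat (Rel f) B (case_nat z h) (trT s Suc 0) \<longleftrightarrow> emb (ev M e s) z" for z
    by (subst msat_trT[where e = e]) (use 1 in auto)
  moreover have "msat (Rel f) B (case_nat z h) (trT t Suc 0) \<longleftrightarrow> emb (ev M e t) z" for z
    by (subst msat_trT[where e = e]) (use 1 in auto)
  ultimately have "msat (Rel f) B h (tr (Eq s t)) \<longleftrightarrow> (\<exists>z. emb (ev M e s) z \<and> emb (ev M e t) z)"
    by simp
  also have "\<dots> \<longleftrightarrow> ev M e s = ev M e t" using emb_total emb_inj by metis
  finally show ?case by simp
next
  case (2 s t)
  have "msat (Rel f) B (case_nat v (case_nat w h)) (trT s (\<lambda>i. Suc (Suc i)) (Suc 0)) \<longleftrightarrow> emb (ev M e s) w"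
    for v w by (subst msat_trT[where e = e]) (use 2 in auto)
  moreover have "msat (Rel f) B (case_nat v (case_nat w h)) (trT t (\<lambda>i. Suc (Suc i)) 0) \<longleftrightarrow> emb (ev M e t) v"
    for v w by (subst msat_trT[where e = e]) (use 2 in auto)
  ultimately have "msat (Rel f) B h (tr (Less s t)) \<longleftrightarrow> (\<exists>w v. emb (ev M e s) w \<and> emb (ev M e t) v \<and> Lf w v)"
    by simp
  also have "\<dots> \<longleftrightarrow> ev M e s \<prec> ev M e t" using emb_total emb_less by blast
  finally show ?case by simp
next
  case (3 \<phi>)
  have "msat (Rel f) B h (tr \<phi>) \<longleftrightarrow> holds M e \<phi>" by (rule 3) (use 3 in auto)
  then show ?case by simp
next
  case (4 \<phi> \<psi>)
  have "msat (Rel f) B h (tr \<phi>) \<longleftrightarrow> holds M e \<phi>" by (rule 4) (use 4 in auto)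
  moreover have "msat (Rel f) B h (tr \<psi>) \<longleftrightarrow> holds M e \<psi>" by (rule 4) (use 4 in auto)
  ultimately show ?case by simp
next
  case (5 \<phi> t)
  have t: "i \<in> fvT t \<Longrightarrow> emb (e i) (h i)" for i
    by (rule 5) (auto simp: ForallB_def fvT_liftT)
  have \<phi>: "msat (Rel f) B (case_nat z h) (tr \<phi>) \<longleftrightarrow> holds M (case_nat x e) \<phi>" if "emb x z" for x z
    by (rule 5, rule emb_case_nat[OF that, of \<phi>], rule 5) (auto simp: ForallB_def)
  have bound: "msat (Rel f) B (case_nat z h) (tr (Less (Var 0) (liftT 0 t)))
      \<longleftrightarrow> (\<exists>x. x \<prec> ev M e t \<and> emb x z)" for z
    by (rule msat_bound[OF t])
  have "msat (Rel f) B h (tr (ForallB t \<phi>)) \<longleftrightarrow>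
      (\<forall>z. (\<exists>x. x \<prec> ev M e t \<and> emb x z) \<longrightarrow> msat (Rel f) B (case_nat z h) (tr \<phi>))"
    unfolding ForallB_def tr.simps(4,5) msat.simps(4,5) using bound by blast
  also have "\<dots> \<longleftrightarrow> (\<forall>x. x \<prec> ev M e t \<longrightarrow> holds M (case_nat x e) \<phi>)"
    using \<phi> emb_total by blast
  finally show ?case by (simp add: ForallB_def)
next
  case (6 \<phi> t)
  have t: "i \<in> fvT t \<Longrightarrow> emb (e i) (h i)" for i
    by (rule 6) (auto simp: ExistsB_def Exists_def Conj_def fvT_liftT)
  have \<phi>: "msat (Rel f) B (case_nat z h) (tr \<phi>) \<longleftrightarrow> holds M (case_nat x e) \<phi>" if "emb x z" for x z
    by (rule 6, rule emb_case_nat[OF that, of \<phi>], rule 6) (auto simp: ExistsB_def Exists_def Conj_def)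
  have bound: "msat (Rel f) B (case_nat z h) (tr (Less (Var 0) (liftT 0 t)))
      \<longleftrightarrow> (\<exists>x. x \<prec> ev M e t \<and> emb x z)" for z
    by (rule msat_bound[OF t])
  have "msat (Rel f) B h (tr (ExistsB t \<phi>)) \<longleftrightarrow>
      (\<exists>z. (\<exists>x. x \<prec> ev M e t \<and> emb x z) \<and> msat (Rel f) B (case_nat z h) (tr \<phi>))"
    unfolding ExistsB_def Exists_def Conj_def tr.simps(3-5) msat.simps(3-5) using bound by blast
  also have "\<dots> \<longleftrightarrow> (\<exists>x. x \<prec> ev M e t \<and> holds M (case_nat x e) \<phi>)"
    using \<phi> emb_total by blast
  finally show ?case by (simp add: ExistsB_def)
qed

text \<open>Upward only: a witness can be embedded, whereas a witness in the interpreted structure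
  might have no preimage.\<close>

lemma msat_gS:
  "gS \<phi> \<Longrightarrow> (\<And>i. i \<in> fv \<phi> \<Longrightarrow> emb (e i) (h i)) \<Longrightarrow> holds M e \<phi> \<Longrightarrow> msat (Rel f) B h (tr \<phi>)"
proof (induction arbitrary: e h rule: gS.induct)
  case (gS_Delta0 \<phi>)
  then show ?case using msat_Delta0 by blast
next
  case (gS_Conj \<phi> \<psi>)
  have "msat (Rel f) B h (tr \<phi>)" by (rule gS_Conj.IH(1)) (use gS_Conj.prems in \<open>auto simp: Conj_def\<close>)
  moreover have "msat (Rel f) B h (tr \<psi>)" by (rule gS_Conj.IH(2)) (use gS_Conj.prems in \<open>auto simp: Conj_def\<close>)
  ultimately show ?case by (simp add: Conj_def)
next
  case (gS_Disj \<phi> \<psi>)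
  have "msat (Rel f) B h (tr \<phi>)" if "holds M e \<phi>"
    by (rule gS_Disj.IH(1)[OF _ that]) (use gS_Disj.prems in \<open>auto simp: Disj_def\<close>)
  moreover have "msat (Rel f) B h (tr \<psi>)" if "holds M e \<psi>"
    by (rule gS_Disj.IH(2)[OF _ that]) (use gS_Disj.prems in \<open>auto simp: Disj_def\<close>)
  ultimately show ?case using gS_Disj.prems by (auto simp: Disj_def)
next
  case (gS_Exists \<phi>)
  then obtain x where x: "holds M (case_nat x e) \<phi>" by auto
  obtain z where z: "emb x z" using emb_total by blast
  have "msat (Rel f) B (case_nat z h) (tr \<phi>)"
    by (rule gS_Exists.IH[OF _ x], rule emb_case_nat[OF z, of \<phi>], rule gS_Exists.prems) (auto simp: Exists_def)
  then show ?case by (auto simp: Exists_def)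
next
  case (gS_ForallB \<phi> t)
  have t: "i \<in> fvT t \<Longrightarrow> emb (e i) (h i)" for i
    by (rule gS_ForallB.prems) (auto simp: ForallB_def fvT_liftT)
  have "msat (Rel f) B (case_nat z h) (tr \<phi>)" if z: "emb x z" "x \<prec> ev M e t" for x z
  proof (rule gS_ForallB.IH)
    show "holds M (case_nat x e) \<phi>" using gS_ForallB.prems(2) z(2) by (simp add: ForallB_def)
    show "emb (case_nat x e i) (case_nat z h i)" if "i \<in> fv \<phi>" for i
      by (rule emb_case_nat[OF z(1) _ that], rule gS_ForallB.prems) (auto simp: ForallB_def)
  qed
  moreover have "msat (Rel f) B (case_nat z h) (tr (Less (Var 0) (liftT 0 t)))
      \<longleftrightarrow> (\<exists>x. x \<prec> ev M e t \<and> emb x z)" for z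
    by (rule msat_bound[OF t])
  ultimately show ?case unfolding ForallB_def tr.simps(4,5) msat.simps(4,5) by blast
qed

text \<open>A universal quantifier over the interpreted structure covers the image. Here the
  restriction to \<Pi>1 formulas enters the main theorem.\<close>

lemma msat_Pi1:
  assumes "Pi1 \<phi>" "\<And>i. i \<in> fv \<phi> \<Longrightarrow> emb (e i) (h i)" "msat (Rel f) B h (tr \<phi>)"
  shows "holds M e \<phi>"
proof -
  have "holds M e ((Forall ^^ n) \<delta>)" if \<delta>: "Delta0 \<delta>" and
    "\<And>i. i \<in> fv ((Forall ^^ n) \<delta>) \<Longrightarrow> emb (e i) (h i)" "msat (Rel f) B h (tr ((Forall ^^ n) \<delta>))" for n \<delta>
    using that(2,3)
  proof (induction n arbitrary: e h)
    case 0
    then show ?case using msat_Delta0[OF \<delta>, of e h B] by simp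
  next
    case (Suc n)
    have "holds M (case_nat x e) ((Forall ^^ n) \<delta>)" for x
    proof -
      obtain z where z: "emb x z" using emb_total by blast
      show ?thesis
      proof (rule Suc.IH)
        show "emb (case_nat x e i) (case_nat z h i)" if "i \<in> fv ((Forall ^^ n) \<delta>)" for i
          by (rule emb_case_nat[OF z _ that]) (use Suc.prems(1) in simp)
      qed (use Suc.prems(2) in simp)
    qed
    then show ?case by simp
  qed
  then show ?thesis using assms unfolding Pi1_def by blast
qed

end

section \<open>Reflection in extensions of PA\<close>

text \<open>\<open>XI f\<close> says of \<open>v, a, b\<close> that \<open>v\<close>, embedded, belongs to the set coded by \<open>a, b\<close>; \<open>PSI f\<close> is
  the diagonal sentence with \<open>a, b\<close> and the code \<open>g\<close> of \<open>\<not> XI f\<close> as parameters.\<close>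

definition XI :: "(nat \<Rightarrow> nat \<Rightarrow> fm) \<Rightarrow> fm" where
  "XI f = Exists (Conj (ren (\<lambda>i. if i = 0 then 1 else 0) (EMB f)) (ren (\<lambda>i. if i = 0 then 0 else Suc i) (f 6 3)))"

definition PSI :: "(nat \<Rightarrow> nat \<Rightarrow> fm) \<Rightarrow> fm" where
  "PSI f = Forall (Imp (Eq (Var 0) (Var 3)) (Neg (XI f)))"

lemma foldr_Conj_Bx:
  assumes T: "good_theory T \<tau>" and M: "isigma1 M" 
    and "\<And>\<phi>. \<phi> \<in> set \<phi>s \<Longrightarrow> isigma1.Bx M \<tau> \<phi> e" "isigma1.Bx M \<tau> \<psi> e"
  shows "isigma1.Bx M \<tau> (foldr Conj \<phi>s \<psi>) e"
proof -
  interpret isigma1 M by fact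
  show ?thesis using assms(3,4) by (induction \<phi>s) (simp_all add: Bx_Conj[OF T])
qed

context pa_rel
begin

lemma fv_XI: "fv (XI f) \<subseteq> {0, 1, 2}"
  using fv_EMB[of f] by (auto simp: XI_def Exists_def Conj_def fv_ren fv_f)

lemma holds_XI: "holds M e (XI f) \<longleftrightarrow> (\<exists>z. emb (e 0) z \<and> Qf z (e 1) (e 2))"
  by (simp add: XI_def holds_ren holds_EMB Rel3[OF refl refl refl] numeral_2_eq_2)

lemma fv_PSI: "fv (PSI f) \<subseteq> {0, 1, 2}"
  using fv_XI by (fastforce simp: PSI_def)

lemma holds_PSI: "holds M e (PSI f) \<longleftrightarrow> \<not> (\<exists>z. emb (e 2) z \<and> Qf z (e 0) (e 1))"
  by (simp add: PSI_def holds_XI numeral_3_eq_3 numeral_2_eq_2)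

end

lemma base_pa_rel:
  fixes M :: "'a la_str"
  assumes "models M PA" "arith_interp f" "defining \<tau>" "holds M e (interp f \<tau> base)"
  shows "pa_rel M f"
proof -
  interpret isigma1 M by (rule isigma1_PA[OF assms(1)])
  have "rel_arith_of (Rel f)"
    using assms(4) unfolding holds_interp[OF assms(2,3)] msat_base .
  then show ?thesis by (intro pa_rel.intro pa_rel_axioms.intro assms isigma1_axioms)
qed

locale reflecting = pa_rel M f for M :: "'a la_str" and f +
  fixes T \<tau> B h
  assumes T: "good_theory T \<tau>" and PA_T: "Th PA \<subseteq> Th T"
    and B: "B = (\<lambda>h A. Bx \<tau> (interp f \<tau> A) h)"
    and Bx_base: "Bx \<tau> (interp f \<tau> base) h"
    and rigid: "msat (Rel f) B h rigid"
    and separation: "msat (Rel f) B h (separation \<tau>)"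
begin

lemma wfd: "defining \<tau>"
  by (rule good_defining[OF T])

text \<open>Inside the box the interpreted axioms may be assumed. Models of \<open>T\<close>
  satisfying them are again of the kind \<open>pa_rel\<close>, as \<open>T\<close> proves PA, so
  everything known about embeddings holds in them.\<close>

lemma Bx_derive:
  assumes "Bx \<tau> \<phi> e"
    and "\<And>(N :: nat la_str) e. pa_rel N f \<Longrightarrow> holds N e \<phi> \<Longrightarrow> holds N e \<psi>"
  shows "Bx \<tau> \<psi> e"
proof -
  have "Bx \<tau> (interp f \<tau> base) e"
    using Bx_base by (rule Bx_cong[THEN iffD1, rotated]) (simp add: fv_interp_base[OF f])
  then have "Bx \<tau> (Conj (interp f \<tau> base) \<phi>) e" using assms(1) by (rule Bx_Conj[OF T])
  then show ?thesis
  proof (rule Bx_valid_Imp[OF T])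
    fix N :: "nat la_str" and e
    assume N: "models N T" and *: "holds N e (Conj (interp f \<tau> base) \<phi>)"
    have "pa_rel N f"
      by (rule base_pa_rel[OF models_Th[OF N PA_T LA_theory_PA] f wfd, of e]) (use * in simp)
    then show "holds N e \<psi>" using assms(2) * by simp
  qed
qed

lemma Z_rigid: "Zf z \<Longrightarrow> Bx \<tau> (f 0 1) (\<lambda>_. z)"
proof -
  assume "Zf z"
  then have "Bx \<tau> (f 0 1) (\<lambda>i. case_nat z h ([0] ! i))"
    using rigid by (simp add: rigid_def B Bx_ren)
  then show ?thesis by (rule Bx_cong[THEN iffD1, rotated]) (simp add: fv_f)
qed

lemma S_rigid: "Sf y z \<Longrightarrow> Bx \<tau> (f 1 2) (case_nat y (\<lambda>_. z))"
proof -
  assume "Sf y z"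
  then have "Bx \<tau> (f 1 2) (\<lambda>i. case_nat z (case_nat y h) ([1, 0] ! i))"
    using rigid by (simp add: rigid_def B Bx_ren numeral_2_eq_2)
  then show ?thesis
    by (rule Bx_cong[THEN iffD1, rotated]) (auto simp: fv_f numeral_2_eq_2 less_Suc_eq)
qed

lemma Q_rigid:
  shows "Qf x a b \<Longrightarrow> Bx \<tau> (f 6 3) ((!) [x, a, b])"
    and "\<not> Qf x a b \<Longrightarrow> Bx \<tau> (Neg (f 6 3)) ((!) [x, a, b])"
proof -
  have *: "Bx \<tau> (ren (\<lambda>i. [2, 1, 0] ! i) \<phi>) (case_nat b (case_nat a (case_nat x h))) \<longleftrightarrow> Bx \<tau> \<phi> ((!) [x, a, b])"
    if "fv \<phi> \<subseteq> {..<3}" for \<phi>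
    unfolding Bx_ren
  proof (rule Bx_cong)
    fix i assume "i \<in> fv \<phi>"
    with that have "i < 3" by auto
    then consider "i = 0" | "i = 1" | "i = 2" by linarith
    then show "case_nat b (case_nat a (case_nat x h)) ([2, 1, 0] ! i) = [x, a, b] ! i" by cases simp_all
  qed
  show "Bx \<tau> (f 6 3) ((!) [x, a, b])" if "Qf x a b"
    using that rigid *[of "f 6 3"] by (simp add: fv_f rigid_def B numeral_3_eq_3 numeral_2_eq_2)
  show "Bx \<tau> (Neg (f 6 3)) ((!) [x, a, b])" if "\<not> Qf x a b"
    using that rigid *[of "Neg (f 6 3)"] by (simp add: fv_f rigid_def B numeral_3_eq_3 numeral_2_eq_2)
qed

text \<open>Rigidity of zero and successor is propagated by induction on \<open>x\<close>. As
  \<open>f\<close> is arbitrary the induction formula has no particular complexity, so induction of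
  full PA is applied in the model.\<close>

lemma emb_rigid: "emb x z \<Longrightarrow> Bx \<tau> (EMB f) (case_nat x (\<lambda>_. z))"
proof -
  have eq: "Bx \<tau> (EMB f) (case_nat (e 0) (\<lambda>_. e 1)) \<longleftrightarrow> Bx \<tau> (EMB f) e" for e
    using fv_EMB[of f] by (intro Bx_cong) auto
  have "\<forall>z. emb x z \<longrightarrow> Bx \<tau> (EMB f) (case_nat x (\<lambda>_. z))"
  proof (rule DA_induction[OF PA, where P = "\<lambda>x. \<forall>z. emb x z \<longrightarrow> Bx \<tau> (EMB f) (case_nat x (\<lambda>_. z))"])
    have "DA M (\<lambda>e. Bx \<tau> (EMB f) (case_nat (e 0) (\<lambda>_. e 1)))"
      unfolding eq using DA_holds[of M "Pr_dot \<tau> (EMB f)"] by (simp add: wfd)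
    then have DA_Bx: "DA M (\<lambda>e. Bx \<tau> (EMB f) (case_nat (s e) (\<lambda>_. t e)))" if "DT M s" "DT M t" for s t
      using DF_rel3[of "\<lambda>_. True" M "\<lambda>x y z. Bx \<tau> (EMB f) (case_nat x (\<lambda>_. y))" s t t] that by simp
    then show "DA M (\<lambda>e. \<forall>z. emb (e 0) z \<longrightarrow> Bx \<tau> (EMB f) (case_nat (e 0) (\<lambda>_. z)))"
      by (intro DA_rules DA_Bx)
    show "\<forall>z. emb \<zero> z \<longrightarrow> Bx \<tau> (EMB f) (case_nat \<zero> (\<lambda>_. z))"
    proof (intro allI impI)
      fix z assume "emb \<zero> z"
      then have "Bx \<tau> (f 0 1) (\<lambda>_. z)" using Z_rigid by (simp add: emb_zero)
      \<comment> \<open>Zero is substituted as a term so that \<open>emb_zero\<close> applies in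
        \<open>N\<close>; \<open>Bx_sb\<close> then identifies it with the dotted argument. The
        induction step treats the successor alike.\<close>
      then have "Bx \<tau> (sb (case_nat Zero Var) (EMB f)) (\<lambda>_. z)"
      proof (rule Bx_derive)
        fix N :: "nat la_str" and e
        assume "pa_rel N f" then interpret N: pa_rel N f .
        assume "holds N e (f 0 1)"
        moreover have "holds N e (f 0 1) \<longleftrightarrow> holds N (\<lambda>_. e 0) (f 0 1)"
          by (rule holds_cong) (simp add: fv_f)
        ultimately show "holds N e (sb (case_nat Zero Var) (EMB f))"
          by (simp add: holds_sb N.holds_EMB N.emb_zero N.Rel1)
      qed
      moreover have "Bx \<tau> (sb (case_nat Zero Var) (EMB f)) (\<lambda>_. z) \<longleftrightarrow> Bx \<tau> (EMB f) (case_nat \<zero> (\<lambda>_. z))"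
        by (rule Bx_sb) (simp add: nd_def split: nat.split)
      ultimately show "Bx \<tau> (EMB f) (case_nat \<zero> (\<lambda>_. z))" by blast
    qed
    fix x assume IH: "\<forall>z. emb x z \<longrightarrow> Bx \<tau> (EMB f) (case_nat x (\<lambda>_. z))"
    show "\<forall>z. emb (ss x) z \<longrightarrow> Bx \<tau> (EMB f) (case_nat (ss x) (\<lambda>_. z))"
    proof (intro allI impI)
      fix z assume "emb (ss x) z"
      then obtain y where y: "emb x y" "Sf y z" using emb_suc by blast
      let ?E = "case_nat x (case_nat y (\<lambda>_. z))"
      have "Bx \<tau> (EMB f) (case_nat x (\<lambda>_. y)) \<longleftrightarrow> Bx \<tau> (EMB f) ?E"
        using fv_EMB[of f] by (intro Bx_cong) auto
      then have "Bx \<tau> (Conj (EMB f) (ren Suc (f 1 2))) ?E"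
        using IH y(1) S_rigid[OF y(2)] by (intro Bx_Conj[OF T]) (simp_all add: Bx_ren)
      then have "Bx \<tau> (sb (case_nat (Succ (Var 0)) (\<lambda>i. Var (Suc (Suc i)))) (EMB f)) ?E"
      proof (rule Bx_derive)
        fix N :: "nat la_str" and e
        assume "pa_rel N f" then interpret N: pa_rel N f .
        assume "holds N e (Conj (EMB f) (ren Suc (f 1 2)))"
        then show "holds N e (sb (case_nat (Succ (Var 0)) (\<lambda>i. Var (Suc (Suc i)))) (EMB f))"
          by (auto simp: holds_sb holds_ren N.holds_EMB N.emb_suc N.Rel2[OF refl refl])
      qed
      moreover have "Bx \<tau> (sb (case_nat (Succ (Var 0)) (\<lambda>i. Var (Suc (Suc i)))) (EMB f)) ?E
          \<longleftrightarrow> Bx \<tau> (EMB f) (case_nat (ss x) (\<lambda>_. z))"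
        by (rule Bx_sb) (simp add: nd_def split: nat.split)
      ultimately show "Bx \<tau> (EMB f) (case_nat (ss x) (\<lambda>_. z))" by blast
    qed
  qed
  then show "emb x z \<Longrightarrow> Bx \<tau> (EMB f) (case_nat x (\<lambda>_. z))" by blast
qed

text \<open>The internal version of Tennenbaum's theorem: a nonstandard element would code a set that is
  decided by \<open>\<tau>\<close> and separates the provable from the refutable diagonal sentences.\<close>

lemma all_standard: "\<exists>x. emb x y"
proof (rule ccontr)
  assume y: "\<not> (\<exists>x. emb x y)"
  obtain a b where ab: "\<And>x. Lf x y \<Longrightarrow>
      (msat (Rel f) B (case_nat x (case_nat b (case_nat a (case_nat y h)))) (tr (DPr \<tau>)) \<longrightarrow> Qf x a b) \<and>
      (msat (Rel f) B (case_nat x (case_nat b (case_nat a (case_nat y h)))) (tr (DRef \<tau>)) \<longrightarrow> \<not> Qf x a b)"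
    using separation by (simp add: separation_def numeral_3_eq_3 numeral_2_eq_2) blast
  \<comment> \<open>The code of the formula saying that the image of v is not in the coded set, with
    numerals for \<open>a\<close> and \<open>b\<close>; the offset 1 leaves v a variable.\<close>
  define g where "g = ev M (nd ((!) [a, b])) (dot 1 (Neg (XI f)))"
  let ?e = "(!) [a, b, g]"
  have eq: "ev M (nd ?e) (dot 1 (Neg (XI f))) = ev M (nd ((!) [a, b])) (dot 1 (Neg (XI f)))"
  proof (rule ev_cong)
    fix i assume "i \<in> fvT (dot 1 (Neg (XI f)))"
    then have "Suc i \<in> fv (XI f)" unfolding fvT_dot by simp
    then have "i < 2" using fv_XI by auto
    then show "nd ?e i = nd ((!) [a, b]) i" by (auto simp: nd_def less_2_cases_iff)
  qed
  \<comment> \<open>The dotted \<open>PSI f\<close> is literally the diagonal sentence of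
    \<open>g\<close>, so no fixed point lemma is called for.\<close>
  have diag: "ev M (nd ?e) (dot 0 (PSI f)) = mDiag g"
    using eq[folded g_def] by (simp add: PSI_def mDiag_def nd_def[of _ 2])
  obtain z where z: "emb g z" using emb_total by blast
  then have zy: "Lf z y" using nonstandard_above y by blast
  let ?h = "case_nat z (case_nat b (case_nat a (case_nat y h)))"
  have up: "msat (Rel f) B h' (tr \<phi>)" if "gS \<phi>" "fv \<phi> \<subseteq> {0}" "h' 0 = z" "holds M (\<lambda>_. g) \<phi>" for h' \<phi>
    using msat_gS[OF that(1), of "\<lambda>_. g" h'] that z by auto
  have gS: "gS \<tau>" using wfd by (simp add: defining_def)
  \<comment> \<open>The renaming to 0 in both definitions gives this without computing the free
    variables of \<open>Pr\<close>.\<close>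
  have fvD: "fv (DPr \<tau>) \<subseteq> {0}" "fv (DRef \<tau>) \<subseteq> {0}"
    by (auto simp: DPr_def DRef_def fv_ren)
  let ?E = "(!) [a, b, g, z]"
  have emb: "Bx \<tau> (ren (\<lambda>i. if i = 0 then 2 else 3) (EMB f)) ?E"
    using emb_rigid[OF z] unfolding Bx_ren
    by (rule Bx_cong[THEN iffD1, rotated]) (use fv_EMB[of f] in auto)
  have E: "Bx \<tau> \<phi> ?E \<longleftrightarrow> Bx \<tau> \<phi> ?e" if "fv \<phi> \<subseteq> {0, 1, 2}" for \<phi>
    using that by (intro Bx_cong) auto
  have Q: "Bx \<tau> (ren (\<lambda>i. if i = 0 then 3 else i - 1) \<phi>) ?E" if "Bx \<tau> \<phi> ((!) [z, a, b])" "fv \<phi> \<subseteq> {..<3}" for \<phi>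
    using that(1) unfolding Bx_ren
  proof (rule Bx_cong[THEN iffD1, rotated])
    fix i assume "i \<in> fv \<phi>"
    with that(2) have "i < 3" by auto
    then consider "i = 0" | "i = 1" | "i = 2" by linarith
    then show "[z, a, b] ! i = ?E (if i = 0 then 3 else i - 1)" by cases simp_all
  qed
  show False
  proof (cases "Qf z a b")
    case True
    \<comment> \<open>Membership of the image of \<open>g\<close> is provable by rigidity, so the
      sentence denying it is refutable; as a \<Sigma>1 fact about \<open>g\<close> this ascends to
      \<open>z\<close>, and separation then puts \<open>z\<close> outside the set. The other case is
      dual.\<close>
    have "Bx \<tau> (Conj (ren (\<lambda>i. if i = 0 then 2 else 3) (EMB f))
        (ren (\<lambda>i. if i = 0 then 3 else i - 1) (f 6 3))) ?E"
      by (intro Bx_Conj[OF T] emb Q Q_rigid(1)[OF True]) (simp add: fv_f)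
    then have "Bx \<tau> (Neg (PSI f)) ?E"
    proof (rule Bx_derive)
      fix N :: "nat la_str" and e
      assume "pa_rel N f" then interpret N: pa_rel N f .
      assume "holds N e (Conj (ren (\<lambda>i. if i = 0 then 2 else 3) (EMB f))
        (ren (\<lambda>i. if i = 0 then 3 else i - 1) (f 6 3)))"
      then show "holds N e (Neg (PSI f))"
        by (auto simp: holds_ren N.holds_EMB N.holds_PSI N.Rel3[OF refl refl refl])
    qed
    then have "Prv \<tau> (mNeg (mDiag g))" using E[of "Neg (PSI f)"] fv_PSI by (simp add: Bx_def diag)
    moreover have "Frm g" unfolding g_def by (rule Frm_dot)
    ultimately have "msat (Rel f) B ?h (tr (DRef \<tau>))"
      by (intro up gS_DRef gS fvD) (simp_all add: wfd)
    then show False using ab[OF zy] True by blast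
  next
    case False
    have "Bx \<tau> (Conj (ren (\<lambda>i. if i = 0 then 2 else 3) (EMB f))
        (ren (\<lambda>i. if i = 0 then 3 else i - 1) (Neg (f 6 3)))) ?E"
      by (intro Bx_Conj[OF T] emb Q Q_rigid(2)[OF False]) (simp add: fv_f)
    then have "Bx \<tau> (PSI f) ?E"
    proof (rule Bx_derive)
      fix N :: "nat la_str" and e
      assume "pa_rel N f" then interpret N: pa_rel N f .
      assume "holds N e (Conj (ren (\<lambda>i. if i = 0 then 2 else 3) (EMB f))
        (ren (\<lambda>i. if i = 0 then 3 else i - 1) (Neg (f 6 3))))"
      then have "N.emb (e 2) (e 3)" "\<not> N.Qf (e 3) (e 0) (e 1)"
        by (simp_all add: holds_ren N.holds_EMB N.Rel3[OF refl refl refl])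
      \<comment> \<open>\<open>PSI\<close> denies membership for every image of \<open>g\<close>;
        the images are equal up to interpreted equality, which \<open>Q\<close> respects in its
        first place.\<close>
      then show "holds N e (PSI f)"
        unfolding N.holds_PSI using N.emb_unique N.R.Q_cong by blast
    qed
    then have "Prv \<tau> (mDiag g)" using E[of "PSI f"] fv_PSI by (simp add: Bx_def diag)
    then have "msat (Rel f) B ?h (tr (DPr \<tau>))"
      by (intro up gS_DPr gS fvD) (simp_all add: wfd)
    then show False using ab[OF zy] False by blast
  qed
qed

text \<open>That the translated formula at images implies \<open>\<phi>\<close> at the preimages is
  a theorem of \<open>T\<close> by \<open>msat_Pi1\<close>; it is boxed, and the resulting \<Sigma>1
  statement about the preimages ascends.\<close>

theorem reflect:
  assumes \<phi>: "Pi1 \<phi>" and box: "Bx \<tau> (interp f \<tau> (tr \<phi>)) h"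
  shows "msat (Rel f) B h (tr (Pr_dot \<tau> \<phi>))"
proof -
  have "\<forall>i. \<exists>x. emb x (h i)" using all_standard by blast
  then obtain e where e: "\<And>i. emb (e i) (h i)" using choice[of "\<lambda>i x. emb x (h i)"] by blast
  \<comment> \<open>Preimages at the even places and their images at the odd ones, so that one
    environment serves both \<open>\<phi>\<close> and its translation.\<close>
  let ?E = "mg e h" and ?m = "fv_bound \<phi>"
  let ?emb = "\<lambda>i. ren (\<lambda>j. if j = 0 then 2 * i else 2 * i + 1) (EMB f)"
  let ?hyp = "ren (\<lambda>i. 2 * i + 1) (interp f \<tau> (tr \<phi>))"
  have emb: "Bx \<tau> (?emb i) ?E" for i
    using emb_rigid[OF e[of i]] unfolding Bx_ren
    by (rule Bx_cong[THEN iffD1, rotated]) (use fv_EMB[of f] in \<open>auto simp: mg_def\<close>)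
  have "Bx \<tau> ?hyp ?E" using box by (simp add: Bx_ren mg_def)
  then have "Bx \<tau> (foldr Conj (map ?emb [0..<?m]) ?hyp) ?E"
    using emb by (intro foldr_Conj_Bx[OF T]) (auto intro: isigma1_axioms)
  then have "Bx \<tau> (ren (\<lambda>i. 2 * i) \<phi>) ?E"
  proof (rule Bx_derive)
    fix N :: "nat la_str" and e
    assume "pa_rel N f" then interpret N: pa_rel N f .
    assume *: "holds N e (foldr Conj (map ?emb [0..<?m]) ?hyp)"
    have "N.emb (e (2 * i)) (e (2 * i + 1))" if "i \<in> fv \<phi>" for i
      using * fv_bound[of \<phi>] that by (auto simp: N.holds_foldr_Conj holds_ren N.holds_EMB)
    moreover have "msat (N.Rel f) (\<lambda>h A. N.Bx \<tau> (interp f \<tau> A) h) (\<lambda>i. e (2 * i + 1)) (tr \<phi>)"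
      using * by (simp add: N.holds_foldr_Conj holds_ren N.holds_interp[OF f wfd])
    ultimately show "holds N e (ren (\<lambda>i. 2 * i) \<phi>)"
      unfolding holds_ren by (rule N.msat_Pi1[OF \<phi>])
  qed
  then have "holds M e (Pr_dot \<tau> \<phi>)" by (simp add: wfd Bx_ren mg_def)
  then show ?thesis
    by (intro msat_gS[of _ e] gS_Pr_dot e) (use wfd in \<open>simp add: defining_def\<close>)
qed

end

theorem reflection_valid:
  assumes T: "good_theory T \<tau>" and PA: "Th PA \<subseteq> Th T" and f: "arith_interp f" and \<phi>: "Pi1 \<phi>"
  shows "T \<turnstile> interp f \<tau> (reflection \<tau> \<phi>)"
proof (rule good_complete[OF T])
  fix M :: "nat la_str" and h
  assume M: "models M T" and "isigma1 M"
  interpret isigma1 M by fact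
  note wf = good_defining[OF T]
  let ?B = "\<lambda>h A. Bx \<tau> (interp f \<tau> A) h"
  show "holds M h (interp f \<tau> (reflection \<tau> \<phi>))"
    unfolding holds_interp[OF f wf] reflection_def msat.simps msat_MConjs
  proof
    assume *: "\<forall>A\<in>set [base, MBox base, rigid, separation \<tau>, MBox (tr \<phi>)]. msat (Rel f) ?B h A"
    have "pa_rel M f"
      by (rule pa_rel.intro[OF isigma1_axioms pa_rel_axioms.intro])
        (use * models_Th[OF M PA LA_theory_PA] f in \<open>simp_all add: msat_base\<close>)
    then interpret reflecting M f T \<tau> ?B h
      by (intro reflecting.intro reflecting_axioms.intro T PA refl) (use * in simp_all)
    show "msat (Rel f) ?B h (tr (Pr_dot \<tau> \<phi>))" using reflect[OF \<phi>] * by simp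
  qed
qed

theorem theorem3p9:
  fixes T\<^sub>0 T\<^sub>1 :: "fm set" and \<tau>\<^sub>0 \<tau>\<^sub>1 :: fm
  assumes "LA_theory T\<^sub>0" and "LA_theory T\<^sub>1"
    and "rec_enumerable (gn ` T\<^sub>0)" and "rec_enumerable (gn ` T\<^sub>1)"
    and "Th ISigma1 \<subseteq> Th T\<^sub>0" and "Th ISigma1 \<subseteq> Th T\<^sub>1"
    and "Sigma1 \<tau>\<^sub>0" and "is_definition \<tau>\<^sub>0 T\<^sub>0"
    and "Sigma1 \<tau>\<^sub>1" and "is_definition \<tau>\<^sub>1 T\<^sub>1"
    and "Th PA \<subseteq> Th T\<^sub>0"
    and "QPL \<tau>\<^sub>0 T\<^sub>0 \<subseteq> QPL \<tau>\<^sub>1 T\<^sub>1"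
  shows "\<forall>\<phi>. Pi1 \<phi> \<longrightarrow> T\<^sub>1 \<turnstile> univ_closure (Imp (Pr_dot \<tau>\<^sub>1 \<phi>) (Pr_dot \<tau>\<^sub>0 \<phi>))"
proof (intro allI impI)
  fix \<phi> assume \<phi>: "Pi1 \<phi>"
  have T0: "good_theory T\<^sub>0 \<tau>\<^sub>0" and T1: "good_theory T\<^sub>1 \<tau>\<^sub>1"
    using assms by (simp_all add: good_theory_def)
  have "mclosure (reflection \<tau>\<^sub>0 \<phi>) \<in> QPL \<tau>\<^sub>0 T\<^sub>0"
    unfolding mclosure_QPL[OF assms(1)] using reflection_valid[OF T0 assms(11) _ \<phi>] by blast
  \<comment> \<open>From here on the boxes of the formula mean provability for
    \<open>\<tau>\<^sub>1\<close>, while the translated parts still speak of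
    \<open>\<tau>\<^sub>0\<close>.\<close>
  then have refl: "\<And>f. arith_interp f \<Longrightarrow> T\<^sub>1 \<turnstile> interp f \<tau>\<^sub>1 (reflection \<tau>\<^sub>0 \<phi>)"
    using assms(12) mclosure_QPL[OF assms(2)] by blast
  have "T\<^sub>1 \<turnstile> Imp (Pr_dot \<tau>\<^sub>1 \<phi>) (Pr_dot \<tau>\<^sub>0 \<phi>)"
  proof (rule good_complete[OF T1])
    fix M :: "nat la_str" and e
    assume M: "models M T\<^sub>1" and "isigma1 M"
    interpret isigma1 M by fact
    show "holds M e (Imp (Pr_dot \<tau>\<^sub>1 \<phi>) (Pr_dot \<tau>\<^sub>0 \<phi>))"
      using provable_transfer[OF T1 M good_defining[OF T0] refl]
      by (simp add: good_defining[OF T0] good_defining[OF T1])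
  qed
  then show "T\<^sub>1 \<turnstile> univ_closure (Imp (Pr_dot \<tau>\<^sub>1 \<phi>) (Pr_dot \<tau>\<^sub>0 \<phi>))"
    by (simp add: proves_univ_closure_iff[OF assms(2)])
qed

end
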